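(* Let $H$, $Q$, $(e_j)$, $(q_j)$, $W$, $\|\cdot\|_Q$, $K_R(a)$ and $\mathcal{V}_\infty(H)$ be as in the context, and let $F\colon H\to H$ be Borel measurable. Assume: (ii) $F$ is bounded: $\sup_{x\in H}\|F(x)\|<+\infty$; (iii) for every initial condition $\eta\in\mathcal{V}_\infty(H)$ that is independent of $(W_t)_{t\ge 0}$, the equation $dX_t=dW_t+F(X_t)\,dt$, $X_0=\eta$, has a strong solution $(X_t)_{t\ge0}$ with $X_t\in\mathcal{V}_\infty(H)$ for each $t\ge 0$, and the Cauchy problem $$\partial_t\mu_t=\tfrac12 \sum_i q_i\,\partial^2_{e_ie_i}\mu_t-\sum_i\partial_{e_i}(b^i\mu_t),\qquad \mu_0=\mathrm{Law}(\eta),\qquad b^i(x)=\langle F(x),e_i\rangle,$$ has a unique probability solution $(\mu_t)_{t\ge 0}$. Then for every initial condition $\eta\in\mathcal{V}_\infty(H)$ independent of $(W_t)_{t\ge0}$, every $T>0$, every $a\in H$ and every $R>0$, the solution of the Cauchy problem with $\mu_0=\mathrm{Law}(\eta)$ satisfies $$\mu_T(K_R(a))>0,$$ or, equivalently, $\mathbb{P}(X_T\in K_R(a))>0$.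
   Context: $H$ is a separable (infinite-dimensional) real Hilbert space with inner product $\langle\cdot,\cdot\rangle$, norm $\|\cdot\|$ and Borel $\sigma$-field $\mathcal{B}(H)$. $Q\colon H\to H$ is a positive self-adjoint operator with finite trace, with orthonormal basis of eigenvectors $(e_j)_{j\ge1}$ and eigenvalues $1=q_1\ge q_2\ge\dots>0$, $\mathrm{tr}\,Q=\sum_{j\ge1}q_j<\infty$. $(W_t)_{t\ge0}$ is an $H$-valued Wiener process with covariance operator $Q$ on a probability space $(\Omega,\mathcal{F},\mathbb{P})$, i.e. $W_t=\sum_{j\ge1}\sqrt{q_j}\,\beta^j_t e_j$ with independent standard real Wiener processes $\beta^j$, so that $\mathbb{E}\langle W_t,u\rangle\langle W_s,v\rangle=\min\{t,s\}\langle Qu,v\rangle$. The weighted norm is $\|x\|_Q=\langle Qx,x\rangle^{1/2}=\bigl(\sum_j q_j\langle x,e_j\rangle^2\bigr)^{1/2}$, and the ellipsoid with center $a\in H$ and parameter $R$ is $K_R(a)=\{x\in H:\|x-a\|_Q\le R\}$. $\mathcal{V}_\infty(H)$ is the set of $H$-valued random variables $\xi$ with finite moments of all orders ($\mathbb{E}\|\xi\|^p<\infty$ for all $p$). $\mathcal{FC}_0^\infty(H)$ is the class of functions $\phi(x)=\phi_0(x_1,\dots,x_m)$, $x_j=\langle x,e_j\rangle$, with $m\in\mathbb{N}$ and $\phi_0$ smooth with compact support in $\mathbb{R}^m$. For an initial condition $\eta$ independent of $W$, $(\mathcal{F}_t)_{t\ge0}$ denotes the filtration generated by $\eta$ and $W$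 (completed by null sets). A strong solution of $dX_t=dW_t+F(X_t)dt$, $X_0=\eta$, is an $\mathcal{F}_t$-adapted $H$-valued process $(X_t)_{t\ge0}$ such that $\mathbb{P}$-a.s. for all $t\ge0$, $X_t=\eta+W_t+\int_0^tF(X_s)\,ds$ (Bochner integral). A probability solution of the Cauchy problem with initial measure $\nu$ is a family $(\mu_t)_{t\ge0}$ of probability measures on $(H,\mathcal{B}(H))$ (measurable in $t$) such that for all $t\ge0$ and all $\phi\in\mathcal{FC}_0^\infty(H)$, $\int\phi\,d\mu_t-\int\phi\,d\nu=\int_0^t\int\mathcal{L}\phi\,d\mu_s\,ds$, where $\mathcal{L}\phi=\sum_{i\ge1}\tfrac12q_i\,\partial^2_{e_ie_i}\phi+\sum_{i\ge1}b^i\,\partial_{e_i}\phi$. The laws $\mathrm{Law}(X_t)$ of the strong solution are a probability solution with $\nu=\mathrm{Law}(\eta)$, so by uniqueness $\mu_t=\mathrm{Law}(X_t)$. *)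

theory Defs
  imports "HOL-Probability.Probability"
begin

section \<open>The Hilbert space and the operator \<open>Q\<close>\<close>

text \<open>
  The separable real Hilbert space \<open>H\<close> is a type of sort
  \<open>{real_inner, banach, second_countable_topology}\<close>. It is infinite-dimensional as soon as it
  has an orthonormal basis indexed by \<open>nat\<close>. All indices are shifted to start at \<open>0\<close>, so that
  \<open>e 0\<close>, \<open>q 0\<close> are the informal \<open>e_1\<close>, \<open>q_1\<close>.
\<close>

definition orthonormal_basis :: "(nat \<Rightarrow> 'a::real_inner) \<Rightarrow> bool" where
  "orthonormal_basis e \<longleftrightarrow>
     (\<forall>i j. inner (e i) (e j) = (if i = j then 1 else 0)) \<and>
     closure (span (range e)) = UNIV"

text \<open>For such an operator the trace is \<open>\<Sum>j. inner (Q (e j)) (e j) = \<Sum>j. q j\<close>.\<close>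

definition positive_trace_class_diag ::
  "('a::real_inner \<Rightarrow> 'a) \<Rightarrow> (nat \<Rightarrow> 'a) \<Rightarrow> (nat \<Rightarrow> real) \<Rightarrow> bool" where
  "positive_trace_class_diag Q e q \<longleftrightarrow>
     bounded_linear Q \<and>
     (\<forall>x y. inner (Q x) y = inner x (Q y)) \<and>
     (\<forall>x. 0 \<le> inner (Q x) x) \<and>
     orthonormal_basis e \<and>
     (\<forall>j. Q (e j) = q j *\<^sub>R e j) \<and>
     q 0 = 1 \<and> decseq q \<and> (\<forall>j. 0 < q j) \<and>
     summable q"

definition Q_norm :: "('a::real_inner \<Rightarrow> 'a) \<Rightarrow> 'a \<Rightarrow> real" where
  "Q_norm Q x = sqrt (inner (Q x) x)"

definition ellipsoid :: "('a::real_inner \<Rightarrow> 'a) \<Rightarrow> real \<Rightarrow> 'a \<Rightarrow> 'a set" where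
  "ellipsoid Q R a = {x. Q_norm Q (x - a) \<le> R}"

section \<open>Random variables and Wiener processes\<close>

definition V_infinity ::
  "'w measure \<Rightarrow> ('w \<Rightarrow> 'a::{real_normed_vector, second_countable_topology}) set" where
  "V_infinity M =
     {\<xi>. \<xi> \<in> borel_measurable M \<and> (\<forall>p::nat. integrable M (\<lambda>\<omega>. norm (\<xi> \<omega>) ^ p))}"

text \<open>
  Processes are indexed by \<open>real\<close>; only the times in \<open>{0..}\<close> matter. A process as a single random
  element takes values in the product space over \<open>{0..}\<close>.
\<close>

abbreviation path_space :: "(real \<Rightarrow> 'a::topological_space) measure" where
  "path_space \<equiv> PiM {0..} (\<lambda>_. borel)"

definition path_of :: "(real \<Rightarrow> 'w \<Rightarrow> 'a) \<Rightarrow> 'w \<Rightarrow> real \<Rightarrow> 'a" where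
  "path_of X \<omega> = (\<lambda>t\<in>{0..}. X t \<omega>)"

definition standard_real_wiener :: "'w measure \<Rightarrow> (real \<Rightarrow> 'w \<Rightarrow> real) \<Rightarrow> bool" where
  "standard_real_wiener M \<beta> \<longleftrightarrow>
     (\<forall>t\<ge>0. \<beta> t \<in> borel_measurable M) \<and>
     (AE \<omega> in M. \<beta> 0 \<omega> = 0) \<and>
     (\<forall>n (ts :: nat \<Rightarrow> real). 0 \<le> ts 0 \<and> incseq ts \<longrightarrow>
        prob_space.indep_vars M (\<lambda>_. borel)
          (\<lambda>i \<omega>. \<beta> (ts (Suc i)) \<omega> - \<beta> (ts i) \<omega>) {..<n}) \<and>
     (\<forall>s t. 0 \<le> s \<and> s < t \<longrightarrow>
        distributed M lborel (\<lambda>\<omega>. \<beta> t \<omega> - \<beta> s \<omega>) (normal_density 0 (sqrt (t - s)))) \<and>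
     (AE \<omega> in M. continuous_on {0..} (\<lambda>t. \<beta> t \<omega>))"

text \<open>
  The Wiener process in \<open>H\<close> whose covariance operator is diagonal in the basis \<open>e\<close> with
  eigenvalues \<open>q\<close>. The series is required to converge in norm, almost surely for each fixed time;
  path continuity of \<open>W\<close> selects the usual version.
\<close>

definition wiener_process ::
  "'w measure \<Rightarrow> (nat \<Rightarrow> 'a::{real_normed_vector, second_countable_topology}) \<Rightarrow>
     (nat \<Rightarrow> real) \<Rightarrow> (real \<Rightarrow> 'w \<Rightarrow> 'a) \<Rightarrow> bool" where
  "wiener_process M e q W \<longleftrightarrow>
     (\<forall>t\<ge>0. W t \<in> borel_measurable M) \<and>
     (AE \<omega> in M. continuous_on {0..} (\<lambda>t. W t \<omega>)) \<and>
     (\<exists>\<beta> :: nat \<Rightarrow> real \<Rightarrow> 'w \<Rightarrow> real.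
        (\<forall>j. standard_real_wiener M (\<beta> j)) \<and>
        prob_space.indep_vars M (\<lambda>_. path_space) (\<lambda>j. path_of (\<beta> j)) UNIV \<and>
        (\<forall>t\<ge>0. AE \<omega> in M. (\<lambda>j. (sqrt (q j) * \<beta> j t \<omega>) *\<^sub>R e j) sums W t \<omega>))"

text \<open>Independence of the sigma-algebras generated by \<open>\<eta>\<close> and by the whole process \<open>W\<close>.\<close>

definition independent_of_process ::
  "'w measure \<Rightarrow> ('w \<Rightarrow> 'a::topological_space) \<Rightarrow> (real \<Rightarrow> 'w \<Rightarrow> 'a) \<Rightarrow> bool" where
  "independent_of_process M \<eta> W \<longleftrightarrow>
     prob_space.indep_set M
       {\<eta> -` B \<inter> space M | B. B \<in> sets borel}
       {path_of W -` A \<inter> space M | A. A \<in> sets path_space}"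

section \<open>Strong solutions\<close>

text \<open>
  The filtration generated by \<open>\<eta>\<close> and \<open>W\<close>, augmented by all null sets of \<open>M\<close>. No completeness of
  \<open>M\<close> is assumed: an incomplete \<open>M\<close> only changes strong solutions up to indistinguishability,
  since they have almost surely continuous paths.
\<close>

definition generated_filtration ::
  "'w measure \<Rightarrow> ('w \<Rightarrow> 'a::topological_space) \<Rightarrow> (real \<Rightarrow> 'w \<Rightarrow> 'a) \<Rightarrow> real \<Rightarrow> 'w measure" where
  "generated_filtration M \<eta> W t =
     sigma (space M)
       ({\<eta> -` B \<inter> space M | B. B \<in> sets borel} \<union>
        {W s -` B \<inter> space M | s B. 0 \<le> s \<and> s \<le> t \<and> B \<in> sets borel} \<union>
        null_sets M)"

definition strong_solution ::
  "'w measure \<Rightarrow> (real \<Rightarrow> 'w \<Rightarrow> 'a) \<Rightarrow> ('a \<Rightarrow> 'a::{banach, second_countable_topology}) \<Rightarrow>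
     ('w \<Rightarrow> 'a) \<Rightarrow> (real \<Rightarrow> 'w \<Rightarrow> 'a) \<Rightarrow> bool" where
  "strong_solution M W F \<eta> X \<longleftrightarrow>
     (\<forall>t\<ge>0. X t \<in> measurable (generated_filtration M \<eta> W t) borel) \<and>
     (AE \<omega> in M. \<forall>t\<ge>0.
        set_integrable lborel {0..t} (\<lambda>s. F (X s \<omega>)) \<and>
        X t \<omega> = \<eta> \<omega> + W t \<omega> + (LINT s:{0..t}|lborel. F (X s \<omega>)))"

section \<open>Smooth cylindrical functions\<close>

text \<open>
  A function on \<open>\<real>\<^sup>m\<close>, with \<open>m\<close> a variable natural number, is a function of real sequences that
  depends only on the coordinates below \<open>m\<close>. For such functions, continuity for the product
  topology on \<open>nat \<Rightarrow> real\<close> is continuity on \<open>\<real>\<^sup>m\<close>.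
\<close>

definition depends_on_first :: "nat \<Rightarrow> ((nat \<Rightarrow> real) \<Rightarrow> real) \<Rightarrow> bool" where
  "depends_on_first m f \<longleftrightarrow> (\<forall>x y. (\<forall>i<m. x i = y i) \<longrightarrow> f x = f y)"

definition coord_deriv :: "nat \<Rightarrow> ((nat \<Rightarrow> real) \<Rightarrow> real) \<Rightarrow> (nat \<Rightarrow> real) \<Rightarrow> real" where
  "coord_deriv i f x = deriv (\<lambda>s. f (x(i := s))) (x i)"

text \<open>All partial derivatives in the first \<open>m\<close> coordinates up to order \<open>k\<close> exist and are continuous.\<close>

primrec Ck_on_coords :: "nat \<Rightarrow> nat \<Rightarrow> ((nat \<Rightarrow> real) \<Rightarrow> real) \<Rightarrow> bool" where
  "Ck_on_coords m 0 f \<longleftrightarrow> continuous_on UNIV f"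
| "Ck_on_coords m (Suc k) f \<longleftrightarrow>
     continuous_on UNIV f \<and>
     (\<forall>i<m. (\<forall>x. (\<lambda>s. f (x(i := s))) differentiable (at (x i))) \<and>
            Ck_on_coords m k (coord_deriv i f))"

definition smooth_compact_support :: "nat \<Rightarrow> ((nat \<Rightarrow> real) \<Rightarrow> real) \<Rightarrow> bool" where
  "smooth_compact_support m f \<longleftrightarrow>
     depends_on_first m f \<and>
     (\<forall>k. Ck_on_coords m k f) \<and>
     (\<exists>r. \<forall>x. (\<exists>i<m. r < \<bar>x i\<bar>) \<longrightarrow> f x = 0)"

definition FC0_infinity :: "(nat \<Rightarrow> 'a::real_inner) \<Rightarrow> ('a \<Rightarrow> real) set" where
  "FC0_infinity e =
     {\<phi>. \<exists>m>0. \<exists>\<phi>0. smooth_compact_support m \<phi>0 \<and> \<phi> = (\<lambda>x. \<phi>0 (\<lambda>j. inner x (e j)))}"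

section \<open>The Cauchy problem\<close>

definition dir_deriv :: "'a::real_vector \<Rightarrow> ('a \<Rightarrow> real) \<Rightarrow> 'a \<Rightarrow> real" where
  "dir_deriv v \<phi> x = deriv (\<lambda>s. \<phi> (x + s *\<^sub>R v)) 0"

text \<open>On \<open>FC0_infinity e\<close> both series have only finitely many nonzero terms.\<close>

definition generator ::
  "(nat \<Rightarrow> 'a::real_inner) \<Rightarrow> (nat \<Rightarrow> real) \<Rightarrow> ('a \<Rightarrow> 'a) \<Rightarrow> ('a \<Rightarrow> real) \<Rightarrow> 'a \<Rightarrow> real" where
  "generator e q F \<phi> x =
     (\<Sum>i. 1/2 * q i * dir_deriv (e i) (dir_deriv (e i) \<phi>) x) +
     (\<Sum>i. inner (F x) (e i) * dir_deriv (e i) \<phi> x)"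

text \<open>
  Membership in the space of measurable maps to \<open>prob_algebra borel\<close> says that each \<open>\<mu> t\<close> with
  \<open>0 \<le> t\<close> is a Borel probability measure and that \<open>t \<mapsto> \<mu> t B\<close> is measurable for every Borel \<open>B\<close>.
  For bounded Borel \<open>F\<close>, \<open>generator e q F \<phi>\<close> is bounded and Borel, so that the integrals below are
  proper ones.
\<close>

definition probability_solution ::
  "(nat \<Rightarrow> 'a::{real_inner, second_countable_topology}) \<Rightarrow> (nat \<Rightarrow> real) \<Rightarrow> ('a \<Rightarrow> 'a) \<Rightarrow>
     'a measure \<Rightarrow> (real \<Rightarrow> 'a measure) \<Rightarrow> bool" where
  "probability_solution e q F \<nu> \<mu> \<longleftrightarrow>
     \<mu> \<in> measurable (restrict_space borel {0..}) (prob_algebra borel) \<and>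
     (\<forall>t\<ge>0. \<forall>\<phi>\<in>FC0_infinity e.
        (\<integral>x. \<phi> x \<partial>\<mu> t) - (\<integral>x. \<phi> x \<partial>\<nu>) =
        (LINT s:{0..t}|lborel. (\<integral>x. generator e q F \<phi> x \<partial>\<mu> s)))"

text \<open>Uniqueness can only concern the times \<open>t \<ge> 0\<close>.\<close>

definition has_unique_probability_solution ::
  "(nat \<Rightarrow> 'a::{real_inner, second_countable_topology}) \<Rightarrow> (nat \<Rightarrow> real) \<Rightarrow> ('a \<Rightarrow> 'a) \<Rightarrow>
     'a measure \<Rightarrow> bool" where
  "has_unique_probability_solution e q F \<nu> \<longleftrightarrow>
     (\<exists>\<mu>. probability_solution e q F \<nu> \<mu> \<and>
          (\<forall>\<mu>'. probability_solution e q F \<nu> \<mu>' \<longrightarrow> (\<forall>t\<ge>0. \<mu>' t = \<mu> t)))"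

end

theory Submission
  imports Defs
begin

text \<open>
  On a short final interval \<open>[T - h, T]\<close> the bounded drift moves the solution by at most \<open>C h\<close>,
  so \<open>X_T\<close> is close to \<open>X_{T-h} + (W_T - W_{T-h})\<close>. The increment is independent of
  \<open>X_{T-h}\<close> and its law charges every ball of \<open>H\<close> (finitely many independent nondegenerate
  Gaussian coordinates, plus a tail which is small in probability), hence \<open>X_T\<close> charges every ball,
  and ellipsoids contain balls because \<open>q_j \<le> 1\<close>. No change of measure is needed.

  To pass to \<open>\<mu>_T\<close> by uniqueness, the laws of a strong solution must solve the Cauchy problem.
  Stochastic integrals are avoided: over a time step of length \<open>h\<close>, adding the Gaussian increments one
  coordinate at a time and then the drift, a Taylor expansion gives the integrated equation up to
  \<open>O(h^{3/2})\<close>. So the difference of its two sides has derivative zero in \<open>t\<close>.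
\<close>

section \<open>Independence up to null sets\<close>

text \<open>Everything rests on one independence statement: coordinate \<open>k\<close> of an
  increment of \<open>W\<close> is independent of the whole past together with all other coordinates
  of the same increment. It lets events for single coordinates be split off as factors, and it makes
  the linear Taylor term vanish in mean while the quadratic one acquires the factor
  \<open>q k * (t - s)\<close>. The difficulty is that the filtration is generated by
  \<open>\<eta>\<close>, \<open>W\<close> and null sets, whereas independence is given for the real
  noises \<open>\<beta> j\<close>, which are tied to \<open>W\<close> only almost surely at each
  fixed time; completed sigma-algebras bridge this gap.

  The second obstacle is that \<open>F\<close> is merely Borel, so the drift along a path cannot be
  frozen at the left end of a time step. The expansion therefore keeps the time integral of the
  drift as it is and compares only derivatives of the smooth function, which are Lipschitz. The
  solution moves by order \<open>h^(1/2)\<close> in mean during a step of length \<open>h\<close>;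
  integrated over the step this is where \<open>h^(3/2)\<close> comes from.\<close>

definition ae_completion :: "'w measure \<Rightarrow> 'w measure \<Rightarrow> 'w measure" where
  "ae_completion M S =
     sigma (space M) {A \<in> sets M. \<exists>A'\<in>sets S. AE \<omega> in M. \<omega> \<in> A \<longleftrightarrow> \<omega> \<in> A'}"

lemma space_ae_completion [simp]: "space (ae_completion M S) = space M"
  unfolding ae_completion_def by (rule space_measure_of) (auto dest: sets.sets_into_space)

text \<open>The class is closed under countable unions because countably many almost sure
  equivalences hold off one null set, so generating a sigma-algebra adds nothing. Asking for
  \<open>A \<in> sets M\<close> keeps every member an event even when \<open>M\<close> is
  incomplete.\<close>

lemma sets_ae_completion:
  assumes "space S = space M"
  shows "sets (ae_completion M S) =
    {A \<in> sets M. \<exists>A'\<in>sets S. AE \<omega> in M. \<omega> \<in> A \<longleftrightarrow> \<omega> \<in> A'}" (is "_ = ?C")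
proof -
  have "sigma_algebra (space M) ?C"
    unfolding sigma_algebra_iff2
  proof (intro conjI ballI allI impI)
    show "?C \<subseteq> Pow (space M)" by (auto dest: sets.sets_into_space)
    show "{} \<in> ?C" by auto
    show "space M - A \<in> ?C" if "A \<in> ?C" for A
    proof -
      from that obtain A' where A': "A' \<in> sets S" "AE \<omega> in M. \<omega> \<in> A \<longleftrightarrow> \<omega> \<in> A'" by auto
      have "AE \<omega> in M. \<omega> \<in> space M - A \<longleftrightarrow> \<omega> \<in> space S - A'"
        using A'(2) AE_space by eventually_elim (use assms in auto)
      with that A' show ?thesis by (auto intro!: bexI[of _ "space S - A'"])
    qed
    show "(\<Union>i::nat. A i) \<in> ?C" if "range A \<subseteq> ?C" for A
    proof -
      from that have "\<forall>i. \<exists>A'\<in>sets S. AE \<omega> in M. \<omega> \<in> A i \<longleftrightarrow> \<omega> \<in> A'" by blast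
      then obtain B where B: "\<And>i. B i \<in> sets S" "\<And>i. AE \<omega> in M. \<omega> \<in> A i \<longleftrightarrow> \<omega> \<in> B i"
        by metis
      have "AE \<omega> in M. \<forall>i. \<omega> \<in> A i \<longleftrightarrow> \<omega> \<in> B i"
        using B(2) by (simp add: AE_all_countable)
      then have "AE \<omega> in M. \<omega> \<in> (\<Union>i. A i) \<longleftrightarrow> \<omega> \<in> (\<Union>i. B i)"
        by eventually_elim auto
      with that B(1) show ?thesis
        by (auto intro!: bexI[of _ "\<Union>i. B i"] sets.countable_UN)
    qed
  qed
  then show ?thesis
    unfolding ae_completion_def by (simp add: sigma_algebra.sets_measure_of_eq)
qed

lemma measurable_ae_completion:
  assumes "space S = space M" "f \<in> measurable M N" "g \<in> measurable S N" "AE \<omega> in M. f \<omega> = g \<omega>"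
  shows "f \<in> measurable (ae_completion M S) N"
proof (rule measurableI)
  show "f \<omega> \<in> space N" if "\<omega> \<in> space (ae_completion M S)" for \<omega>
    using measurable_space[OF assms(2)] that by simp
  fix A assume A: "A \<in> sets N"
  have "AE \<omega> in M. \<omega> \<in> f -` A \<inter> space M \<longleftrightarrow> \<omega> \<in> g -` A \<inter> space S"
    using assms(4) AE_space by eventually_elim (simp add: assms(1))
  then show "f -` A \<inter> space (ae_completion M S) \<in> sets (ae_completion M S)"
    unfolding sets_ae_completion[OF assms(1)]
    using measurable_sets[OF assms(2) A] measurable_sets[OF assms(3) A]
    by (intro CollectI conjI bexI[of _ "g -` A \<inter> space S"]) simp_all
qed

lemma null_sets_ae_completion:
  assumes "space S = space M" "N \<in> null_sets M"
  shows "N \<in> sets (ae_completion M S)"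
  unfolding sets_ae_completion[OF assms(1)]
  using assms(2) AE_not_in[OF assms(2)] by (auto intro!: bexI[of _ "{}"])

section \<open>Independence of random variables with values in different spaces\<close>

context prob_space
begin

lemma indep_set_commute: "indep_set A B \<Longrightarrow> indep_set B A"
  unfolding indep_sets2_eq proof (elim conjE, intro conjI ballI)
  fix b a assume "\<forall>a\<in>A. \<forall>b\<in>B. prob (a \<inter> b) = prob a * prob b" "b \<in> B" "a \<in> A"
  then have "prob (a \<inter> b) = prob a * prob b" by blast
  then show "prob (b \<inter> a) = prob b * prob a" by (subst Int_commute) (subst mult.commute, assumption)
qed

text \<open>Replacing an event by an almost surely equal one changes neither its probability nor
  that of its intersection with another event. Null sets and almost sure identities can thus be
  absorbed into one side of an independence statement.\<close>

lemma indep_set_ae_completion: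
  assumes S: "space S = space M" and "indep_set (sets S) B"
  shows "indep_set (sets (ae_completion M S)) B"
  unfolding indep_sets2_eq
proof (intro conjI ballI)
  show "sets (ae_completion M S) \<subseteq> events" by (auto simp: sets_ae_completion[OF S])
  show "B \<subseteq> events" using indep_setD_ev2[OF assms(2)] .
  fix a b assume a: "a \<in> sets (ae_completion M S)" and b: "b \<in> B"
  then obtain a' where a': "a' \<in> sets S" "AE \<omega> in M. \<omega> \<in> a \<longleftrightarrow> \<omega> \<in> a'" "a \<in> events"
    by (auto simp: sets_ae_completion[OF S])
  have ev: "a' \<in> events" "b \<in> events"
    using indep_setD_ev1[OF assms(2)] \<open>B \<subseteq> events\<close> a' b by auto
  have "prob (a \<inter> b) = prob (a' \<inter> b)"
    using a' ev by (intro finite_measure_eq_AE) auto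
  also have "\<dots> = prob a' * prob b" using indep_setD[OF assms(2) a'(1) b] .
  also have "prob a' = prob a" using a' ev by (intro finite_measure_eq_AE) auto
  finally show "prob (a \<inter> b) = prob a * prob b" .
qed

text \<open>
  Unlike the library's \<^const>\<open>indep_var\<close>, this allows the two random variables to have different
  types.
\<close>

definition indep_rv :: "'b measure \<Rightarrow> ('a \<Rightarrow> 'b) \<Rightarrow> 'c measure \<Rightarrow> ('a \<Rightarrow> 'c) \<Rightarrow> bool" where
  "indep_rv N X T Y \<longleftrightarrow> random_variable N X \<and> random_variable T Y \<and>
     indep_set {X -` A \<inter> space M |A. A \<in> sets N} {Y -` B \<inter> space M |B. B \<in> sets T}"

lemma indep_rv1: "indep_rv N X T Y \<Longrightarrow> random_variable N X"
  and indep_rv2: "indep_rv N X T Y \<Longrightarrow> random_variable T Y"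
  by (simp_all add: indep_rv_def)

lemma Int_stable_vimages: "Int_stable {Y -` A \<inter> space M |A. A \<in> sets T}"
proof (rule Int_stableI)
  fix a b assume "a \<in> {Y -` A \<inter> space M |A. A \<in> sets T}" "b \<in> {Y -` A \<inter> space M |A. A \<in> sets T}"
  then obtain A B where "A \<in> sets T" "B \<in> sets T" "a = Y -` A \<inter> space M" "b = Y -` B \<inter> space M"
    by auto
  then show "a \<inter> b \<in> {Y -` A \<inter> space M |A. A \<in> sets T}"
    by (auto intro!: exI[of _ "A \<inter> B"])
qed

text \<open>Preimages of a sigma-algebra already form a sigma-algebra, so generating adds nothing.
  For equal value types this gives access to the results on independent families and on expectations
  of products.\<close>

lemma indep_rv_iff_indep_var: "indep_rv N X T Y \<longleftrightarrow> indep_var N X T Y"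
proof -
  have *: "sigma_sets (space M) {X -` A \<inter> space M |A. A \<in> sets N} = {X -` A \<inter> space M |A. A \<in> sets N}"
    if "random_variable N X" for X :: "'a \<Rightarrow> 'b" and N
    using sigma_sets_vimage_commute[of X "space M" "space N" "sets N"] measurable_space[OF that]
    by (simp add: sets.sigma_sets_eq Pi_iff)
  show ?thesis
    unfolding indep_rv_def indep_var_eq using * by auto
qed

text \<open>A pi-lambda argument: \<open>E\<close> is an intersection-stable generator on one side,
  and the preimages under \<open>Y\<close> are intersection-stable in any case.\<close>

lemma indep_rvI_generator:
  assumes X: "random_variable N X" and Y: "random_variable T Y"
    and N: "sets N = sigma_sets (space N) E" "Int_stable E" "E \<subseteq> Pow (space N)"
    and eq: "\<And>A B. A \<in> E \<Longrightarrow> B \<in> sets T \<Longrightarrow>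
      prob (X -` A \<inter> space M \<inter> (Y -` B \<inter> space M)) =
      prob (X -` A \<inter> space M) * prob (Y -` B \<inter> space M)"
  shows "indep_rv N X T Y"
proof -
  have *: "sigma_sets (space M) {X -` A \<inter> space M |A. A \<in> E} = {X -` A \<inter> space M |A. A \<in> sets N}"
    unfolding N(1) using measurable_space[OF X] by (intro sigma_sets_vimage_commute[symmetric]) auto
  have "E \<subseteq> sets N" unfolding N(1) by auto
  then have "indep_set {X -` A \<inter> space M |A. A \<in> E} {Y -` A \<inter> space M |A. A \<in> sets T}"
    unfolding indep_sets2_eq using eq measurable_sets[OF X] measurable_sets[OF Y] by auto
  moreover have "Int_stable {X -` A \<inter> space M |A. A \<in> E}"
  proof (rule Int_stableI)
    fix a b assume "a \<in> {X -` A \<inter> space M |A. A \<in> E}" "b \<in> {X -` A \<inter> space M |A. A \<in> E}"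
    then obtain A B where "A \<in> E" "B \<in> E" "a = X -` A \<inter> space M" "b = X -` B \<inter> space M" by auto
    then show "a \<inter> b \<in> {X -` A \<inter> space M |A. A \<in> E}"
      using Int_stableD[OF N(2), of A B] by (auto intro!: exI[of _ "A \<inter> B"])
  qed
  ultimately have "indep_set (sigma_sets (space M) {X -` A \<inter> space M |A. A \<in> E})
    (sigma_sets (space M) {Y -` A \<inter> space M |A. A \<in> sets T})"
    by (intro indep_set_sigma_sets Int_stable_vimages)
  then show ?thesis
    unfolding indep_rv_def *[symmetric] indep_sets2_eq using X Y by blast
qed

lemma indep_rvI:
  assumes "random_variable N X" "random_variable T Y"
    and "\<And>A B. A \<in> sets N \<Longrightarrow> B \<in> sets T \<Longrightarrow>
      prob (X -` A \<inter> space M \<inter> (Y -` B \<inter> space M)) =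
      prob (X -` A \<inter> space M) * prob (Y -` B \<inter> space M)"
  shows "indep_rv N X T Y"
  using assms(1,2) sets.sigma_sets_eq[of N, symmetric] sets.Int_stable[of N] sets.space_closed[of N] assms(3)
  by (rule indep_rvI_generator)

lemma indep_rvD:
  assumes "indep_rv N X T Y" "A \<in> sets N" "B \<in> sets T"
  shows "prob (X -` A \<inter> space M \<inter> (Y -` B \<inter> space M)) =
      prob (X -` A \<inter> space M) * prob (Y -` B \<inter> space M)"
  using assms unfolding indep_rv_def by (auto intro!: indep_setD)

text \<open>On rectangles the two hypotheses factor the joint probability into three; grouping the
  first two factors gives the claim. Repeated use joins independent sources of randomness into one
  variable that stays independent of \<open>Y\<close>.\<close>

lemma indep_rv_pairI:
  assumes Z: "random_variable L Z" and XY: "indep_rv N X T Y"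
    and ZXY: "indep_rv L Z (N \<Otimes>\<^sub>M T) (\<lambda>\<omega>. (X \<omega>, Y \<omega>))"
  shows "indep_rv (L \<Otimes>\<^sub>M N) (\<lambda>\<omega>. (Z \<omega>, X \<omega>)) T Y"
proof (rule indep_rvI_generator[OF _ _ _ Int_stable_pair_measure_generator[of L N]])
  note [measurable] = Z indep_rv1[OF XY] indep_rv2[OF XY]
  show "random_variable (L \<Otimes>\<^sub>M N) (\<lambda>\<omega>. (Z \<omega>, X \<omega>))" "random_variable T Y" by measurable
  show "sets (L \<Otimes>\<^sub>M N) = sigma_sets (space (L \<Otimes>\<^sub>M N)) {a \<times> b |a b. a \<in> sets L \<and> b \<in> sets N}"
    unfolding space_pair_measure by (rule sets_pair_measure)
  show "{a \<times> b |a b. a \<in> sets L \<and> b \<in> sets N} \<subseteq> Pow (space (L \<Otimes>\<^sub>M N))"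
    by (auto simp: space_pair_measure dest: sets.sets_into_space)
  fix A B assume "A \<in> {a \<times> b |a b. a \<in> sets L \<and> b \<in> sets N}" and B: "B \<in> sets T"
  then obtain a b where A: "A = a \<times> b" "a \<in> sets L" "b \<in> sets N" by auto
  let ?a = "Z -` a \<inter> space M" and ?b = "X -` b \<inter> space M" and ?B = "Y -` B \<inter> space M"
  have ab: "(\<lambda>\<omega>. (Z \<omega>, X \<omega>)) -` A \<inter> space M = ?a \<inter> ?b" unfolding A by auto
  have 1: "prob (?a \<inter> ?b \<inter> ?B) = prob ?a * (prob ?b * prob ?B)"
    using indep_rvD[OF ZXY \<open>a \<in> sets L\<close> pair_measureI[OF \<open>b \<in> sets N\<close> B]]
      indep_rvD[OF XY \<open>b \<in> sets N\<close> B]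
    by (simp add: vimage_def Int_def conj_ac cong: conj_cong)
  \<comment> \<open>Letting \<open>Y\<close> range over the whole space extracts from
    \<open>ZXY\<close> the independence of \<open>Z\<close> and \<open>X\<close>.\<close>
  have "X -` b \<inter> space M \<inter> (Y -` space T \<inter> space M) = ?b"
    using measurable_space[OF indep_rv2[OF XY]] by auto
  then have 2: "prob (?a \<inter> ?b) = prob ?a * prob ?b"
    using indep_rvD[OF ZXY \<open>a \<in> sets L\<close> pair_measureI[OF \<open>b \<in> sets N\<close> sets.top[of T]]]
    by (simp add: vimage_def Int_def conj_ac cong: conj_cong)
  show "prob ((\<lambda>\<omega>. (Z \<omega>, X \<omega>)) -` A \<inter> space M \<inter> ?B) =
     prob ((\<lambda>\<omega>. (Z \<omega>, X \<omega>)) -` A \<inter> space M) * prob ?B"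
    unfolding ab 1 2 by simp
qed

lemma indep_rv_compose:
  assumes "indep_rv N X T Y" "f \<in> measurable N N'" "g \<in> measurable T T'"
  shows "indep_rv N' (\<lambda>\<omega>. f (X \<omega>)) T' (\<lambda>\<omega>. g (Y \<omega>))"
proof (rule indep_rvI)
  note rv = indep_rv1[OF assms(1)] indep_rv2[OF assms(1)]
  show "random_variable N' (\<lambda>\<omega>. f (X \<omega>))" "random_variable T' (\<lambda>\<omega>. g (Y \<omega>))"
    by (rule measurable_compose[OF rv(1) assms(2)], rule measurable_compose[OF rv(2) assms(3)])
  fix A B assume AB: "A \<in> sets N'" "B \<in> sets T'"
  have "(\<lambda>\<omega>. f (X \<omega>)) -` A \<inter> space M = X -` (f -` A \<inter> space N) \<inter> space M"
    "(\<lambda>\<omega>. g (Y \<omega>)) -` B \<inter> space M = Y -` (g -` B \<inter> space T) \<inter> space M"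
    using measurable_space[OF rv(1)] measurable_space[OF rv(2)] by auto
  then show "prob ((\<lambda>\<omega>. f (X \<omega>)) -` A \<inter> space M \<inter> ((\<lambda>\<omega>. g (Y \<omega>)) -` B \<inter> space M)) =
      prob ((\<lambda>\<omega>. f (X \<omega>)) -` A \<inter> space M) * prob ((\<lambda>\<omega>. g (Y \<omega>)) -` B \<inter> space M)"
    using indep_rvD[OF assms(1) measurable_sets[OF assms(2) AB(1)] measurable_sets[OF assms(3) AB(2)]]
    by simp
qed

lemma indep_rv_AE_cong:
  assumes "indep_rv N X T Y" "random_variable T Y'" "AE \<omega> in M. Y \<omega> = Y' \<omega>"
  shows "indep_rv N X T Y'"
proof (rule indep_rvI)
  note rv = indep_rv1[OF assms(1)] indep_rv2[OF assms(1)]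
  show "random_variable N X" "random_variable T Y'" using rv assms(2) by auto
  fix A B assume AB: "A \<in> sets N" "B \<in> sets T"
  note ev = measurable_sets[OF rv(1) AB(1)] measurable_sets[OF rv(2) AB(2)]
    measurable_sets[OF assms(2) AB(2)]
  have 1: "prob (Y' -` B \<inter> space M) = prob (Y -` B \<inter> space M)"
    by (rule finite_measure_eq_AE[OF _ ev(3) ev(2)], use assms(3) in eventually_elim) simp
  have 2: "prob (X -` A \<inter> space M \<inter> (Y' -` B \<inter> space M)) = prob (X -` A \<inter> space M \<inter> (Y -` B \<inter> space M))"
    by (rule finite_measure_eq_AE[OF _ sets.Int[OF ev(1,3)] sets.Int[OF ev(1,2)]], use assms(3) in eventually_elim) simp
  show "prob (X -` A \<inter> space M \<inter> (Y' -` B \<inter> space M)) =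
      prob (X -` A \<inter> space M) * prob (Y' -` B \<inter> space M)"
    unfolding 1 2 by (rule indep_rvD[OF assms(1) AB])
qed

lemma indep_set_vimageI:
  assumes "indep_rv N X T Y"
  shows "indep_set (sets (vimage_algebra (space M) X N)) {Y -` B \<inter> space M | B. B \<in> sets T}"
proof -
  note rv = indep_rv1[OF assms] indep_rv2[OF assms]
  have *: "sets (vimage_algebra (space M) X N) = {X -` A \<inter> space M | A. A \<in> sets N}"
    using measurable_space[OF rv(1)] by (intro sets_vimage_algebra2) auto
  show ?thesis
    unfolding indep_sets2_eq *
    using indep_rvD[OF assms] measurable_sets[OF rv(1)] measurable_sets[OF rv(2)] by auto
qed

lemma indep_rv_if_indep_set:
  assumes "space S = space M" "indep_set (sets S) {Y -` B \<inter> space M | B. B \<in> sets T}"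
    and X: "X \<in> measurable S N" and Y: "random_variable T Y"
  shows "indep_rv N X T Y"
proof (rule indep_rvI[OF _ Y])
  have "sets S \<subseteq> events" using indep_setD_ev1[OF assms(2)] .
  then show "random_variable N X"
    using X assms(1) by (auto simp: measurable_def)
  fix A B assume "A \<in> sets N" "B \<in> sets T"
  then show "prob (X -` A \<inter> space M \<inter> (Y -` B \<inter> space M)) =
      prob (X -` A \<inter> space M) * prob (Y -` B \<inter> space M)"
    using measurable_sets[OF X, of A] assms(1) by (intro indep_setD[OF assms(2)]) auto
qed

end

section \<open>Independence of Wiener increments\<close>

text \<open>The definition offers independence of increments along finite parts of monotone time
  sequences. The past is generated by events involving finitely many times; these times, sorted and
  continued by \<open>s\<close> and \<open>t\<close>, form such a sequence. Values are recentred at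
  time 0, where the process vanishes only almost surely, so that they are exactly sums of
  increments.\<close>

lemma (in prob_space) standard_real_wiener_indep_past:
  assumes \<beta>: "standard_real_wiener M \<beta>" and st: "0 \<le> s" "s < t"
  shows "indep_rv (PiM {0..s} (\<lambda>_. borel)) (\<lambda>\<omega>. \<lambda>r\<in>{0..s}. \<beta> r \<omega> - \<beta> 0 \<omega>)
    borel (\<lambda>\<omega>. \<beta> t \<omega> - \<beta> s \<omega>)"
proof (rule indep_rvI_generator[OF _ _ _ Int_stable_prod_algebra])
  have rv: "\<beta> r \<in> borel_measurable M" if "0 \<le> r" for r
    using \<beta> that unfolding standard_real_wiener_def by auto
  show "random_variable (PiM {0..s} (\<lambda>_. borel)) (\<lambda>\<omega>. \<lambda>r\<in>{0..s}. \<beta> r \<omega> - \<beta> 0 \<omega>)"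
    using rv by (intro measurable_restrict borel_measurable_diff) auto
  show "(\<lambda>\<omega>. \<beta> t \<omega> - \<beta> s \<omega>) \<in> borel_measurable M" using rv[of s] rv[of t] st by simp
  show "sets (PiM {0..s} (\<lambda>_. borel)) =
    sigma_sets (space (PiM {0..s} (\<lambda>_. borel))) (prod_algebra {0..s} (\<lambda>_. borel))"
    unfolding space_PiM by (rule sets_PiM)
  show "prod_algebra {0..s} (\<lambda>_. borel) \<subseteq> Pow (space (PiM {0..s} (\<lambda>_. borel)))"
    unfolding space_PiM by (rule prod_algebra_sets_into_space)
  fix A B assume A: "A \<in> prod_algebra {0..s} (\<lambda>_. borel :: real measure)" and B: "B \<in> sets (borel :: real measure)"
  obtain J E where J: "A = prod_emb {0..s} (\<lambda>_. borel) J (\<Pi>\<^sub>E j\<in>J. E j)"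
    "finite J" "J \<subseteq> {0..s}" and E: "\<And>j. j \<in> J \<Longrightarrow> E j \<in> sets borel"
    using prod_algebraE[OF A] by metis
  \<comment> \<open>Inserting 0 makes the grid nonempty and starts it at 0, so that partial sums of
    increments telescope to values minus \<open>\<beta> 0 \<omega>\<close>.\<close>
  define xs where "xs = sorted_list_of_set (insert 0 J)"
  define n where "n = length xs"
  have xs: "set xs = insert 0 J" "sorted xs" using J(2) unfolding xs_def
    by (simp_all only: set_sorted_list_of_set sorted_sorted_list_of_set finite_insert)
  have "xs \<noteq> []" using xs by auto
  then have n: "0 < n" by (simp add: n_def)
  have mem: "0 \<le> xs ! i \<and> xs ! i \<le> s" if "i < n" for i
  proof -
    have "xs ! i \<in> insert 0 J" using that xs(1) nth_mem[of i xs] by (simp add: n_def)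
    then show ?thesis using J(3) st by auto
  qed
  have xs0: "xs ! 0 = 0"
  proof -
    obtain i where "i < n" "xs ! i = 0" using xs(1) by (metis in_set_conv_nth insertI1 n_def)
    then show ?thesis using sorted_nth_mono[OF xs(2), of 0 i] mem[OF n] by (simp add: n_def)
  qed
  \<comment> \<open>After the \<open>n\<close> times of the past come \<open>s\<close> and then
    \<open>t\<close> forever: increment number \<open>n\<close> is the one from \<open>s\<close> to
    \<open>t\<close>, and the sequence is monotone on all of \<open>nat\<close>.\<close>
  define ts where "ts i = (if i < n then xs ! i else if i = n then s else t)" for i
  have "incseq ts"
    unfolding mono_def ts_def using sorted_nth_mono[OF xs(2)] mem st
    by (auto simp: n_def)
       (meson dual_order.trans less_imp_le mem n_def)+
  moreover have ts0: "ts 0 = 0" using n xs0 by (simp add: ts_def)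
  ultimately have "indep_vars (\<lambda>_. borel) (\<lambda>i \<omega>. \<beta> (ts (Suc i)) \<omega> - \<beta> (ts i) \<omega>) {..<Suc n}"
    (is "indep_vars _ ?D _")
    using \<beta> unfolding standard_real_wiener_def by simp
  from indep_var_restrict[OF this, of "{..<n}" "{n}"]
  have ind: "indep_rv (PiM {..<n} (\<lambda>_. borel)) (\<lambda>\<omega>. restrict (\<lambda>i. ?D i \<omega>) {..<n})
      (PiM {n} (\<lambda>_. borel)) (\<lambda>\<omega>. restrict (\<lambda>i. ?D i \<omega>) {n})"
    unfolding indep_rv_iff_indep_var by auto
  have "\<forall>j\<in>J. \<exists>i<n. xs ! i = j" using xs(1) by (metis in_set_conv_nth insertI2 n_def)
  then obtain idx where idx: "\<And>j. j \<in> J \<Longrightarrow> idx j < n" "\<And>j. j \<in> J \<Longrightarrow> xs ! idx j = j"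
    by metis
  have sum: "(\<Sum>i<k. ?D i \<omega>) = \<beta> (ts k) \<omega> - \<beta> 0 \<omega>" for k \<omega>
    using sum_lessThan_telescope[of "\<lambda>i. \<beta> (ts i) \<omega>" k] ts0 by simp
  have sumJ: "(\<Sum>i<idx j. restrict (\<lambda>i. ?D i \<omega>) {..<n} i) = \<beta> j \<omega> - \<beta> 0 \<omega>" if "j \<in> J" for j \<omega>
  proof -
    have "(\<Sum>i<idx j. restrict (\<lambda>i. ?D i \<omega>) {..<n} i) = (\<Sum>i<idx j. ?D i \<omega>)"
      using idx(1)[OF that] by (intro sum.cong) auto
    also have "\<dots> = \<beta> (ts (idx j)) \<omega> - \<beta> 0 \<omega>" by (rule sum)
    finally show ?thesis using idx[OF that] by (simp add: ts_def)
  qed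
  \<comment> \<open>The cylinder event \<open>A\<close> as a condition on increments: the recentred
    value at time \<open>j\<close> is the sum of the first \<open>idx j\<close> of them.\<close>
  define A' where "A' = {p \<in> space (PiM {..<n} (\<lambda>_. borel :: real measure)). \<forall>j\<in>J. (\<Sum>i<idx j. p i) \<in> E j}"
  define B' where "B' = {p \<in> space (PiM {n} (\<lambda>_. borel :: real measure)). p n \<in> B}"
  have A': "A' \<in> sets (PiM {..<n} (\<lambda>_. borel))"
  proof -
    have "(\<lambda>p. \<Sum>i<idx j. p i) \<in> borel_measurable (PiM {..<n} (\<lambda>_. borel :: real measure))" if "j \<in> J" for j
      using idx(1)[OF that] by (intro borel_measurable_sum measurable_component_singleton) auto
    then show ?thesis
      unfolding A'_def using J(2) E by (intro sets.sets_Collect_finite_All) (auto intro!: measurable_sets_Collect)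
  qed
  have B': "B' \<in> sets (PiM {n} (\<lambda>_. borel))"
    unfolding B'_def using B by (intro measurable_sets_Collect[OF measurable_component_singleton]) auto
  have 1: "(\<lambda>\<omega>. \<lambda>r\<in>{0..s}. \<beta> r \<omega> - \<beta> 0 \<omega>) -` A \<inter> space M
      = (\<lambda>\<omega>. restrict (\<lambda>i. ?D i \<omega>) {..<n}) -` A' \<inter> space M"
  proof -
    have "(\<lambda>r\<in>{0..s}. \<beta> r \<omega> - \<beta> 0 \<omega>) \<in> A \<longleftrightarrow> restrict (\<lambda>i. ?D i \<omega>) {..<n} \<in> A'" for \<omega>
    proof -
      have "(\<lambda>r\<in>{0..s}. \<beta> r \<omega> - \<beta> 0 \<omega>) \<in> A \<longleftrightarrow> (\<forall>j\<in>J. \<beta> j \<omega> - \<beta> 0 \<omega> \<in> E j)"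
        unfolding J(1) using J(3) by (auto simp: prod_emb_def PiE_iff extensional_def restrict_def subset_eq)
      also have "\<dots> \<longleftrightarrow> restrict (\<lambda>i. ?D i \<omega>) {..<n} \<in> A'"
        unfolding A'_def using sumJ by (auto simp: space_PiM)
      finally show ?thesis .
    qed
    then show ?thesis by auto
  qed
  have 2: "(\<lambda>\<omega>. \<beta> t \<omega> - \<beta> s \<omega>) -` B \<inter> space M
      = (\<lambda>\<omega>. restrict (\<lambda>i. ?D i \<omega>) {n}) -` B' \<inter> space M"
    unfolding B'_def by (auto simp: space_PiM ts_def)
  show "prob ((\<lambda>\<omega>. \<lambda>r\<in>{0..s}. \<beta> r \<omega> - \<beta> 0 \<omega>) -` A \<inter> space M \<inter> ((\<lambda>\<omega>. \<beta> t \<omega> - \<beta> s \<omega>) -` B \<inter> space M)) =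
      prob ((\<lambda>\<omega>. \<lambda>r\<in>{0..s}. \<beta> r \<omega> - \<beta> 0 \<omega>) -` A \<inter> space M) * prob ((\<lambda>\<omega>. \<beta> t \<omega> - \<beta> s \<omega>) -` B \<inter> space M)"
    unfolding 1 2 by (rule indep_rvD[OF ind A' B'])
qed


section \<open>Coordinates of the increments of the H-valued Wiener process\<close>

definition incr :: "(real \<Rightarrow> 'w \<Rightarrow> 'a::real_inner) \<Rightarrow> (nat \<Rightarrow> 'a) \<Rightarrow> real \<Rightarrow> real \<Rightarrow> nat \<Rightarrow> 'w \<Rightarrow> real" where
  "incr W e s t k \<omega> = inner (W t \<omega> - W s \<omega>) (e k)"

text \<open>All that is known at time \<open>s\<close>, together with the increments from
  \<open>s\<close> to \<open>t\<close> in every coordinate except \<open>k\<close>. The other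
  coordinates belong here because some have already been used, or form the tail of an expansion,
  when the turn of coordinate \<open>k\<close> comes.\<close>

definition past_and_others ::
  "'w measure \<Rightarrow> ('w \<Rightarrow> 'a::real_inner) \<Rightarrow> (real \<Rightarrow> 'w \<Rightarrow> 'a) \<Rightarrow> (nat \<Rightarrow> 'a) \<Rightarrow> real \<Rightarrow> real \<Rightarrow> nat \<Rightarrow> 'w measure"
  where "past_and_others M \<eta> W e s t k =
    sigma (space M) (sets (generated_filtration M \<eta> W s) \<union>
      {incr W e s t l -` B \<inter> space M |l B. l \<noteq> k \<and> B \<in> sets borel})"

lemma space_generated_filtration [simp]:
  assumes "\<And>t. 0 \<le> t \<Longrightarrow> W t \<in> borel_measurable M" "\<eta> \<in> borel_measurable M"
  shows "space (generated_filtration M \<eta> W s) = space M"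
  unfolding generated_filtration_def
  by (rule space_measure_of) (auto dest: sets.sets_into_space null_setsD2)

text \<open>\<open>wiener_process\<close> only asserts that suitable noises exist; the locale fixes
  a choice \<open>\<beta>\<close> of them. \<open>q_le\<close> is what remains of
  \<open>q 0 = 1\<close> and monotonicity.\<close>

locale hilbert_wiener = prob_space M for M :: "'w measure" +
  fixes e :: "nat \<Rightarrow> 'a::{real_inner, banach, second_countable_topology}"
    and q :: "nat \<Rightarrow> real" and W :: "real \<Rightarrow> 'w \<Rightarrow> 'a" and \<beta> :: "nat \<Rightarrow> real \<Rightarrow> 'w \<Rightarrow> real"
    and \<eta> :: "'w \<Rightarrow> 'a"
  assumes basis: "orthonormal_basis e"
    and q_pos: "\<And>j. 0 < q j" and q_le: "\<And>j. q j \<le> 1"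
    and W_rv: "\<And>t. 0 \<le> t \<Longrightarrow> W t \<in> borel_measurable M"
    and W_cont: "AE \<omega> in M. continuous_on {0..} (\<lambda>t. W t \<omega>)"
    and \<beta>_wiener: "\<And>j. standard_real_wiener M (\<beta> j)"
    and \<beta>_indep: "indep_vars (\<lambda>_. path_space) (\<lambda>j. path_of (\<beta> j)) UNIV"
    and W_sums: "\<And>t. 0 \<le> t \<Longrightarrow> AE \<omega> in M. (\<lambda>j. (sqrt (q j) * \<beta> j t \<omega>) *\<^sub>R e j) sums W t \<omega>"
    and \<eta>_rv: "\<eta> \<in> borel_measurable M"
    and \<eta>_indep: "independent_of_process M \<eta> W"
begin

lemma e_inner: "inner (e i) (e j) = (if i = j then 1 else 0)"
  using basis by (simp add: orthonormal_basis_def)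

lemma \<beta>_rv: "0 \<le> t \<Longrightarrow> \<beta> j t \<in> borel_measurable M"
  using \<beta>_wiener[of j] by (simp add: standard_real_wiener_def)

lemma \<beta>_0: "AE \<omega> in M. \<beta> j 0 \<omega> = 0"
  using \<beta>_wiener[of j] by (simp add: standard_real_wiener_def)

lemma space_filtration [simp]: "space (generated_filtration M \<eta> W s) = space M"
  using W_rv \<eta>_rv by simp

text \<open>The inner product with \<open>e k\<close> is continuous and may be taken term by term;
  by orthonormality a single term of the series survives.\<close>

lemma W_coord:
  assumes "0 \<le> t"
  shows "AE \<omega> in M. inner (W t \<omega>) (e k) = sqrt (q k) * \<beta> k t \<omega>"
  using W_sums[OF assms]
proof eventually_elim
  case (elim \<omega>)
  have "(\<lambda>j. inner ((sqrt (q j) * \<beta> j t \<omega>) *\<^sub>R e j) (e k)) sums inner (W t \<omega>) (e k)"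
    by (rule bounded_linear.sums[OF bounded_linear_inner_left elim])
  then have "(\<lambda>j. if j = k then sqrt (q j) * \<beta> j t \<omega> else 0) sums inner (W t \<omega>) (e k)"
    by (rule sums_cong[THEN iffD1, rotated]) (simp add: e_inner)
  then show ?case using sums_single[of k "\<lambda>j. sqrt (q j) * \<beta> j t \<omega>"] sums_unique2 by blast
qed

lemma incr_eq:
  assumes "0 \<le> s" "s \<le> t"
  shows "AE \<omega> in M. incr W e s t k \<omega> = sqrt (q k) * (\<beta> k t \<omega> - \<beta> k s \<omega>)"
  using W_coord[of s k] W_coord[of t k] assms
  unfolding incr_def by (auto simp: inner_diff_left right_diff_distrib)

lemma incr_rv: "0 \<le> s \<Longrightarrow> s \<le> t \<Longrightarrow> incr W e s t k \<in> borel_measurable M"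
  unfolding incr_def using W_rv[of s] W_rv[of t] by simp

text \<open>Independence of \<open>\<eta>\<close> is assumed from the path of \<open>W\<close>, but
  the arguments below work with the noises. Each noise is a coordinate of \<open>W\<close> divided
  by \<open>sqrt (q j)\<close>, almost surely at each fixed time, hence measurable for the
  completion of the sigma-algebra of \<open>W\<close>.\<close>

lemma \<eta>_indep_paths:
  "indep_rv borel \<eta> (PiM UNIV (\<lambda>_. path_space)) (\<lambda>\<omega>. \<lambda>j\<in>UNIV. path_of (\<beta> j) \<omega>)"
proof -
  let ?S = "vimage_algebra (space M) (path_of W) (path_space :: (real \<Rightarrow> 'a) measure)"
  let ?E = "{\<eta> -` B \<inter> space M | B. B \<in> sets borel}"
  have pathW: "path_of W \<in> space M \<rightarrow> space (path_space :: (real \<Rightarrow> 'a) measure)"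
    by (auto simp: path_of_def space_PiM)
  have sub: "?E \<subseteq> events" using \<eta>_rv by auto
  have "indep_set ?E (sets ?S)"
    using \<eta>_indep pathW unfolding independent_of_process_def by (simp add: sets_vimage_algebra2)
  then have ind: "indep_set (sets (ae_completion M ?S)) ?E"
    by (intro indep_set_ae_completion, simp, rule indep_set_commute)
  have comp: "\<beta> j r \<in> borel_measurable (ae_completion M ?S)" if "0 \<le> r" for j r
  proof (rule measurable_ae_completion)
    show "\<beta> j r \<in> borel_measurable M" using \<beta>_rv that .
    have "(\<lambda>p. p r) \<in> measurable (path_space :: (real \<Rightarrow> 'a) measure) borel"
      using that by (intro measurable_component_singleton) auto
    from measurable_compose[OF measurable_vimage_algebra1[OF pathW] this]
    have "W r \<in> borel_measurable ?S" using that by (simp add: path_of_def)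
    then show "(\<lambda>\<omega>. inner (W r \<omega>) (e j) / sqrt (q j)) \<in> borel_measurable ?S" by simp
    show "AE \<omega> in M. \<beta> j r \<omega> = inner (W r \<omega>) (e j) / sqrt (q j)"
      using W_coord[OF that, of j]
    proof eventually_elim
      case (elim \<omega>)
      then show ?case using q_pos[of j] by simp
    qed
  qed simp
  \<comment> \<open>Almost sure identities at single times suffice, although there are uncountably
    many times: measurability into a product space is tested one coordinate at a time.\<close>
  have "(\<lambda>\<omega>. path_of (\<beta> j) \<omega>) \<in> measurable (ae_completion M ?S) path_space" for j
    unfolding path_of_def[of "\<beta> j"] by (intro measurable_restrict comp) auto
  then have "(\<lambda>\<omega>. \<lambda>j\<in>UNIV. path_of (\<beta> j) \<omega>) \<in> measurable (ae_completion M ?S) (PiM UNIV (\<lambda>_. path_space))"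
    by (intro measurable_restrict)
  from indep_rv_if_indep_set[OF _ ind this \<eta>_rv] show ?thesis
    unfolding indep_rv_def by (simp add: indep_set_commute)
qed

text \<open>Three sources are joined by \<open>indep_rv_pairI\<close>: the past of noise
  \<open>k\<close>, the other noises, and \<open>\<eta>\<close>. The other noises enter with their
  full paths because their increments from \<open>s\<close> to \<open>t\<close> are needed for
  \<open>past_and_others\<close> as well.\<close>

lemma \<beta>_indep_past_and_others:
  assumes st: "0 \<le> s" "s < t"
  shows "indep_rv
    (borel \<Otimes>\<^sub>M (PiM (- {k}) (\<lambda>_. path_space) \<Otimes>\<^sub>M PiM {0..s} (\<lambda>_. borel)))
    (\<lambda>\<omega>. (\<eta> \<omega>, (\<lambda>j\<in>- {k}. path_of (\<beta> j) \<omega>), \<lambda>r\<in>{0..s}. \<beta> k r \<omega> - \<beta> k 0 \<omega>))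
    borel (\<lambda>\<omega>. \<beta> k t \<omega> - \<beta> k s \<omega>)"
proof -
  let ?P = "path_space :: (real \<Rightarrow> real) measure"
  let ?B = "PiM {0..s} (\<lambda>_. borel) :: (real \<Rightarrow> real) measure"
  have comp: "(\<lambda>p. p r) \<in> borel_measurable ?P" if "0 \<le> r" for r
    using that by (intro measurable_component_singleton) auto
  \<comment> \<open>A path is split into its recentred past and its increment from \<open>s\<close>
    to \<open>t\<close>. Both are measurable functions of the whole path, so independence of whole
    paths passes to the pair.\<close>
  define f where "f p = ((\<lambda>r\<in>{0..s}. p r - p 0), p t - p s)" for p :: "real \<Rightarrow> real"
  have f: "f \<in> measurable ?P (?B \<Otimes>\<^sub>M borel)"
    unfolding f_def using st
    by (intro measurable_Pair measurable_restrict borel_measurable_diff comp) auto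
  have f_path: "f (path_of (\<beta> k) \<omega>) = ((\<lambda>r\<in>{0..s}. \<beta> k r \<omega> - \<beta> k 0 \<omega>), \<beta> k t \<omega> - \<beta> k s \<omega>)" for \<omega>
    using st by (auto simp: f_def path_of_def fun_eq_iff)
  have pk: "(\<lambda>z. z k) \<in> measurable (PiM {k} (\<lambda>_. ?P)) ?P" "(\<lambda>z. z k) \<in> measurable (PiM UNIV (\<lambda>_. ?P)) ?P"
    by (auto intro!: measurable_component_singleton)
  have "indep_rv (PiM (- {k}) (\<lambda>_. ?P)) (\<lambda>\<omega>. \<lambda>j\<in>- {k}. path_of (\<beta> j) \<omega>)
    (PiM {k} (\<lambda>_. ?P)) (\<lambda>\<omega>. \<lambda>j\<in>{k}. path_of (\<beta> j) \<omega>)"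
    unfolding indep_rv_iff_indep_var by (rule indep_var_restrict[OF \<beta>_indep]) auto
  from indep_rv_compose[OF this measurable_ident measurable_compose[OF pk(1) f]]
  have "indep_rv (PiM (- {k}) (\<lambda>_. ?P)) (\<lambda>\<omega>. \<lambda>j\<in>- {k}. path_of (\<beta> j) \<omega>)
     (?B \<Otimes>\<^sub>M borel) (\<lambda>\<omega>. ((\<lambda>r\<in>{0..s}. \<beta> k r \<omega> - \<beta> k 0 \<omega>), \<beta> k t \<omega> - \<beta> k s \<omega>))"
    by (simp add: f_path)
  from indep_rv_pairI[OF indep_rv1[OF this] standard_real_wiener_indep_past[OF \<beta>_wiener st] this]
  have 1: "indep_rv (PiM (- {k}) (\<lambda>_. ?P) \<Otimes>\<^sub>M ?B)
     (\<lambda>\<omega>. ((\<lambda>j\<in>- {k}. path_of (\<beta> j) \<omega>), (\<lambda>r\<in>{0..s}. \<beta> k r \<omega> - \<beta> k 0 \<omega>)))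
     borel (\<lambda>\<omega>. \<beta> k t \<omega> - \<beta> k s \<omega>)" .
  \<comment> \<open>The same regrouping for the family of all noises: other paths, past of noise
    \<open>k\<close>, increment of noise \<open>k\<close>. As one variable this triple is
    independent of \<open>\<eta>\<close>.\<close>
  define g where "g z = ((restrict z (- {k}), fst (f (z k))), snd (f (z k)))" for z :: "nat \<Rightarrow> real \<Rightarrow> real"
  have "g \<in> measurable (PiM UNIV (\<lambda>_. ?P)) ((PiM (- {k}) (\<lambda>_. ?P) \<Otimes>\<^sub>M ?B) \<Otimes>\<^sub>M borel)"
    unfolding g_def using measurable_compose[OF pk(2) f]
    by (intro measurable_Pair measurable_restrict_subset measurable_fst'' measurable_snd'') auto
  from indep_rv_compose[OF \<eta>_indep_paths measurable_ident this]
  have 2: "indep_rv borel \<eta> ((PiM (- {k}) (\<lambda>_. ?P) \<Otimes>\<^sub>M ?B) \<Otimes>\<^sub>M borel)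
     (\<lambda>\<omega>. (((\<lambda>j\<in>- {k}. path_of (\<beta> j) \<omega>), (\<lambda>r\<in>{0..s}. \<beta> k r \<omega> - \<beta> k 0 \<omega>)), \<beta> k t \<omega> - \<beta> k s \<omega>))"
    by (simp add: g_def f_path)
  show ?thesis by (rule indep_rv_pairI[OF \<eta>_rv 1 2])
qed

lemma
  assumes "0 \<le> s" "s \<le> t"
  shows space_past_and_others: "space (past_and_others M \<eta> W e s t k) = space M"
    and sets_past_and_others: "sets (past_and_others M \<eta> W e s t k) =
      sigma_sets (space M) (sets (generated_filtration M \<eta> W s) \<union>
        {incr W e s t l -` B \<inter> space M |l B. l \<noteq> k \<and> B \<in> sets borel})"
proof -
  have "sets (generated_filtration M \<eta> W s) \<union>
      {incr W e s t l -` B \<inter> space M |l B. l \<noteq> k \<and> B \<in> sets borel} \<subseteq> Pow (space M)"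
    using sets.space_closed[of "generated_filtration M \<eta> W s"] by auto
  then show "space (past_and_others M \<eta> W e s t k) = space M"
    "sets (past_and_others M \<eta> W e s t k) =
      sigma_sets (space M) (sets (generated_filtration M \<eta> W s) \<union>
        {incr W e s t l -` B \<inter> space M |l B. l \<noteq> k \<and> B \<in> sets borel})"
    unfolding past_and_others_def by (simp_all add: space_measure_of sets_measure_of)
qed

text \<open>Every generator of \<open>past_and_others\<close> agrees almost surely with an event
  determined by the variables of \<open>\<beta>_indep_past_and_others\<close>, and completion
  preserves independence.\<close>

lemma incr_indep:
  assumes st: "0 \<le> s" "s < t" and X: "X \<in> measurable (past_and_others M \<eta> W e s t k) N"
  shows "indep_rv N X borel (incr W e s t k)"
proof -
  let ?U = "\<lambda>\<omega>. (\<eta> \<omega>, (\<lambda>j\<in>- {k}. path_of (\<beta> j) \<omega>), \<lambda>r\<in>{0..s}. \<beta> k r \<omega> - \<beta> k 0 \<omega>)"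
  let ?P = "path_space :: (real \<Rightarrow> real) measure"
  let ?B = "PiM {0..s} (\<lambda>_. borel) :: (real \<Rightarrow> real) measure"
  let ?L = "borel \<Otimes>\<^sub>M (PiM (- {k}) (\<lambda>_. ?P) \<Otimes>\<^sub>M ?B)"
  let ?S = "vimage_algebra (space M) ?U ?L"
  let ?G = "ae_completion M ?S"
  note ind = \<beta>_indep_past_and_others[OF st, of k]
  have G: "indep_set (sets ?G) {(\<lambda>\<omega>. \<beta> k t \<omega> - \<beta> k s \<omega>) -` B \<inter> space M |B. B \<in> sets borel}"
    by (rule indep_set_ae_completion[OF _ indep_set_vimageI[OF ind]]) simp
  have U: "?U \<in> measurable ?S ?L"
    using measurable_space[OF indep_rv1[OF ind]] by (intro measurable_vimage_algebra1) auto
  have \<eta>S: "\<eta> \<in> borel_measurable ?S"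
    using measurable_compose[OF U measurable_fst] by simp
  have pathS: "\<beta> j r \<in> borel_measurable ?S" if "j \<noteq> k" "0 \<le> r" for j r
  proof -
    have "(\<lambda>u. fst (snd u) j r) \<in> borel_measurable ?L"
      by (rule measurable_compose[OF measurable_compose[OF measurable_compose[OF measurable_snd measurable_fst]
          measurable_component_singleton[of j]] measurable_component_singleton[of r]])
         (use that in auto)
    from measurable_compose[OF U this] show ?thesis using that by (simp add: path_of_def)
  qed
  have pastS: "(\<lambda>\<omega>. \<beta> j r \<omega> - \<beta> j 0 \<omega>) \<in> borel_measurable ?S" if "0 \<le> r" "r \<le> s" for j r
  proof (cases "j = k")
    case True
    have "(\<lambda>u. snd (snd u) r) \<in> borel_measurable ?L"
      by (rule measurable_compose[OF measurable_compose[OF measurable_snd measurable_snd]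
          measurable_component_singleton[of r]]) (use that in auto)
    from measurable_compose[OF U this] show ?thesis using that True by simp
  next
    case False
    then show ?thesis using pathS[of j r] pathS[of j 0] that by simp
  qed
  have \<eta>G: "\<eta> \<in> borel_measurable ?G"
    by (rule measurable_ae_completion[OF _ \<eta>_rv \<eta>S]) simp_all
  have WG: "W r \<in> borel_measurable ?G" if "0 \<le> r" "r \<le> s" for r
  proof (rule measurable_ae_completion)
    show "W r \<in> borel_measurable M" using W_rv that by auto
    \<comment> \<open>\<open>W r\<close> is recovered as the limit of its series. The noises are
      recentred at 0 because only the recentred past of noise \<open>k\<close> is available in
      \<open>?S\<close>; almost surely this changes nothing.\<close>
    let ?g = "\<lambda>\<omega>. lim (\<lambda>n. \<Sum>j<n. (sqrt (q j) * (\<beta> j r \<omega> - \<beta> j 0 \<omega>)) *\<^sub>R e j)"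
    show "?g \<in> borel_measurable ?S"
      using pastS[OF that] by (intro borel_measurable_lim_metric borel_measurable_sum borel_measurable_scaleR
          borel_measurable_times borel_measurable_const)
    have "AE \<omega> in M. \<forall>j. \<beta> j 0 \<omega> = 0" using \<beta>_0 by (simp add: AE_all_countable)
    with W_sums[OF that(1)] show "AE \<omega> in M. W r \<omega> = ?g \<omega>"
      by eventually_elim (simp add: sums_def limI)
  qed simp
  have "sets (generated_filtration M \<eta> W s) \<subseteq> sets ?G"
  proof -
    have "{\<eta> -` B \<inter> space M | B. B \<in> sets borel} \<union>
        {W r -` B \<inter> space M | r B. 0 \<le> r \<and> r \<le> s \<and> B \<in> sets borel} \<union> null_sets M \<subseteq> sets ?G" (is "?gen \<subseteq> _")
      using measurable_sets[OF \<eta>G] measurable_sets[OF WG] null_sets_ae_completion[of ?S M] by auto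
    from sets.sigma_sets_subset[OF this] show ?thesis
      unfolding generated_filtration_def
      by (subst sets_measure_of) (auto dest: sets.sets_into_space null_setsD2)
  qed
  \<comment> \<open>These increments come from the full paths of the other noises, which reach
    beyond time \<open>s\<close>.\<close>
  moreover have "incr W e s t l -` B \<inter> space M \<in> sets ?G" if "l \<noteq> k" "B \<in> sets borel" for l B
  proof -
    have "incr W e s t l \<in> borel_measurable ?G"
      by (rule measurable_ae_completion[OF _ incr_rv _ incr_eq])
        (use st that pathS[of l t] pathS[of l s] in auto)
    from measurable_sets[OF this that(2)] show ?thesis by simp
  qed
  ultimately have "sets (generated_filtration M \<eta> W s) \<union>
      {incr W e s t l -` B \<inter> space M |l B. l \<noteq> k \<and> B \<in> sets borel} \<subseteq> sets ?G"
    by auto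
  from sets.sigma_sets_subset[OF this]
  have "sets (past_and_others M \<eta> W e s t k) \<subseteq> sets ?G"
    using st by (subst sets_past_and_others) auto
  then have "X \<in> measurable ?G N"
    using X st by (auto simp: measurable_def space_past_and_others)
  then have "indep_rv N X borel (\<lambda>\<omega>. \<beta> k t \<omega> - \<beta> k s \<omega>)"
    using G indep_rv2[OF ind] by (intro indep_rv_if_indep_set[of ?G]) auto
  from indep_rv_compose[OF this measurable_ident, of "\<lambda>x. sqrt (q k) * x"]
  have "indep_rv N X borel (\<lambda>\<omega>. sqrt (q k) * (\<beta> k t \<omega> - \<beta> k s \<omega>))" by simp
  then show ?thesis
    by (rule indep_rv_AE_cong) (use st incr_rv[of s t k] incr_eq[of s t k] in auto)
qed

lemma measurable_past:
  assumes "X \<in> measurable (generated_filtration M \<eta> W s) N" "0 \<le> s" "s \<le> t"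
  shows "X \<in> measurable (past_and_others M \<eta> W e s t k) N"
  using assms(1) unfolding measurable_def space_past_and_others[OF assms(2,3)] sets_past_and_others[OF assms(2,3)]
  by auto

lemma measurable_others:
  assumes "l \<noteq> k" "0 \<le> s" "s \<le> t"
  shows "incr W e s t l \<in> borel_measurable (past_and_others M \<eta> W e s t k)"
  using assms(1) unfolding measurable_def space_past_and_others[OF assms(2,3)] sets_past_and_others[OF assms(2,3)]
  by auto

lemma measurable_filtration:
  assumes "X \<in> measurable (generated_filtration M \<eta> W s) N"
  shows "X \<in> measurable M N"
proof -
  have gen: "{\<eta> -` B \<inter> space M | B. B \<in> sets borel} \<union>
      {W r -` B \<inter> space M | r B. 0 \<le> r \<and> r \<le> s \<and> B \<in> sets borel} \<union> null_sets M \<subseteq> events" (is "?gen \<subseteq> _")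
    using measurable_sets[OF \<eta>_rv] measurable_sets[OF W_rv] by auto
  have "sets (generated_filtration M \<eta> W s) \<subseteq> events"
    using sets.sigma_sets_subset[OF gen] unfolding generated_filtration_def
    by (subst sets_measure_of) (auto dest: sets.sets_into_space null_setsD2)
  then show ?thesis using assms by (auto simp: measurable_def)
qed

end

section \<open>Orthonormal expansions\<close>

definition trunc :: "(nat \<Rightarrow> 'a::real_inner) \<Rightarrow> nat \<Rightarrow> 'a \<Rightarrow> 'a" where
  "trunc e n x = (\<Sum>k<n. inner x (e k) *\<^sub>R e k)"

text \<open>\<open>trunc e n x\<close> is the orthogonal projection of \<open>x\<close> onto the
  span of the first \<open>n\<close> basis vectors: the residual is orthogonal to that span, and
  Pythagoras makes the projection the best approximation.\<close>

lemma trunc_norm_le: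
  assumes "orthonormal_basis e"
  shows "norm (x - trunc e n x) \<le> norm (x - (\<Sum>k<n. c k *\<^sub>R e k))"
proof -
  have e: "inner (e i) (e j) = (if i = j then 1 else 0)" for i j
    using assms by (simp add: orthonormal_basis_def)
  let ?v = "\<Sum>k<n. (inner x (e k) - c k) *\<^sub>R e k"
  have coord: "inner (x - trunc e n x) (e k) = 0" if "k < n" for k
  proof -
    have "inner (trunc e n x) (e k) = (\<Sum>j<n. inner x (e j) * (if j = k then 1 else 0))"
      by (simp add: trunc_def inner_sum_left e)
    also have "\<dots> = inner x (e k)" using that by (simp add: sum.delta' if_distrib[of "\<lambda>z. _ * z"] cong: if_cong)
    finally show ?thesis by (simp add: inner_diff_left)
  qed
  have "orthogonal (x - trunc e n x) ?v"
    unfolding orthogonal_def inner_sum_right using coord by simp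
  from norm_add_Pythagorean[OF this]
  have "(norm (x - trunc e n x))\<^sup>2 \<le> (norm (x - trunc e n x + ?v))\<^sup>2" by simp
  also have "x - trunc e n x + ?v = x - (\<Sum>k<n. c k *\<^sub>R e k)"
    by (simp add: trunc_def scaleR_diff_left sum_subtractf)
  finally show ?thesis by (rule power2_le_imp_le) simp
qed

text \<open>Coefficients are padded by zeros. The form with all \<open>m\<close> from
  \<open>n\<close> on permits comparison with every truncation of high order.\<close>

lemma span_range_sum:
  assumes "v \<in> span (range (e :: nat \<Rightarrow> 'a::real_vector))"
  obtains c n where "\<And>m. n \<le> m \<Longrightarrow> v = (\<Sum>k<m. c k *\<^sub>R e k)"
proof -
  have "\<exists>c n. \<forall>m\<ge>n. v = (\<Sum>k<m. c k *\<^sub>R e k)"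
    using assms
  proof (induction rule: span_induct_alt)
    case base
    show ?case by (intro exI[of _ "\<lambda>_. 0"]) simp
  next
    case (step a x y)
    then obtain j c n where x: "x = e j" and c: "\<forall>m\<ge>n. y = (\<Sum>k<m. c k *\<^sub>R e k)" by auto
    have "a *\<^sub>R x + y = (\<Sum>k<m. ((if k = j then a else 0) + c k) *\<^sub>R e k)" if "max n (Suc j) \<le> m" for m
    proof -
      have "(\<Sum>k<m. (if k = j then a else 0) *\<^sub>R e k) = (\<Sum>k<m. if k = j then a *\<^sub>R e k else 0)"
        by (intro sum.cong) auto
      also have "\<dots> = a *\<^sub>R e j" using that by simp
      finally show ?thesis using c that by (simp add: x scaleR_add_left sum.distrib)
    qed
    then show ?case by (intro exI[of _ "\<lambda>k. (if k = j then a else 0) + c k"] exI[of _ "max n (Suc j)"]) blast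
  qed
  then show ?thesis using that by blast
qed

text \<open>By density some \<open>v\<close> in the span is close to \<open>x\<close>. It is a
  combination of the first \<open>m\<close> basis vectors for all large \<open>m\<close>, and the
  projection is at least as close.\<close>

lemma trunc_tendsto:
  assumes "orthonormal_basis e"
  shows "(\<lambda>n. trunc e n x) \<longlonglongrightarrow> x"
proof (rule metric_LIMSEQ_I)
  fix r :: real assume "0 < r"
  have "x \<in> closure (span (range e))" using assms by (simp add: orthonormal_basis_def)
  then obtain v where v: "v \<in> span (range e)" "dist v x < r"
    using \<open>0 < r\<close> unfolding closure_approachable by blast
  obtain c n where c: "\<And>m. n \<le> m \<Longrightarrow> v = (\<Sum>k<m. c k *\<^sub>R e k)"
    using span_range_sum[OF v(1)] by blast
  have "dist (trunc e m x) x < r" if "n \<le> m" for m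
    using trunc_norm_le[OF assms, of x m c] v(2) c[OF that] by (simp add: dist_norm norm_minus_commute)
  then show "\<exists>n. \<forall>m\<ge>n. dist (trunc e m x) x < r" by blast
qed

text \<open>The tail is expressed through the coordinates from \<open>n\<close> on alone; this is
  how the tail of an increment is seen to be measurable without its first coordinates.\<close>

lemma trunc_sums:
  assumes "orthonormal_basis e"
  shows "(\<lambda>k. inner x (e (k + n)) *\<^sub>R e (k + n)) sums (x - trunc e n x)"
  using sums_split_initial_segment[of "\<lambda>k. inner x (e k) *\<^sub>R e k" x n] trunc_tendsto[OF assms, of x]
  by (simp add: sums_def trunc_def)

text \<open>On truncations \<open>Q\<close> is diagonal with entries at most 1, so the comparison
  holds term by term; both quadratic forms are continuous and the limit preserves it.\<close>

lemma Q_norm_le_norm: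
  assumes "positive_trace_class_diag Q e q"
  shows "Q_norm Q x \<le> norm x"
proof -
  have Q: "bounded_linear Q" "\<And>j. Q (e j) = q j *\<^sub>R e j" and basis: "orthonormal_basis e"
    and q: "\<And>j. q j \<le> 1"
    and q_pos: "\<And>j. 0 < q j"
    using assms unfolding positive_trace_class_diag_def decseq_def by (auto, metis zero_le)
  have e: "inner (e i) (e j) = (if i = j then 1 else 0)" for i j
    using basis by (simp add: orthonormal_basis_def)
  interpret Q: bounded_linear Q by fact
  have "inner (Q (trunc e n x)) (trunc e n x) \<le> inner (trunc e n x) (trunc e n x)" for n
  proof -
    have inn: "inner (\<Sum>k<n. a k *\<^sub>R e k) (\<Sum>k<n. b k *\<^sub>R e k) = (\<Sum>k<n. a k * b k)" for a b
      by (simp add: inner_sum_left inner_sum_right e if_distrib[of "\<lambda>z. _ * z"] mult.commute cong: if_cong)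
    have "Q (trunc e n x) = (\<Sum>k<n. (q k * inner x (e k)) *\<^sub>R e k)"
      unfolding trunc_def by (simp add: Q.sum Q.scaleR Q(2) mult.commute)
    then have "inner (Q (trunc e n x)) (trunc e n x) = (\<Sum>k<n. q k * inner x (e k) * inner x (e k))"
      unfolding trunc_def by (simp only: inn)
    also have "\<dots> \<le> (\<Sum>k<n. inner x (e k) * inner x (e k))"
      unfolding mult.assoc by (intro sum_mono mult_right_le_one_le mult_left_le_one_le q) (auto intro: less_imp_le q_pos)
    also have "\<dots> = inner (trunc e n x) (trunc e n x)" unfolding trunc_def by (simp only: inn)
    finally show ?thesis .
  qed
  moreover have "(\<lambda>n. inner (Q (trunc e n x)) (trunc e n x)) \<longlonglongrightarrow> inner (Q x) x"
    by (intro tendsto_inner Q.tendsto trunc_tendsto basis)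
  moreover have "(\<lambda>n. inner (trunc e n x) (trunc e n x)) \<longlonglongrightarrow> inner x x"
    by (intro tendsto_inner trunc_tendsto basis)
  ultimately have "inner (Q x) x \<le> inner x x" by (intro LIMSEQ_le) auto
  then show ?thesis unfolding Q_norm_def norm_eq_sqrt_inner by simp
qed

lemma closed_ellipsoid:
  assumes "bounded_linear Q"
  shows "closed (ellipsoid Q R a)"
proof -
  interpret bounded_linear Q by fact
  have "continuous_on UNIV (\<lambda>x. Q_norm Q (x - a))"
    unfolding Q_norm_def by (intro continuous_intros continuous_on)
  then show ?thesis
    unfolding ellipsoid_def by (intro closed_Collect_le continuous_on_const)
qed

section \<open>Small ball probabilities\<close>

context hilbert_wiener
begin

text \<open>Almost surely the increment is \<open>sqrt (q k)\<close> times an increment of noise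
  \<open>k\<close>, hence a centred Gaussian with standard deviation \<open>\<sigma>\<close>. By
  \<open>q k \<le> 1\<close> the bounds on absolute moments involve only
  \<open>sqrt (t - s)\<close>, so that later constants do not depend on the coordinate.\<close>

lemma
  assumes st: "0 \<le> s" "s < t"
  shows incr_moment1: "integrable M (incr W e s t k)" "(\<integral>\<omega>. incr W e s t k \<omega> \<partial>M) = 0"
    and incr_moment2: "integrable M (\<lambda>\<omega>. (incr W e s t k \<omega>)\<^sup>2)"
      "(\<integral>\<omega>. (incr W e s t k \<omega>)\<^sup>2 \<partial>M) = q k * (t - s)"
    and incr_abs_moment1: "(\<integral>\<omega>. \<bar>incr W e s t k \<omega>\<bar> \<partial>M) \<le> sqrt (t - s)"
    and incr_abs_moment3: "integrable M (\<lambda>\<omega>. \<bar>incr W e s t k \<omega>\<bar> ^ 3)"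
      "(\<integral>\<omega>. \<bar>incr W e s t k \<omega>\<bar> ^ 3 \<partial>M) \<le> 2 * sqrt (t - s) ^ 3"
    and incr_near_pos: "0 < \<epsilon> \<Longrightarrow> 0 < prob {\<omega> \<in> space M. \<bar>incr W e s t k \<omega> - c\<bar> < \<epsilon>}"
proof -
  define \<sigma> where "\<sigma> = sqrt (q k) * sqrt (t - s)"
  have \<sigma>: "0 < \<sigma>" using q_pos[of k] st by (simp add: \<sigma>_def)
  have "distributed M lborel (\<lambda>\<omega>. \<beta> k t \<omega> - \<beta> k s \<omega>) (normal_density 0 (sqrt (t - s)))"
    using \<beta>_wiener[of k] st unfolding standard_real_wiener_def by auto
  from normal_density_affine[OF this, of "sqrt (q k)" 0]
  have D: "distributed M lborel (\<lambda>\<omega>. sqrt (q k) * (\<beta> k t \<omega> - \<beta> k s \<omega>)) (normal_density 0 \<sigma>)"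
    using q_pos[of k] st by (simp add: \<sigma>_def)
  let ?Z = "\<lambda>\<omega>. sqrt (q k) * (\<beta> k t \<omega> - \<beta> k s \<omega>)"
  have eq: "AE \<omega> in M. incr W e s t k \<omega> = ?Z \<omega>" using incr_eq st by simp
  have [measurable]: "incr W e s t k \<in> borel_measurable M" using incr_rv st by simp
  have [measurable]: "?Z \<in> borel_measurable M" using \<beta>_rv[of s k] \<beta>_rv[of t k] st by simp
  \<comment> \<open>Turns integrals against the normal density into expectations; applied to the
    identity, the square, the absolute value and its cube.\<close>
  have transfer: "integrable M (\<lambda>\<omega>. f (incr W e s t k \<omega>)) \<and> (\<integral>\<omega>. f (incr W e s t k \<omega>) \<partial>M) = v"
    if f[measurable]: "f \<in> borel_measurable borel"
      and v: "has_bochner_integral lborel (\<lambda>x. normal_density 0 \<sigma> x * f x) v" for f :: "real \<Rightarrow> real" and v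
  proof -
    have "integrable M (\<lambda>\<omega>. f (?Z \<omega>))"
      using distributed_integrable[OF D, of f] v normal_density_nonneg
      by (auto simp: has_bochner_integral_iff)
    moreover have "(\<integral>\<omega>. f (?Z \<omega>) \<partial>M) = v"
      using distributed_integral[OF D, of f] v normal_density_nonneg
      by (auto simp: has_bochner_integral_iff)
    moreover have "AE \<omega> in M. f (incr W e s t k \<omega>) = f (?Z \<omega>)" using eq by eventually_elim simp
    ultimately show ?thesis
      using integrable_cong_AE[of "\<lambda>\<omega>. f (incr W e s t k \<omega>)" M "\<lambda>\<omega>. f (?Z \<omega>)"]
        integral_cong_AE[of "\<lambda>\<omega>. f (incr W e s t k \<omega>)" M "\<lambda>\<omega>. f (?Z \<omega>)"] by simp
  qed
  have \<sigma>2: "\<sigma>\<^sup>2 = q k * (t - s)" unfolding \<sigma>_def using q_pos[of k] st by (simp add: power_mult_distrib)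
  have m2: "has_bochner_integral lborel (\<lambda>x. normal_density 0 \<sigma> x * x\<^sup>2) (\<sigma>\<^sup>2)"
  proof -
    have "fact (2 * 1) / ((2 / \<sigma>\<^sup>2) ^ 1 * fact 1) = \<sigma>\<^sup>2" by (simp add: fact_2)
    with normal_moment_even[OF \<sigma>, of 0 1] show ?thesis by simp
  qed
  have \<sigma>_le: "\<sigma> \<le> sqrt (t - s)" unfolding \<sigma>_def using q_le[of k] q_pos[of k] st by (simp add: mult_left_le_one_le)
  \<comment> \<open>Absolute moments of odd order carry the factor \<open>sqrt (2 / pi)\<close>,
    which the bounds drop.\<close>
  have pi: "sqrt (2 / pi) \<le> 1" using pi_gt3 by simp
  show "integrable M (incr W e s t k)" "(\<integral>\<omega>. incr W e s t k \<omega> \<partial>M) = 0"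
    using transfer[of "\<lambda>x. x" 0] normal_moment_odd[OF \<sigma>, of 0 0] by auto
  show "integrable M (\<lambda>\<omega>. (incr W e s t k \<omega>)\<^sup>2)" "(\<integral>\<omega>. (incr W e s t k \<omega>)\<^sup>2 \<partial>M) = q k * (t - s)"
    using transfer[OF _ m2] \<sigma>2 by simp_all
  have "(\<integral>\<omega>. \<bar>incr W e s t k \<omega>\<bar> \<partial>M) = \<sigma> * sqrt (2 / pi)"
    using transfer[of "\<lambda>x. \<bar>x\<bar>" "\<sigma> * sqrt (2 / pi)"] normal_moment_abs_odd[OF \<sigma>, of 0 0] by auto
  also have "\<dots> \<le> \<sigma> * 1" using \<sigma> pi by (intro mult_left_mono) auto
  finally show "(\<integral>\<omega>. \<bar>incr W e s t k \<omega>\<bar> \<partial>M) \<le> sqrt (t - s)" using \<sigma>_le by simp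
  have 3: "integrable M (\<lambda>\<omega>. \<bar>incr W e s t k \<omega>\<bar> ^ 3) \<and>
      (\<integral>\<omega>. \<bar>incr W e s t k \<omega>\<bar> ^ 3 \<partial>M) = 2 * \<sigma> ^ 3 * sqrt (2 / pi)"
    using transfer[of "\<lambda>x. \<bar>x\<bar> ^ 3" "2 * \<sigma> ^ 3 * sqrt (2 / pi)"] normal_moment_abs_odd[OF \<sigma>, of 0 1]
    by (auto simp: numeral_3_eq_3)
  then show "integrable M (\<lambda>\<omega>. \<bar>incr W e s t k \<omega>\<bar> ^ 3)" by simp
  have "2 * \<sigma> ^ 3 * sqrt (2 / pi) \<le> 2 * sqrt (t - s) ^ 3 * 1"
    using \<sigma> \<sigma>_le pi st by (intro mult_mono mult_left_mono power_mono) auto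
  with 3 show "(\<integral>\<omega>. \<bar>incr W e s t k \<omega>\<bar> ^ 3 \<partial>M) \<le> 2 * sqrt (t - s) ^ 3" by simp
  show "0 < prob {\<omega> \<in> space M. \<bar>incr W e s t k \<omega> - c\<bar> < \<epsilon>}" if "0 < \<epsilon>"
  proof -
    let ?I = "{c - \<epsilon> <..< c + \<epsilon>}"
    have "prob {\<omega> \<in> space M. \<bar>incr W e s t k \<omega> - c\<bar> < \<epsilon>} = prob (?Z -` ?I \<inter> space M)"
      using eq by (intro finite_measure_eq_AE) (auto elim!: eventually_mono simp: abs_less_iff)
    \<comment> \<open>If the interval had probability zero, the strictly positive density would make
      it Lebesgue null, but its length is \<open>2 * \<epsilon>\<close>.\<close>
    moreover have "emeasure M (?Z -` ?I \<inter> space M) \<noteq> 0"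
    proof
      assume "emeasure M (?Z -` ?I \<inter> space M) = 0"
      then have "(\<integral>\<^sup>+x. ennreal (normal_density 0 \<sigma> x) * indicator ?I x \<partial>lborel) = 0"
        using distributed_emeasure[OF D, of ?I] by simp
      then have "AE x in lborel. x \<notin> ?I"
        using less_imp_neq[OF normal_density_pos[OF \<sigma>, of 0]] normal_density_nonneg[of 0 \<sigma>]
        by (subst (asm) nn_integral_0_iff_AE)
          (auto elim!: eventually_mono simp: indicator_def ennreal_eq_0_iff antisym_conv split: if_splits)
      then have "emeasure lborel ?I = 0"
        by (subst (asm) AE_iff_measurable[of ?I]) (auto simp: greaterThanLessThan_def)
      then show False using that by simp
    qed
    ultimately show ?thesis
      by (simp add: emeasure_eq_measure zero_less_measure_iff)
  qed
qed

text \<open>\<open>Y\<close> is confined near a point \<open>y\<close>, and the increment is steered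
  towards \<open>z = a - y\<close>. The events for single coordinates are adjoined one at a time; by
  \<open>incr_indep\<close> each multiplies the probability by a positive factor.\<close>

lemma increment_ball_pos:
  assumes st: "0 \<le> s" "s < t" and Y: "Y \<in> borel_measurable (generated_filtration M \<eta> W s)"
    and \<epsilon>: "0 < \<epsilon>"
  shows "0 < prob {\<omega> \<in> space M. norm (Y \<omega> + (W t \<omega> - W s \<omega>) - a) < \<epsilon>}"
proof -
  \<comment> \<open>A quarter for each of four errors: \<open>Y\<close> against \<open>y\<close>,
    the tail of the increment, its first \<open>n\<close> coordinates against those of
    \<open>z\<close>, and the tail of \<open>z\<close>.\<close>
  define r where "r = \<epsilon> / 4"
  have r: "0 < r" using \<epsilon> by (simp add: r_def)
  let ?D = "\<lambda>\<omega>. W t \<omega> - W s \<omega>"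
  have [measurable]: "Y \<in> borel_measurable M" using measurable_filtration[OF Y] .
  have [measurable]: "W t \<in> borel_measurable M" "W s \<in> borel_measurable M" using W_rv st by auto
  \<comment> \<open>Separability yields \<open>y\<close>: otherwise \<open>Y\<close> would almost
    surely be at distance at least \<open>r\<close> from every point of a countable dense
    set.\<close>
  obtain y where y: "0 < prob {\<omega> \<in> space M. norm (Y \<omega> - y) < r}"
  proof (rule ccontr)
    assume no: "\<not> thesis"
    obtain S :: "'a set" where S: "countable S" "\<And>X. open X \<Longrightarrow> X \<noteq> {} \<Longrightarrow> \<exists>d\<in>S. d \<in> X"
      using countable_dense_setE by metis
    have "AE \<omega> in M. \<not> norm (Y \<omega> - y) < r" for y
    proof -
      have "prob {\<omega> \<in> space M. norm (Y \<omega> - y) < r} = 0"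
        using no that[of y] measure_nonneg[of M "{\<omega> \<in> space M. norm (Y \<omega> - y) < r}"] by linarith
      then show ?thesis by (subst AE_iff_measurable[OF _ refl]) (auto simp: emeasure_eq_measure)
    qed
    then have "AE \<omega> in M. \<forall>y\<in>S. \<not> norm (Y \<omega> - y) < r"
      using S(1) by (simp add: AE_ball_countable)
    then have "AE \<omega> in M. False"
    proof eventually_elim
      case (elim \<omega>)
      with S(2)[of "ball (Y \<omega>) r"] r show ?case by (auto simp: dist_norm)
    qed
    then show False by (simp add: AE_False not_empty prob_space)
  qed
  define z where "z = a - y"
  define A where "A = {\<omega> \<in> space M. norm (Y \<omega> - y) < r}"
  define T where "T n = {\<omega> \<in> space M. norm (?D \<omega> - trunc e n (?D \<omega>)) < r}" for n
  have trunc_meas: "(\<lambda>x. x - trunc e n x) \<in> borel_measurable borel" for n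
    unfolding trunc_def by simp
  have T_ev: "T n \<in> events" for n
    unfolding T_def using trunc_meas[of n] by measurable
  have "(\<lambda>n. \<integral>\<omega>. (indicator (space M - T n) \<omega> :: real) \<partial>M) \<longlonglongrightarrow> (\<integral>\<omega>. 0 \<partial>M)"
  proof (rule integral_dominated_convergence[where w = "\<lambda>_. 1"])
    show "AE \<omega> in M. (\<lambda>n. indicator (space M - T n) \<omega> :: real) \<longlonglongrightarrow> 0"
    proof (rule AE_I2)
      fix \<omega> assume "\<omega> \<in> space M"
      have "(\<lambda>n. norm (?D \<omega> - trunc e n (?D \<omega>))) \<longlonglongrightarrow> norm (?D \<omega> - ?D \<omega>)"
        by (intro tendsto_intros trunc_tendsto basis)
      then have "\<forall>\<^sub>F n in sequentially. norm (?D \<omega> - trunc e n (?D \<omega>)) < r"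
        using r by (intro order_tendstoD) auto
      then have "\<forall>\<^sub>F n in sequentially. indicator (space M - T n) \<omega> = (0::real)"
        by eventually_elim (simp add: T_def)
      then show "(\<lambda>n. indicator (space M - T n) \<omega> :: real) \<longlonglongrightarrow> 0" by (rule tendsto_eventually)
    qed
  qed (use T_ev in auto)
  then have "(\<lambda>n. prob (space M - T n)) \<longlonglongrightarrow> 0" using T_ev by simp
  then have ev1: "\<forall>\<^sub>F n in sequentially. prob (space M - T n) < prob A"
    using y by (intro order_tendstoD) (auto simp: A_def)
  have "(\<lambda>n. norm (z - trunc e n z)) \<longlonglongrightarrow> norm (z - z)"
    by (intro tendsto_intros trunc_tendsto basis)
  then have ev2: "\<forall>\<^sub>F n in sequentially. norm (z - trunc e n z) < r"
    using r by (intro order_tendstoD) auto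
  \<comment> \<open>The complement of \<open>T n\<close> is made less likely than \<open>A\<close>,
    so \<open>A \<inter> T n\<close> has positive probability whatever the dependence between the
    two events.\<close>
  obtain n where n: "prob (space M - T n) < prob A" "norm (z - trunc e n z) < r"
    using eventually_happens[OF eventually_conj[OF ev1 ev2]] by auto
  \<comment> \<open>Then \<open>n\<close> coordinate errors of size \<open>\<delta>\<close> add up
    to less than \<open>r\<close>; the summand 1 also covers \<open>n = 0\<close>.\<close>
  define \<delta> where "\<delta> = r / (real n + 1)"
  have \<delta>: "0 < \<delta>" "real n * \<delta> < r" using r by (simp_all add: \<delta>_def field_simps)
  define E where "E k = {\<omega> \<in> space M. \<bar>incr W e s t k \<omega> - inner z (e k)\<bar> < \<delta>}" for k
  have A_ev: "A \<in> events" unfolding A_def by measurable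
  have E_ev: "E k \<in> events" for k unfolding E_def using incr_rv[of s t k] st by simp
  \<comment> \<open>\<open>A\<close>, the tail event and the events for coordinates below
    \<open>j\<close> all lie in \<open>past_and_others\<close> for coordinate \<open>j\<close>, so
    \<open>E j\<close> splits off as a factor.\<close>
  have peel: "0 < prob (A \<inter> T n \<inter> (\<Inter>k\<in>{..<j}. E k) \<inter> space M)" if "j \<le> n" for j
    using that
  proof (induction j)
    case 0
    have "prob A \<le> prob (A \<inter> T n) + prob (space M - T n)"
      using A_ev T_ev[of n] sets.sets_into_space[OF A_ev]
      by (intro order.trans[OF finite_measure_mono measure_subadditive]) auto
    with n(1) show ?case using sets.sets_into_space[OF A_ev] by (simp add: Int_absorb2 le_infI1)
  next
    case (Suc j)
    let ?S = "past_and_others M \<eta> W e s t j"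
    let ?B = "A \<inter> T n \<inter> (\<Inter>k\<in>{..<j}. E k) \<inter> space M"
    have sp: "space ?S = space M" using st by (simp add: space_past_and_others)
    have oth: "incr W e s t l \<in> borel_measurable ?S" if "l \<noteq> j" for l
      using measurable_others[of l j s t] that st by simp
    have [measurable]: "Y \<in> borel_measurable ?S" using measurable_past[OF Y] st by simp
    \<comment> \<open>Written as a series, the tail involves only coordinates \<open>l + n\<close>,
      none of which is \<open>j\<close>, since \<open>j < n\<close>.\<close>
    have "(\<lambda>\<omega>. \<Sum>l. incr W e s t (l + n) \<omega> *\<^sub>R e (l + n)) \<in> borel_measurable ?S"
      using oth Suc.prems
      by (intro borel_measurable_suminf borel_measurable_scaleR borel_measurable_const) auto
    also have "(\<lambda>\<omega>. \<Sum>l. incr W e s t (l + n) \<omega> *\<^sub>R e (l + n)) = (\<lambda>\<omega>. ?D \<omega> - trunc e n (?D \<omega>))"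
      unfolding incr_def using sums_unique[OF trunc_sums[OF basis]] by (auto simp: fun_eq_iff)
    finally have [measurable]: "(\<lambda>\<omega>. ?D \<omega> - trunc e n (?D \<omega>)) \<in> borel_measurable ?S" .
    have "A \<in> sets ?S" unfolding A_def sp[symmetric] by measurable
    moreover have "T n \<in> sets ?S" unfolding T_def sp[symmetric] by measurable
    moreover have "E k \<in> sets ?S" if "k < j" for k
    proof -
      have [measurable]: "incr W e s t k \<in> borel_measurable ?S" using oth[of k] that by simp
      show ?thesis unfolding E_def sp[symmetric] by measurable
    qed
    ultimately have B: "?B \<in> sets ?S"
      using sets.top[of ?S] unfolding sp by (cases "j = 0") (auto intro!: sets.Int sets.finite_INT)
    have "id \<in> measurable ?S ?S" by simp
    note indep_rvD[OF incr_indep[OF st this] B, of "{inner z (e j) - \<delta> <..< inner z (e j) + \<delta>}"]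
    moreover have "id -` ?B \<inter> space M = ?B" by auto
    moreover have "incr W e s t j -` {inner z (e j) - \<delta> <..< inner z (e j) + \<delta>} \<inter> space M = E j"
      by (auto simp: E_def abs_less_iff)
    ultimately have "prob (?B \<inter> E j) = prob ?B * prob (E j)" by simp
    moreover have "0 < prob (E j)" unfolding E_def using incr_near_pos[OF st \<delta>(1)] .
    moreover have "A \<inter> T n \<inter> (\<Inter>k\<in>{..<Suc j}. E k) \<inter> space M = ?B \<inter> E j"
      by (auto simp: lessThan_Suc)
    ultimately show ?case using Suc by simp
  qed
  have "A \<inter> T n \<inter> (\<Inter>k\<in>{..<n}. E k) \<inter> space M \<subseteq>
      {\<omega> \<in> space M. norm (Y \<omega> + ?D \<omega> - a) < \<epsilon>}"
  proof
    fix \<omega> assume "\<omega> \<in> A \<inter> T n \<inter> (\<Inter>k\<in>{..<n}. E k) \<inter> space M"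
    then have \<omega>: "\<omega> \<in> space M" "norm (Y \<omega> - y) < r" "norm (?D \<omega> - trunc e n (?D \<omega>)) < r"
      "\<And>k. k < n \<Longrightarrow> \<bar>incr W e s t k \<omega> - inner z (e k)\<bar> < \<delta>"
      by (auto simp: A_def T_def E_def)
    have "norm (trunc e n (?D \<omega>) - trunc e n z) = norm (\<Sum>k<n. (incr W e s t k \<omega> - inner z (e k)) *\<^sub>R e k)"
      by (simp add: trunc_def incr_def scaleR_diff_left sum_subtractf)
    also have "\<dots> \<le> (\<Sum>k<n. \<delta>)"
      using \<omega>(4) e_inner by (intro sum_norm_le) (auto simp: norm_eq_sqrt_inner less_imp_le)
    also have "\<dots> < r" using \<delta> by simp
    finally have "norm (trunc e n (?D \<omega>) - trunc e n z) < r" .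
    moreover have "norm (u + v + w - x) \<le> norm u + norm v + norm w + norm x" for u v w x :: 'a
      using norm_triangle_ineq4[of "u + v + w" x] norm_triangle_ineq[of "u + v" w] norm_triangle_ineq[of u v]
      by linarith
    from this[of "Y \<omega> - y" "?D \<omega> - trunc e n (?D \<omega>)" "trunc e n (?D \<omega>) - trunc e n z" "z - trunc e n z"]
    have "norm (Y \<omega> + ?D \<omega> - a) \<le> norm (Y \<omega> - y) + norm (?D \<omega> - trunc e n (?D \<omega>)) +
        norm (trunc e n (?D \<omega>) - trunc e n z) + norm (z - trunc e n z)"
      by (simp add: z_def algebra_simps)
    ultimately show "\<omega> \<in> {\<omega> \<in> space M. norm (Y \<omega> + ?D \<omega> - a) < \<epsilon>}"
      using \<omega>(1-3) n(2) unfolding r_def by simp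
  qed
  then have "prob (A \<inter> T n \<inter> (\<Inter>k\<in>{..<n}. E k) \<inter> space M) \<le>
      prob {\<omega> \<in> space M. norm (Y \<omega> + ?D \<omega> - a) < \<epsilon>}"
    by (intro finite_measure_mono) measurable
  with peel[of n] show ?thesis by simp
qed

section \<open>Bounded drift over a time interval\<close>

lemma solution_rv:
  assumes "strong_solution M W F \<eta> X" "0 \<le> t"
  shows "X t \<in> borel_measurable M"
  using assms measurable_filtration unfolding strong_solution_def by blast

text \<open>One exceptional null set serves all pairs of times. The interval is open on the left so
  that consecutive steps are disjoint and their integrals add up.\<close>

lemma solution_increment:
  assumes X: "strong_solution M W F \<eta> X" and F: "\<And>x. norm (F x) \<le> C"
  shows "AE \<omega> in M. \<forall>s t. 0 \<le> s \<and> s \<le> t \<longrightarrow>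
    set_integrable lborel {s<..t} (\<lambda>r. F (X r \<omega>)) \<and>
    X t \<omega> - X s \<omega> = W t \<omega> - W s \<omega> + (LINT r:{s<..t}|lborel. F (X r \<omega>)) \<and>
    norm (LINT r:{s<..t}|lborel. F (X r \<omega>)) \<le> C * (t - s)"
proof -
  have "AE \<omega> in M. \<forall>t\<ge>0. set_integrable lborel {0..t} (\<lambda>s. F (X s \<omega>)) \<and>
      X t \<omega> = \<eta> \<omega> + W t \<omega> + (LINT s:{0..t}|lborel. F (X s \<omega>))"
    using X unfolding strong_solution_def by blast
  then show ?thesis
  proof eventually_elim
    case (elim \<omega>)
    show ?case
    proof (intro allI impI)
      fix s t :: real assume st: "0 \<le> s \<and> s \<le> t"
      let ?f = "\<lambda>r. F (X r \<omega>)"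
      have int: "set_integrable lborel {0..s} ?f" "set_integrable lborel {0..t} ?f"
        using elim st by auto
      have int': "set_integrable lborel {s<..t} ?f"
        by (rule set_integrable_subset[OF int(2)]) (use st in auto)
      have "{0..t} = {0..s} \<union> {s<..t}" using st by auto
      then have "(LINT r:{0..t}|lborel. ?f r) = (LINT r:{0..s}|lborel. ?f r) + (LINT r:{s<..t}|lborel. ?f r)"
        using set_integral_Un[OF _ int(1) int'] by (simp add: ivl_disj_int)
      then have eq: "X t \<omega> - X s \<omega> = W t \<omega> - W s \<omega> + (LINT r:{s<..t}|lborel. ?f r)"
        using elim st by auto
      have "norm (LINT r:{s<..t}|lborel. ?f r) \<le> (LINT r:{s<..t}|lborel. norm (?f r))"
        by (rule set_integral_norm_bound[OF int'])
      also have "\<dots> \<le> (LINT r:{s<..t}|lborel. C)"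
      proof (rule set_integral_mono)
        have "integrable lborel (indicat_real {s<..t})"
          using st by (intro integrable_real_indicator) auto
        then show "set_integrable lborel {s<..t} (\<lambda>_. C)" by (simp add: set_integrable_def)
      qed (use set_integrable_norm[OF int'] F in auto)
      also have "\<dots> = C * (t - s)" using st by (simp add: set_integral_const)
      finally show "set_integrable lborel {s<..t} ?f \<and>
          X t \<omega> - X s \<omega> = W t \<omega> - W s \<omega> + (LINT r:{s<..t}|lborel. ?f r) \<and>
          norm (LINT r:{s<..t}|lborel. ?f r) \<le> C * (t - s)"
        using eq int' by blast
    qed
  qed
qed

lemma solution_ball_pos:
  assumes X: "strong_solution M W F \<eta> X" and F: "\<And>x. norm (F x) \<le> C" and "0 < t" "0 < \<epsilon>"
  shows "0 < prob {\<omega> \<in> space M. norm (X t \<omega> - a) < \<epsilon>}"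
proof -
  have C: "0 \<le> C" using F[of 0] norm_ge_zero[of "F 0"] by linarith
  \<comment> \<open>This \<open>h\<close> keeps the drift contribution below
    \<open>\<epsilon> / 2\<close>; \<open>C + 1\<close> avoids a division by zero, and the minimum
    with \<open>t\<close> keeps the starting time nonnegative.\<close>
  define h where "h = min t (\<epsilon> / (2 * (C + 1)))"
  have h: "0 < h" "h \<le> t" using assms C by (auto simp: h_def)
  have "C * h \<le> C * (\<epsilon> / (2 * (C + 1)))" using C by (intro mult_left_mono) (simp add: h_def)
  also have "\<dots> \<le> \<epsilon> / 2" using C \<open>0 < \<epsilon>\<close> by (simp add: field_simps)
  finally have Ch: "C * h \<le> \<epsilon> / 2" .
  define s where "s = t - h"
  have s: "0 \<le> s" "s < t" using h by (auto simp: s_def)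
  have [measurable]: "X t \<in> borel_measurable M" "X s \<in> borel_measurable M"
    using solution_rv[OF X] s by auto
  have [measurable]: "W t \<in> borel_measurable M" "W s \<in> borel_measurable M" using W_rv s by auto
  have "X s \<in> borel_measurable (generated_filtration M \<eta> W s)"
    using X s unfolding strong_solution_def by blast
  from increment_ball_pos[OF s this, of "\<epsilon> / 2" a] \<open>0 < \<epsilon>\<close>
  have "0 < prob {\<omega> \<in> space M. norm (X s \<omega> + (W t \<omega> - W s \<omega>) - a) < \<epsilon> / 2}" by simp
  also have "\<dots> \<le> prob {\<omega> \<in> space M. norm (X t \<omega> - a) < \<epsilon>}"
  proof (rule finite_measure_mono_AE)
    show "AE \<omega> in M. \<omega> \<in> {\<omega> \<in> space M. norm (X s \<omega> + (W t \<omega> - W s \<omega>) - a) < \<epsilon> / 2} \<longrightarrow>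
        \<omega> \<in> {\<omega> \<in> space M. norm (X t \<omega> - a) < \<epsilon>}"
      using solution_increment[OF X F]
    proof eventually_elim
      case (elim \<omega>)
      let ?I = "LINT r:{s<..t}|lborel. F (X r \<omega>)"
      have "X t \<omega> - X s \<omega> = W t \<omega> - W s \<omega> + ?I" "norm ?I \<le> C * h"
        using elim[rule_format, of s t] s by (auto simp: s_def)
      then have "X t \<omega> - a = (X s \<omega> + (W t \<omega> - W s \<omega>) - a) + ?I" "norm ?I \<le> \<epsilon> / 2"
        using Ch by (auto simp: algebra_simps)
      moreover from this(1) have "norm (X t \<omega> - a) \<le> norm (X s \<omega> + (W t \<omega> - W s \<omega>) - a) + norm ?I"
        by (metis norm_triangle_ineq)
      ultimately show ?case by auto
    qed
  qed measurable
  finally show ?thesis .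
qed

end

section \<open>Calculus of smooth cylindrical functions\<close>

lemma smooth_continuous: "smooth_compact_support m f \<Longrightarrow> continuous_on UNIV f"
  unfolding smooth_compact_support_def using Ck_on_coords.simps(1) by blast

lemma smooth_has_derivative:
  assumes "smooth_compact_support m f" "i < m"
  shows "((\<lambda>s. f (x(i := s))) has_real_derivative coord_deriv i f (x(i := s))) (at s)"
proof -
  have "Ck_on_coords m (Suc 0) f" using assms(1) unfolding smooth_compact_support_def by blast
  then have "(\<lambda>u. f ((x(i := s))(i := u))) differentiable (at ((x(i := s)) i))"
    using assms(2) unfolding Ck_on_coords.simps by blast
  then show ?thesis
    by (simp add: coord_deriv_def DERIV_deriv_iff_real_differentiable)
qed

text \<open>Closure under partial derivatives lets every bound for the class be applied to
  derivatives of any order; the same radius \<open>r\<close> serves for the support.\<close>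

lemma smooth_coord_deriv:
  assumes f: "smooth_compact_support m f" and i: "i < m"
  shows "smooth_compact_support m (coord_deriv i f)"
  unfolding smooth_compact_support_def
proof (intro conjI allI)
  have dep: "\<And>x y. (\<forall>i<m. x i = y i) \<Longrightarrow> f x = f y"
    using f unfolding smooth_compact_support_def depends_on_first_def by blast
  show "depends_on_first m (coord_deriv i f)"
    unfolding depends_on_first_def coord_deriv_def
  proof (intro allI impI)
    fix x y :: "nat \<Rightarrow> real" assume xy: "\<forall>i<m. x i = y i"
    then have "f (x(i := s)) = f (y(i := s))" for s by (intro dep) auto
    then show "deriv (\<lambda>s. f (x(i := s))) (x i) = deriv (\<lambda>s. f (y(i := s))) (y i)"
      using xy i by simp
  qed
  show "Ck_on_coords m k (coord_deriv i f)" for k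
    using f i Ck_on_coords.simps(2)[of m k f] unfolding smooth_compact_support_def by blast
  obtain r where r: "\<And>x. \<exists>i<m. r < \<bar>x i\<bar> \<Longrightarrow> f x = 0"
    using f unfolding smooth_compact_support_def by blast
  show "\<exists>r. \<forall>x. (\<exists>i<m. r < \<bar>x i\<bar>) \<longrightarrow> coord_deriv i f x = 0"
  proof (intro exI allI impI)
    fix x :: "nat \<Rightarrow> real" assume "\<exists>i<m. r < \<bar>x i\<bar>"
    then obtain j where j: "j < m" "r < \<bar>x j\<bar>" by blast
    have "\<forall>\<^sub>F s in nhds (x i). f (x(i := s)) = 0"
    proof (cases "j = i")
      case True
      \<comment> \<open>The strict inequality makes the set open: along this line \<open>f\<close>
        vanishes in a whole neighbourhood of \<open>x i\<close>, hence so does the derivative at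
        \<open>x i\<close>.\<close>
      have "open {s :: real. r < \<bar>s\<bar>}" by (intro open_Collect_less continuous_intros)
      then have "\<forall>\<^sub>F s in nhds (x i). s \<in> {s. r < \<bar>s\<bar>}"
        using j True by (intro eventually_nhds_in_open) auto
      then show ?thesis
      proof eventually_elim
        case (elim s)
        then show ?case using i by (intro r) (auto intro!: exI[of _ i])
      qed
    next
      case False
      then show ?thesis using j by (intro always_eventually allI r) (auto intro!: exI[of _ j])
    qed
    then have "deriv (\<lambda>s. f (x(i := s))) (x i) = deriv (\<lambda>s. 0) (x i)"
      by (intro deriv_cong_ev) auto
    then show "coord_deriv i f x = 0" by (simp add: coord_deriv_def)
  qed
qed

lemma smooth_bounded:
  assumes f: "smooth_compact_support m f"
  obtains K where "0 \<le> K" "\<And>x. \<bar>f x\<bar> \<le> K"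
proof -
  obtain r where r: "\<And>x. \<exists>i<m. r < \<bar>x i\<bar> \<Longrightarrow> f x = 0"
    using f unfolding smooth_compact_support_def by blast
  have dep: "\<And>x y. (\<forall>i<m. x i = y i) \<Longrightarrow> f x = f y"
    using f unfolding smooth_compact_support_def depends_on_first_def by blast
  \<comment> \<open>Coordinates from \<open>m\<close> on are frozen at 0, which does not change
    \<open>f\<close>. The box is then a product of compact sets, compact by Tychonoff although it
    has infinitely many factors.\<close>
  define S where "S = (\<Pi>\<^sub>E i\<in>UNIV. if i < m then {- r..r} else {0 :: real})"
  have "compact S"
    unfolding S_def compactin_euclidean_iff[symmetric] euclidean_product_topology[symmetric] compactin_PiE
    by auto
  then have "compact (f ` S)"
    using smooth_continuous[OF f] by (intro compact_continuous_image) (auto intro: continuous_on_subset)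
  then obtain K where K: "\<And>y. y \<in> f ` S \<Longrightarrow> \<bar>y\<bar> \<le> K"
    by (meson compact_imp_bounded bounded_real)
  have "\<bar>f x\<bar> \<le> max K 0" for x
  proof (cases "\<exists>i<m. r < \<bar>x i\<bar>")
    case True
    then show ?thesis using r by simp
  next
    case False
    then have "- r \<le> x i" "x i \<le> r" if "i < m" for i
      using that by (meson abs_le_iff minus_le_iff not_less)+
    then have "(\<lambda>i. if i < m then x i else 0) \<in> S" unfolding S_def by auto
    moreover have "f x = f (\<lambda>i. if i < m then x i else 0)" by (rule dep) simp
    ultimately show ?thesis using K by (metis imageI max.coboundedI1)
  qed
  then show ?thesis using that[of "max K 0"] by simp
qed

text \<open>Maclaurin's formula along a line in direction \<open>i\<close>. The point
  \<open>u\<close> in the remainder is not located, which is enough wherever the derivative of order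
  \<open>n\<close> is bounded globally.\<close>

lemma smooth_taylor:
  assumes f: "smooth_compact_support m f" and i: "i < m"
  shows "\<exists>u. f (x(i := x i + d)) =
    (\<Sum>k<n. (coord_deriv i ^^ k) f x / fact k * d ^ k) + (coord_deriv i ^^ n) f u / fact n * d ^ n"
proof -
  define g where "g k s = (coord_deriv i ^^ k) f (x(i := x i + s))" for k s
  have sm: "smooth_compact_support m ((coord_deriv i ^^ k) f)" for k
    by (induction k) (use f i smooth_coord_deriv in auto)
  have "DERIV (g k) s :> g (Suc k) s" for k s
    unfolding g_def
    using DERIV_shift[THEN iffD1, OF smooth_has_derivative[OF sm[of k] i, of x "s + x i"]]
    by (simp add: add.commute)
  then obtain t where "g 0 d = (\<Sum>k<n. g k 0 / fact k * d ^ k) + g n t / fact n * d ^ n"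
    using Maclaurin_all_le[of g "g 0" d n] by blast
  then show ?thesis unfolding g_def by auto
qed

text \<open>
  With \<open>d\<close> a Gaussian increment, \<open>mixed k x d\<close> is independent of \<open>d k\<close>; this is why the expansions
  below change one coordinate at a time.
\<close>

definition mixed :: "nat \<Rightarrow> (nat \<Rightarrow> real) \<Rightarrow> (nat \<Rightarrow> real) \<Rightarrow> nat \<Rightarrow> real" where
  "mixed k x d = (\<lambda>j. if j < k then x j + d j else x j)"

lemma mixed_0 [simp]: "mixed 0 x d = x"
  and mixed_Suc: "mixed (Suc k) x d = (mixed k x d)(k := mixed k x d k + d k)"
  and mixed_self [simp]: "mixed k x d k = x k"
  by (auto simp: mixed_def fun_eq_iff less_Suc_eq)

text \<open>Coordinates from \<open>m\<close> on do not affect \<open>f\<close>, so \<open>m\<close>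
  moves of a single coordinate account for the whole displacement.\<close>

lemma mixed_telescope:
  assumes "smooth_compact_support m f"
  shows "f (\<lambda>j. x j + d j) - f x = (\<Sum>k<m. f (mixed (Suc k) x d) - f (mixed k x d))"
proof -
  have "f (\<lambda>j. x j + d j) = f (mixed m x d)"
    using assms unfolding smooth_compact_support_def depends_on_first_def
    by (auto simp: mixed_def)
  then show ?thesis using sum_lessThan_telescope[of "\<lambda>k. f (mixed k x d)" m] by simp
qed

text \<open>Each move of one coordinate costs at most a bounded partial derivative times the
  displacement. The sum of absolute differences serves as distance because its expectation splits
  into coordinates.\<close>

lemma smooth_lipschitz:
  assumes f: "smooth_compact_support m f"
  obtains L where "0 \<le> L" "\<And>x y. \<bar>f x - f y\<bar> \<le> L * (\<Sum>i<m. \<bar>x i - y i\<bar>)"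
proof -
  have "\<forall>i\<in>{..<m}. \<exists>K. \<forall>x. \<bar>coord_deriv i f x\<bar> \<le> K"
    using smooth_bounded[OF smooth_coord_deriv[OF f]] by (metis lessThan_iff)
  then obtain K where K: "\<And>i x. i < m \<Longrightarrow> \<bar>coord_deriv i f x\<bar> \<le> K i" by (metis lessThan_iff)
  define L where "L = (\<Sum>i<m. \<bar>K i\<bar>)"
  have KL: "K i \<le> L" if "i < m" for i
    unfolding L_def using member_le_sum[of i "{..<m}" "\<lambda>i. \<bar>K i\<bar>"] that by auto
  have "\<bar>f x - f y\<bar> \<le> L * (\<Sum>i<m. \<bar>x i - y i\<bar>)" for x y
  proof -
    define d where "d = (\<lambda>j. x j - y j)"
    have "\<bar>f (mixed (Suc k) y d) - f (mixed k y d)\<bar> \<le> L * \<bar>d k\<bar>" if k: "k < m" for k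
    proof -
      obtain u where "f ((mixed k y d)(k := mixed k y d k + d k)) = f (mixed k y d) + coord_deriv k f u * d k"
        using smooth_taylor[OF f k, of "mixed k y d" "d k" 1] by auto
      then have "f (mixed (Suc k) y d) - f (mixed k y d) = coord_deriv k f u * d k"
        unfolding mixed_Suc by simp
      moreover have "\<bar>coord_deriv k f u\<bar> \<le> L" using K[OF k] KL[OF k] by (rule order.trans)
      ultimately show ?thesis by (simp add: abs_mult mult_right_mono)
    qed
    then have "\<bar>\<Sum>k<m. f (mixed (Suc k) y d) - f (mixed k y d)\<bar> \<le> (\<Sum>k<m. L * \<bar>d k\<bar>)"
      by (intro order.trans[OF sum_abs] sum_mono) simp
    with mixed_telescope[OF f, of y d] show ?thesis by (simp add: d_def sum_distrib_left)
  qed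
  moreover have "0 \<le> L" by (simp add: L_def sum_nonneg)
  ultimately show ?thesis using that by blast
qed

text \<open>Intended for the drift: its displacement has the order of the time step, so a quadratic
  remainder is negligible.\<close>

lemma smooth_first_order:
  assumes f: "smooth_compact_support m f"
  obtains L where "0 \<le> L"
    "\<And>x d. \<bar>f (\<lambda>j. x j + d j) - f x - (\<Sum>k<m. coord_deriv k f x * d k)\<bar> \<le> L * (\<Sum>i<m. \<bar>d i\<bar>)\<^sup>2"
proof -
  have "\<forall>i\<in>{..<m}. \<exists>K\<ge>0. \<forall>x y. \<bar>coord_deriv i f x - coord_deriv i f y\<bar> \<le> K * (\<Sum>i<m. \<bar>x i - y i\<bar>)"
    using smooth_lipschitz[OF smooth_coord_deriv[OF f]] by (metis lessThan_iff)
  then obtain K where K: "\<And>i. i < m \<Longrightarrow> 0 \<le> K i"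
    "\<And>i x y. i < m \<Longrightarrow> \<bar>coord_deriv i f x - coord_deriv i f y\<bar> \<le> K i * (\<Sum>i<m. \<bar>x i - y i\<bar>)"
    by (metis lessThan_iff)
  define L where "L = (\<Sum>i<m. K i)"
  have L0: "0 \<le> L" unfolding L_def using K(1) by (intro sum_nonneg) auto
  have KL: "K i \<le> L" if "i < m" for i
    unfolding L_def using member_le_sum[of i "{..<m}" K] that K(1) by auto
  have "\<bar>f (\<lambda>j. x j + d j) - f x - (\<Sum>k<m. coord_deriv k f x * d k)\<bar> \<le> L * (\<Sum>i<m. \<bar>d i\<bar>)\<^sup>2" for x d
  proof -
    let ?N = "\<Sum>i<m. \<bar>d i\<bar>"
    have step: "\<bar>f (mixed (Suc k) x d) - f (mixed k x d) - coord_deriv k f x * d k\<bar> \<le> L * ?N * \<bar>d k\<bar>"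
      if k: "k < m" for k
    proof -
      \<comment> \<open>Here the intermediate point must be located, hence the mean value theorem
        for either sign of \<open>d k\<close>. It differs from \<open>x\<close> by at most
        \<open>\<bar>d i\<bar>\<close> in each coordinate \<open>i\<close>, and the Lipschitz bound
        for the derivative supplies the second factor of the remainder.\<close>
      have "\<exists>u. f (mixed (Suc k) x d) - f (mixed k x d) = coord_deriv k f ((mixed k x d)(k := u)) * d k \<and>
          \<bar>u - x k\<bar> \<le> \<bar>d k\<bar>"
      proof (cases "d k = 0")
        case True
        moreover have "(mixed k x d)(k := x k) = mixed k x d" by (auto simp: fun_eq_iff)
        ultimately show ?thesis unfolding mixed_Suc by (intro exI[of _ "x k"]) simp
      next
        case False
        have D: "((\<lambda>s. f ((mixed k x d)(k := s))) has_real_derivative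
            coord_deriv k f ((mixed k x d)(k := s))) (at s)" for s
          by (rule smooth_has_derivative[OF f k])
        show ?thesis
        proof (cases "0 < d k")
          case True
          then obtain u where "x k < u" "u < x k + d k"
            "f ((mixed k x d)(k := x k + d k)) - f ((mixed k x d)(k := x k)) =
              (x k + d k - x k) * coord_deriv k f ((mixed k x d)(k := u))"
            using MVT2[of "x k" "x k + d k" "\<lambda>s. f ((mixed k x d)(k := s))" "\<lambda>s. coord_deriv k f ((mixed k x d)(k := s))"] D
            by auto
          moreover have "(mixed k x d)(k := x k) = mixed k x d" by (auto simp: fun_eq_iff)
          ultimately show ?thesis unfolding mixed_Suc by (intro exI[of _ u]) (simp add: mult.commute)
        next
          case False
          with \<open>d k \<noteq> 0\<close> obtain u where "x k + d k < u" "u < x k"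
            "f ((mixed k x d)(k := x k)) - f ((mixed k x d)(k := x k + d k)) =
              (x k - (x k + d k)) * coord_deriv k f ((mixed k x d)(k := u))"
            using MVT2[of "x k + d k" "x k" "\<lambda>s. f ((mixed k x d)(k := s))" "\<lambda>s. coord_deriv k f ((mixed k x d)(k := s))"] D
            by auto
          moreover have "(mixed k x d)(k := x k) = mixed k x d" by (auto simp: fun_eq_iff)
          ultimately show ?thesis unfolding mixed_Suc by (intro exI[of _ u]) (simp add: mult.commute)
        qed
      qed
      then obtain u where u: "f (mixed (Suc k) x d) - f (mixed k x d) = coord_deriv k f ((mixed k x d)(k := u)) * d k"
        "\<bar>u - x k\<bar> \<le> \<bar>d k\<bar>" by blast
      have "\<bar>coord_deriv k f ((mixed k x d)(k := u)) - coord_deriv k f x\<bar>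
          \<le> K k * (\<Sum>i<m. \<bar>((mixed k x d)(k := u)) i - x i\<bar>)" by (rule K(2)[OF k])
      also have "\<dots> \<le> L * ?N"
        using KL[OF k] u(2) K(1)[OF k] by (intro mult_mono sum_mono sum_nonneg L0) (auto simp: mixed_def)
      finally have "\<bar>(coord_deriv k f ((mixed k x d)(k := u)) - coord_deriv k f x) * d k\<bar> \<le> L * ?N * \<bar>d k\<bar>"
        unfolding abs_mult by (intro mult_right_mono) auto
      then show ?thesis unfolding u(1) by (simp add: left_diff_distrib)
    qed
    have "\<bar>\<Sum>k<m. f (mixed (Suc k) x d) - f (mixed k x d) - coord_deriv k f x * d k\<bar> \<le> (\<Sum>k<m. L * ?N * \<bar>d k\<bar>)"
      using step by (intro order.trans[OF sum_abs] sum_mono) simp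
    also have "\<dots> = L * ?N\<^sup>2" by (simp add: sum_distrib_left[symmetric] power2_eq_square)
    finally show ?thesis using mixed_telescope[OF f, of x d] by (simp add: sum_subtractf)
  qed
  with L0 show ?thesis using that by blast
qed

text \<open>Intended for Gaussian increments: their displacement has the order of the square root of
  the time step, so the quadratic term must be kept and the cubic one is negligible.
  \<open>K\<close> bounds the third derivative; the factor 1/6 is dropped.\<close>

lemma smooth_second_order:
  assumes f: "smooth_compact_support m f" and i: "i < m"
  obtains K where "0 \<le> K" "\<And>x d. \<bar>f (x(i := x i + d)) - f x - coord_deriv i f x * d -
      1/2 * coord_deriv i (coord_deriv i f) x * d\<^sup>2\<bar> \<le> K * \<bar>d\<bar> ^ 3"
proof -
  obtain K where K: "0 \<le> K" "\<And>x. \<bar>coord_deriv i (coord_deriv i (coord_deriv i f)) x\<bar> \<le> K"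
    using smooth_bounded[OF smooth_coord_deriv[OF smooth_coord_deriv[OF smooth_coord_deriv[OF f i] i] i]] by metis
  have "\<bar>f (x(i := x i + d)) - f x - coord_deriv i f x * d -
      1/2 * coord_deriv i (coord_deriv i f) x * d\<^sup>2\<bar> \<le> K * \<bar>d\<bar> ^ 3" for x d
  proof -
    obtain u where "f (x(i := x i + d)) = (\<Sum>k<3. (coord_deriv i ^^ k) f x / fact k * d ^ k) +
        (coord_deriv i ^^ 3) f u / fact 3 * d ^ 3"
      using smooth_taylor[OF f i] by blast
    then have "f (x(i := x i + d)) - f x - coord_deriv i f x * d - 1/2 * coord_deriv i (coord_deriv i f) x * d\<^sup>2
        = coord_deriv i (coord_deriv i (coord_deriv i f)) u / 6 * d ^ 3"
      by (simp add: eval_nat_numeral lessThan_Suc field_simps)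
    note arg_cong[OF this, where f = abs]
    also have "\<bar>\<dots>\<bar> \<le> K * \<bar>d\<bar> ^ 3"
      unfolding abs_mult power_abs using K(2)[of u] K(1) by (intro mult_right_mono) auto
    finally show ?thesis .
  qed
  with K(1) show ?thesis using that by blast
qed

section \<open>The generator on cylindrical functions\<close>

definition coords :: "(nat \<Rightarrow> 'a::real_inner) \<Rightarrow> 'a \<Rightarrow> nat \<Rightarrow> real" where
  "coords e x = (\<lambda>j. inner x (e j))"

lemma coords_add_basis:
  assumes "orthonormal_basis e"
  shows "coords e (x + s *\<^sub>R e i) = (coords e x)(i := coords e x i + s)"
  using assms by (auto simp: coords_def orthonormal_basis_def inner_add_left fun_eq_iff)

text \<open>Moving along \<open>e i\<close> changes coordinate \<open>i\<close> alone, which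
  \<open>f\<close> does not see for \<open>i\<close> from \<open>m\<close> on. The result is an
  equation between functions, so that it can be applied a second time for the second
  derivative.\<close>

lemma dir_deriv_cylinder:
  assumes e: "orthonormal_basis e" and f: "smooth_compact_support m f"
  shows "dir_deriv (e i) (\<lambda>x. f (coords e x)) =
    (if i < m then (\<lambda>x. coord_deriv i f (coords e x)) else (\<lambda>x. 0))"
proof (rule ext)
  fix x
  show "dir_deriv (e i) (\<lambda>x. f (coords e x)) x =
    (if i < m then (\<lambda>x. coord_deriv i f (coords e x)) else (\<lambda>x. 0)) x"
  proof (cases "i < m")
    case True
    have "((\<lambda>s. f ((coords e x)(i := s + coords e x i))) has_real_derivative coord_deriv i f (coords e x)) (at 0)"
      using DERIV_shift[of "\<lambda>s. f ((coords e x)(i := s))" _ 0 "coords e x i"]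
        smooth_has_derivative[OF f True, of "coords e x" "coords e x i"] by simp
    then show ?thesis
      unfolding dir_deriv_def coords_add_basis[OF e] using True
      by (simp add: DERIV_imp_deriv add.commute)
  next
    case False
    have "f ((coords e x)(i := s)) = f (coords e x)" for s
      using f False unfolding smooth_compact_support_def depends_on_first_def
      by (metis fun_upd_other)
    then show ?thesis
      unfolding dir_deriv_def coords_add_basis[OF e] using False by simp
  qed
qed

lemma generator_cylinder:
  assumes e: "orthonormal_basis e" and f: "smooth_compact_support m f"
  shows "generator e q F (\<lambda>x. f (coords e x)) x =
    (\<Sum>i<m. 1/2 * q i * coord_deriv i (coord_deriv i f) (coords e x)) +
    (\<Sum>i<m. inner (F x) (e i) * coord_deriv i f (coords e x))"
proof -
  have 2: "dir_deriv (e i) (dir_deriv (e i) (\<lambda>x. f (coords e x))) x =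
      (if i < m then coord_deriv i (coord_deriv i f) (coords e x) else 0)" for i
  proof (cases "i < m")
    case True
    then show ?thesis
      using dir_deriv_cylinder[OF e f, of i] dir_deriv_cylinder[OF e smooth_coord_deriv[OF f True], of i] by simp
  next
    case False
    then show ?thesis using dir_deriv_cylinder[OF e f, of i] by (simp add: dir_deriv_def)
  qed
  have "(\<Sum>i. 1/2 * q i * dir_deriv (e i) (dir_deriv (e i) (\<lambda>x. f (coords e x))) x) =
      (\<Sum>i<m. 1/2 * q i * coord_deriv i (coord_deriv i f) (coords e x))"
    unfolding 2 by (subst suminf_finite[of "{..<m}"]) auto
  moreover have "(\<Sum>i. inner (F x) (e i) * dir_deriv (e i) (\<lambda>x. f (coords e x)) x) =
      (\<Sum>i<m. inner (F x) (e i) * coord_deriv i f (coords e x))"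
    unfolding dir_deriv_cylinder[OF e f] by (subst suminf_finite[of "{..<m}"]) auto
  ultimately show ?thesis unfolding generator_def by simp
qed

section \<open>The laws of a strong solution\<close>

text \<open>Time is rounded down to multiples of \<open>1 / real (Suc n)\<close>. The rounded
  process is jointly measurable because countably many times occur, and it converges by continuity
  of the paths.\<close>

lemma continuous_paths_measurable:
  fixes Z :: "real \<Rightarrow> 'w \<Rightarrow> 'b::metric_space"
  assumes Z: "\<And>t. Z t \<in> borel_measurable M"
    and cont: "\<And>\<omega>. \<omega> \<in> space M \<Longrightarrow> continuous_on UNIV (\<lambda>t. Z t \<omega>)"
  shows "(\<lambda>(t, \<omega>). Z t \<omega>) \<in> borel_measurable (borel \<Otimes>\<^sub>M M)"
proof (rule borel_measurable_LIMSEQ_metric)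
  let ?Z = "\<lambda>n (t, \<omega>). Z (of_int \<lfloor>real (Suc n) * t\<rfloor> / real (Suc n)) \<omega>"
  show "?Z n \<in> borel_measurable (borel \<Otimes>\<^sub>M M)" for n
  proof -
    have "(\<lambda>p. Z (of_int (\<lfloor>real (Suc n) * fst p\<rfloor>) / real (Suc n)) (snd p)) \<in> borel_measurable (borel \<Otimes>\<^sub>M M)"
    proof (rule measurable_compose_countable[where f = "\<lambda>i p. Z (of_int i / real (Suc n)) (snd p)"
          and g = "\<lambda>p. \<lfloor>real (Suc n) * fst p\<rfloor>"])
      show "(\<lambda>p. Z (of_int i / real (Suc n)) (snd p)) \<in> borel_measurable (borel \<Otimes>\<^sub>M M)" for i
        by (rule measurable_compose[OF measurable_snd Z])
      show "(\<lambda>p. \<lfloor>real (Suc n) * fst p\<rfloor>) \<in> measurable (borel \<Otimes>\<^sub>M M) (count_space UNIV)"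
        by measurable
    qed
    then show ?thesis by (simp add: case_prod_beta)
  qed
  fix p assume "p \<in> space ((borel :: real measure) \<Otimes>\<^sub>M M)"
  then obtain t \<omega> where p: "p = (t, \<omega>)" "\<omega> \<in> space M" by (auto simp: space_pair_measure)
  have "(\<lambda>n. of_int \<lfloor>real (Suc n) * t\<rfloor> / real (Suc n)) \<longlonglongrightarrow> t"
  proof (rule tendsto_sandwich)
    show "(\<lambda>n. t - 1 / real (Suc n)) \<longlonglongrightarrow> t"
      using tendsto_diff[OF tendsto_const LIMSEQ_Suc[OF lim_1_over_n], of t] by simp
    show "\<forall>\<^sub>F n in sequentially. t - 1 / real (Suc n) \<le> of_int \<lfloor>real (Suc n) * t\<rfloor> / real (Suc n)"
    proof (intro always_eventually allI)
      fix n
      have "real (Suc n) * t - 1 \<le> of_int \<lfloor>real (Suc n) * t\<rfloor>" by linarith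
      then have "(real (Suc n) * t - 1) / real (Suc n) \<le> of_int \<lfloor>real (Suc n) * t\<rfloor> / real (Suc n)"
        by (rule divide_right_mono) simp
      then show "t - 1 / real (Suc n) \<le> of_int \<lfloor>real (Suc n) * t\<rfloor> / real (Suc n)"
        by (simp add: diff_divide_distrib del: of_nat_Suc)
    qed
    show "\<forall>\<^sub>F n in sequentially. of_int \<lfloor>real (Suc n) * t\<rfloor> / real (Suc n) \<le> t"
      by (intro always_eventually allI) (simp add: field_simps)
  qed (rule tendsto_const)
  moreover have "isCont (\<lambda>t. Z t \<omega>) t"
    using cont[OF p(2)] by (simp add: continuous_on_eq_continuous_at)
  ultimately have "(\<lambda>n. Z (of_int \<lfloor>real (Suc n) * t\<rfloor> / real (Suc n)) \<omega>) \<longlonglongrightarrow> Z t \<omega>"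
    using isCont_tendsto_compose by blast
  then show "(\<lambda>n. ?Z n p) \<longlonglongrightarrow> (case p of (t, \<omega>) \<Rightarrow> Z t \<omega>)" by (simp add: p)
qed

context hilbert_wiener
begin

text \<open>A strong solution is measurable at each fixed time, while Fubini and the measurability
  of the laws in time call for joint measurability. Almost surely \<open>X - W\<close> is Lipschitz
  with constant \<open>C\<close>, so \<open>X\<close> has continuous paths off a null set.\<close>

lemma solution_modification:
  assumes X: "strong_solution M W F \<eta> X" and F: "\<And>x. norm (F x) \<le> C"
  obtains Z where "strong_solution M W F \<eta> Z" "(\<lambda>(t, \<omega>). Z t \<omega>) \<in> borel_measurable (borel \<Otimes>\<^sub>M M)"
    "AE \<omega> in M. \<forall>t\<ge>0. Z t \<omega> = X t \<omega>"
proof -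
  have C: "0 \<le> C" using F[of 0] norm_ge_zero[of "F 0"] by linarith
  have "AE \<omega> in M. continuous_on {0..} (\<lambda>t. X t \<omega>)"
    using solution_increment[OF X F] W_cont
  proof eventually_elim
    case (elim \<omega>)
    have "C-lipschitz_on {0..} (\<lambda>t. X t \<omega> - W t \<omega>)"
    proof (rule lipschitz_onI[OF _ C])
      have *: "dist (X s \<omega> - W s \<omega>) (X t \<omega> - W t \<omega>) \<le> C * dist s t" if "0 \<le> s" "s \<le> t" for s t
      proof -
        have eq: "X t \<omega> - X s \<omega> = W t \<omega> - W s \<omega> + (LINT r:{s<..t}|lborel. F (X r \<omega>))"
          and le: "norm (LINT r:{s<..t}|lborel. F (X r \<omega>)) \<le> C * (t - s)"
          using elim(1) that by auto
        from eq have "X t \<omega> - W t \<omega> - (X s \<omega> - W s \<omega>) = (LINT r:{s<..t}|lborel. F (X r \<omega>))"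
          by (simp add: algebra_simps)
        with le show ?thesis using that
          unfolding dist_norm norm_minus_commute[of "X s \<omega> - W s \<omega>"] by simp
      qed
      fix s t :: real assume "s \<in> {0..}" "t \<in> {0..}"
      then show "dist (X s \<omega> - W s \<omega>) (X t \<omega> - W t \<omega>) \<le> C * dist s t"
        using *[of s t] *[of t s] by (cases "s \<le> t") (auto simp: dist_commute)
    qed
    from continuous_on_add[OF lipschitz_on_continuous_on[OF this] elim(2)] show ?case by simp
  qed
  then obtain N where N: "N \<in> null_sets M"
    and cont: "\<And>\<omega>. \<omega> \<in> space M - N \<Longrightarrow> continuous_on {0..} (\<lambda>t. X t \<omega>)"
    by (rule AE_E3) blast
  \<comment> \<open>On the exceptional set the path is replaced by 0, and before time 0 it is
    continued by its initial value; thus every path is continuous on the whole line.\<close>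
  define Z where "Z t \<omega> = (if \<omega> \<in> N then 0 else X (max 0 t) \<omega>)" for t \<omega>
  have AE_eq: "AE \<omega> in M. \<forall>t\<ge>0. Z t \<omega> = X t \<omega>"
    using AE_not_in[OF N] by eventually_elim (simp add: Z_def)
  \<comment> \<open>The filtration contains all null sets, so the modification stays
    adapted.\<close>
  have N_filt: "N \<in> sets (generated_filtration M \<eta> W t)" for t
    unfolding generated_filtration_def using N
    by (subst sets_measure_of) (auto dest: sets.sets_into_space null_setsD2)
  have Z_filt: "Z t \<in> borel_measurable (generated_filtration M \<eta> W t)" if "0 \<le> t" for t
  proof -
    have "X t \<in> borel_measurable (generated_filtration M \<eta> W t)"
      using X that unfolding strong_solution_def by blast
    then have "(\<lambda>\<omega>. if \<omega> \<in> N then 0 else X t \<omega>) \<in> borel_measurable (generated_filtration M \<eta> W t)"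
      using N_filt[of t] sets.sets_into_space[OF null_setsD2[OF N]]
      by (intro measurable_If_set) (auto simp: Int_absorb2)
    moreover have "max 0 t = t" using that by simp
    ultimately show ?thesis unfolding Z_def by metis
  qed
  have sol: "strong_solution M W F \<eta> Z"
    unfolding strong_solution_def
  proof (intro conjI allI impI)
    show "Z t \<in> borel_measurable (generated_filtration M \<eta> W t)" if "0 \<le> t" for t
      using Z_filt that .
    have "AE \<omega> in M. \<forall>t\<ge>0. set_integrable lborel {0..t} (\<lambda>s. F (X s \<omega>)) \<and>
        X t \<omega> = \<eta> \<omega> + W t \<omega> + (LINT s:{0..t}|lborel. F (X s \<omega>))"
      using X unfolding strong_solution_def by blast
    with AE_eq show "AE \<omega> in M. \<forall>t\<ge>0. set_integrable lborel {0..t} (\<lambda>s. F (Z s \<omega>)) \<and>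
        Z t \<omega> = \<eta> \<omega> + W t \<omega> + (LINT s:{0..t}|lborel. F (Z s \<omega>))"
    proof eventually_elim
      case (elim \<omega>)
      show ?case
      proof (intro allI impI)
        fix t :: real assume t: "0 \<le> t"
        have "set_integrable lborel {0..t} (\<lambda>s. F (Z s \<omega>)) = set_integrable lborel {0..t} (\<lambda>s. F (X s \<omega>))"
          using elim(1) by (intro set_integrable_cong) auto
        moreover have "(LINT s:{0..t}|lborel. F (Z s \<omega>)) = (LINT s:{0..t}|lborel. F (X s \<omega>))"
          using elim(1) by (intro set_lebesgue_integral_cong) auto
        ultimately show "set_integrable lborel {0..t} (\<lambda>s. F (Z s \<omega>)) \<and>
            Z t \<omega> = \<eta> \<omega> + W t \<omega> + (LINT s:{0..t}|lborel. F (Z s \<omega>))"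
          using elim t by simp
      qed
    qed
  qed
  have "(\<lambda>(t, \<omega>). Z t \<omega>) \<in> borel_measurable (borel \<Otimes>\<^sub>M M)"
  proof (rule continuous_paths_measurable)
    fix t
    have "Z t = Z (max 0 t)" by (simp add: Z_def fun_eq_iff)
    then show "Z t \<in> borel_measurable M" using solution_rv[OF sol, of "max 0 t"] by simp
  next
    fix \<omega> assume \<omega>: "\<omega> \<in> space M"
    show "continuous_on UNIV (\<lambda>t. Z t \<omega>)"
    proof (cases "\<omega> \<in> N")
      case False
      with cont \<omega> have "continuous_on {0..} (\<lambda>t. X t \<omega>)" by simp
      then have "continuous_on UNIV (\<lambda>t. X (max 0 t) \<omega>)"
        by (rule continuous_on_compose2) (auto intro!: continuous_intros)
      with False show ?thesis by (simp add: Z_def)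
    qed (simp add: Z_def)
  qed
  with sol AE_eq show ?thesis using that by blast
qed

text \<open>The bounded factor is independent of the increment, which has mean 0 and variance
  \<open>q k * (t - s)\<close>. These identities play the role of the martingale property and of the
  quadratic variation.\<close>

lemma
  assumes st: "0 \<le> s" "s < t" and g: "g \<in> borel_measurable (past_and_others M \<eta> W e s t k)"
    and B: "\<And>\<omega>. \<bar>g \<omega>\<bar> \<le> B"
  shows incr_times_past: "integrable M (\<lambda>\<omega>. g \<omega> * incr W e s t k \<omega>)"
      "(\<integral>\<omega>. g \<omega> * incr W e s t k \<omega> \<partial>M) = 0"
    and incr_sq_times_past: "integrable M (\<lambda>\<omega>. g \<omega> * (incr W e s t k \<omega>)\<^sup>2)"
      "(\<integral>\<omega>. g \<omega> * (incr W e s t k \<omega>)\<^sup>2 \<partial>M) = (\<integral>\<omega>. g \<omega> \<partial>M) * (q k * (t - s))"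
proof -
  have ind: "indep_rv borel g borel (incr W e s t k)" by (rule incr_indep[OF st g])
  have int: "integrable M g"
    using indep_rv1[OF ind] B by (intro integrable_const_bound[of _ B]) auto
  note 1 = ind[unfolded indep_rv_iff_indep_var]
  have 2: "indep_var borel g borel (\<lambda>\<omega>. (incr W e s t k \<omega>)\<^sup>2)"
    unfolding indep_rv_iff_indep_var[symmetric]
    using indep_rv_compose[OF ind measurable_ident, of "\<lambda>x. x\<^sup>2" borel] by simp
  show "integrable M (\<lambda>\<omega>. g \<omega> * incr W e s t k \<omega>)" "(\<integral>\<omega>. g \<omega> * incr W e s t k \<omega> \<partial>M) = 0"
    using indep_var_integrable[OF 1 int incr_moment1(1)[OF st]]
      indep_var_lebesgue_integral[OF 1 int incr_moment1(1)[OF st]] incr_moment1(2)[OF st] by auto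
  show "integrable M (\<lambda>\<omega>. g \<omega> * (incr W e s t k \<omega>)\<^sup>2)"
    "(\<integral>\<omega>. g \<omega> * (incr W e s t k \<omega>)\<^sup>2 \<partial>M) = (\<integral>\<omega>. g \<omega> \<partial>M) * (q k * (t - s))"
    using indep_var_integrable[OF 2 int incr_moment2(1)[OF st]]
      indep_var_lebesgue_integral[OF 2 int incr_moment2(1)[OF st]] incr_moment2(2)[OF st] by auto
qed

text \<open>The integrand is bounded and supported on a set of finite product measure, so Fubini
  applies.\<close>

lemma
  fixes \<Phi> :: "real \<Rightarrow> 'w \<Rightarrow> real" and s t :: real
  assumes Phi: "(\<lambda>(r, \<omega>). \<Phi> r \<omega>) \<in> borel_measurable (borel \<Otimes>\<^sub>M M)"
    and B: "\<And>r \<omega>. \<bar>\<Phi> r \<omega>\<bar> \<le> B" and st: "s \<le> t"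
  shows bounded_process_integrable: "integrable M (\<lambda>\<omega>. LINT r:{s<..t}|lborel. \<Phi> r \<omega>)"
      "set_integrable lborel {s<..t} (\<lambda>r. \<integral>\<omega>. \<Phi> r \<omega> \<partial>M)"
    and bounded_process_Fubini:
      "(\<integral>\<omega>. (LINT r:{s<..t}|lborel. \<Phi> r \<omega>) \<partial>M) = (LINT r:{s<..t}|lborel. (\<integral>\<omega>. \<Phi> r \<omega> \<partial>M))"
proof -
  interpret P: pair_sigma_finite lborel M ..
  let ?g = "\<lambda>(r, \<omega>). indicator {s<..t} r *\<^sub>R \<Phi> r \<omega>"
  have meas: "(\<lambda>(r, \<omega>). \<Phi> r \<omega>) \<in> borel_measurable (lborel \<Otimes>\<^sub>M M)" using Phi by simp
  have int: "integrable (lborel \<Otimes>\<^sub>M M) ?g"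
  proof (rule integrableI_bounded_set)
    show "{s<..t} \<times> space M \<in> sets (lborel \<Otimes>\<^sub>M M)"
      by (intro pair_measureI) auto
    show "?g \<in> borel_measurable (lborel \<Otimes>\<^sub>M M)"
      using meas by (simp add: case_prod_beta)
    show "emeasure (lborel \<Otimes>\<^sub>M M) ({s<..t} \<times> space M) < \<infinity>"
      using st by (simp add: emeasure_pair_measure_Times emeasure_space_1)
    show "AE x\<in>{s<..t} \<times> space M in lborel \<Otimes>\<^sub>M M. norm (?g x) \<le> B"
      using B by (intro AE_I2) (auto simp: indicator_def)
    show "AE x in lborel \<Otimes>\<^sub>M M. x \<notin> {s<..t} \<times> space M \<longrightarrow> ?g x = 0"
      by (rule AE_I2) (auto simp: space_pair_measure indicator_def)
  qed
  show "integrable M (\<lambda>\<omega>. LINT r:{s<..t}|lborel. \<Phi> r \<omega>)"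
    using P.integrable_snd[OF int] unfolding set_lebesgue_integral_def by simp
  show "set_integrable lborel {s<..t} (\<lambda>r. \<integral>\<omega>. \<Phi> r \<omega> \<partial>M)"
    using P.integrable_fst[OF int] unfolding set_integrable_def by simp
  show "(\<integral>\<omega>. (LINT r:{s<..t}|lborel. \<Phi> r \<omega>) \<partial>M) = (LINT r:{s<..t}|lborel. (\<integral>\<omega>. \<Phi> r \<omega> \<partial>M))"
    using P.Fubini_integral[OF int] unfolding set_lebesgue_integral_def by simp
qed

end

lemma cylinder_measurable:
  assumes "continuous_on UNIV (g :: (nat \<Rightarrow> real) \<Rightarrow> real)" "\<And>j. (\<lambda>\<omega>. Y \<omega> j) \<in> borel_measurable N"
  shows "(\<lambda>\<omega>. g (Y \<omega>)) \<in> borel_measurable N"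
proof -
  have "Y \<in> borel_measurable N" using assms(2) by (rule measurable_coordinatewise_then_product)
  from measurable_compose[OF this borel_measurable_continuous_onI[OF assms(1)]] show ?thesis .
qed

lemma (in prob_space) expectation_abs_le:
  fixes f :: "'a \<Rightarrow> real"
  assumes "integrable M f" "AE \<omega> in M. \<bar>f \<omega>\<bar> \<le> B"
  shows "\<bar>\<integral>\<omega>. f \<omega> \<partial>M\<bar> \<le> B"
proof -
  have "\<bar>\<integral>\<omega>. f \<omega> \<partial>M\<bar> \<le> (\<integral>\<omega>. \<bar>f \<omega>\<bar> \<partial>M)" by (rule integral_abs_bound)
  also have "\<dots> \<le> B" using assms by (intro integral_le_const) auto
  finally show ?thesis .
qed

section \<open>Short-time expansion of expectations along a solution\<close>

locale bounded_solution = hilbert_wiener M e q W \<beta> \<eta>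
  for M :: "'w measure" and e :: "nat \<Rightarrow> 'a::{real_inner, banach, second_countable_topology}"
    and q W \<beta> \<eta> +
  fixes F :: "'a \<Rightarrow> 'a" and C :: real and X :: "real \<Rightarrow> 'w \<Rightarrow> 'a"
  assumes F_borel [measurable]: "F \<in> borel_measurable borel" and F_bound: "\<And>x. norm (F x) \<le> C"
    and solution: "strong_solution M W F \<eta> X"
    and X_joint: "(\<lambda>(t, \<omega>). X t \<omega>) \<in> borel_measurable (borel \<Otimes>\<^sub>M M)"
begin

lemma C_nonneg: "0 \<le> C"
  using F_bound[of 0] norm_ge_zero[of "F 0"] by linarith

lemma F_coord_bound: "\<bar>inner (F x) (e k)\<bar> \<le> C"
  using Cauchy_Schwarz_ineq2[of "F x" "e k"] F_bound[of x] e_inner[of k k] by (simp add: norm_eq_sqrt_inner)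

lemma coords_rv: "0 \<le> t \<Longrightarrow> (\<lambda>\<omega>. coords e (X t \<omega>) j) \<in> borel_measurable M"
  using solution_rv[OF solution, of t] unfolding coords_def by simp

lemma coords_past:
  assumes "0 \<le> s" "s \<le> t"
  shows "(\<lambda>\<omega>. coords e (X s \<omega>) j) \<in> borel_measurable (past_and_others M \<eta> W e s t k)"
proof -
  have "X s \<in> borel_measurable (generated_filtration M \<eta> W s)"
    using solution assms unfolding strong_solution_def by blast
  from measurable_past[OF this assms] show ?thesis unfolding coords_def by simp
qed

definition drift :: "real \<Rightarrow> real \<Rightarrow> nat \<Rightarrow> 'w \<Rightarrow> real" where
  "drift s t k \<omega> = (LINT r:{s<..t}|lborel. inner (F (X r \<omega>)) (e k))"

lemma coords_increment:
  "AE \<omega> in M. \<forall>s t k. 0 \<le> s \<and> s \<le> t \<longrightarrow>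
    set_integrable lborel {s<..t} (\<lambda>r. inner (F (X r \<omega>)) (e k)) \<and>
    coords e (X t \<omega>) k = coords e (X s \<omega>) k + incr W e s t k \<omega> + drift s t k \<omega> \<and>
    \<bar>drift s t k \<omega>\<bar> \<le> C * (t - s)"
  using solution_increment[OF solution F_bound]
proof eventually_elim
  case (elim \<omega>)
  show ?case
  proof (intro allI impI)
    fix s t :: real and k assume st: "0 \<le> s \<and> s \<le> t"
    let ?I = "LINT r:{s<..t}|lborel. F (X r \<omega>)"
    have I: "set_integrable lborel {s<..t} (\<lambda>r. F (X r \<omega>))"
      "X t \<omega> - X s \<omega> = W t \<omega> - W s \<omega> + ?I" "norm ?I \<le> C * (t - s)"
      using elim st by auto
    have int: "set_integrable lborel {s<..t} (\<lambda>r. inner (F (X r \<omega>)) (e k))"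
      using integrable_inner_left[of "e k" lborel "\<lambda>r. indicator {s<..t} r *\<^sub>R F (X r \<omega>)"] I(1)
      unfolding set_integrable_def by simp
    have "drift s t k \<omega> = inner ?I (e k)"
      using integral_inner_left[of "e k" lborel "\<lambda>r. indicator {s<..t} r *\<^sub>R F (X r \<omega>)"] I(1)
      unfolding drift_def set_integrable_def set_lebesgue_integral_def by simp
    moreover have "\<bar>inner ?I (e k)\<bar> \<le> norm ?I"
      using Cauchy_Schwarz_ineq2[of ?I "e k"] e_inner[of k k] by (simp add: norm_eq_sqrt_inner)
    moreover have "inner (X t \<omega> - X s \<omega>) (e k) = inner (W t \<omega> - W s \<omega>) (e k) + inner ?I (e k)"
      unfolding I(2) by (rule inner_add_left)
    ultimately show "set_integrable lborel {s<..t} (\<lambda>r. inner (F (X r \<omega>)) (e k)) \<and>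
        coords e (X t \<omega>) k = coords e (X s \<omega>) k + incr W e s t k \<omega> + drift s t k \<omega> \<and>
        \<bar>drift s t k \<omega>\<bar> \<le> C * (t - s)"
      using int I(3) by (simp add: coords_def incr_def inner_diff_left)
  qed
qed

text \<open>In mean the Gaussian part contributes at most \<open>sqrt (r - s)\<close> and the drift
  at most \<open>C * (r - s)\<close>; on steps of length at most 1 the latter is dominated by
  \<open>C * sqrt (r - s)\<close>.\<close>

lemma
  assumes "0 \<le> s" "s < t" "t \<le> s + 1" "s \<le> r" "r \<le> t"
  shows coord_dev_integrable: "integrable M (\<lambda>\<omega>. \<bar>coords e (X r \<omega>) j - coords e (X s \<omega>) j\<bar>)"
    and coord_dev_le: "(\<integral>\<omega>. \<bar>coords e (X r \<omega>) j - coords e (X s \<omega>) j\<bar> \<partial>M) \<le> (1 + C) * sqrt (t - s)"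
proof -
  let ?d = "\<lambda>\<omega>. \<bar>coords e (X r \<omega>) j - coords e (X s \<omega>) j\<bar>"
  have "integrable M ?d \<and> (\<integral>\<omega>. ?d \<omega> \<partial>M) \<le> (1 + C) * sqrt (t - s)"
  proof (cases "r = s")
    case True
    then show ?thesis using assms C_nonneg by simp
  next
    case False
    with assms have sr: "0 \<le> s" "s < r" by auto
    let ?b = "\<lambda>\<omega>. \<bar>incr W e s r j \<omega>\<bar> + C * (r - s)"
    have b: "integrable M ?b" using incr_moment1(1)[OF sr] by simp
    have [measurable]: "?d \<in> borel_measurable M" using coords_rv[of r j] coords_rv[of s j] sr by simp
    have le: "AE \<omega> in M. ?d \<omega> \<le> ?b \<omega>"
      using coords_increment
    proof eventually_elim
      case (elim \<omega>)
      from elim[rule_format, of s r j] sr show ?case by auto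
    qed
    have int: "integrable M ?d"
      by (rule Bochner_Integration.integrable_bound[OF b]) (use le in \<open>auto elim!: eventually_mono\<close>)
    have "(\<integral>\<omega>. ?d \<omega> \<partial>M) \<le> (\<integral>\<omega>. ?b \<omega> \<partial>M)" by (rule integral_mono_AE[OF int b le])
    also have "\<dots> = (\<integral>\<omega>. \<bar>incr W e s r j \<omega>\<bar> \<partial>M) + C * (r - s)"
      using incr_moment1(1)[OF sr] by (simp add: prob_space)
    also have "\<dots> \<le> sqrt (t - s) + C * sqrt (t - s)"
    proof (intro add_mono mult_left_mono C_nonneg)
      show "(\<integral>\<omega>. \<bar>incr W e s r j \<omega>\<bar> \<partial>M) \<le> sqrt (t - s)"
        using incr_abs_moment1[OF sr, of j] assms real_sqrt_le_mono[of "r - s" "t - s"] by linarith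
      have "(r - s) * (r - s) \<le> (r - s) * 1" using assms by (intro mult_left_mono) auto
      then have "r - s \<le> sqrt (r - s)" by (intro real_le_rsqrt) (simp add: power2_eq_square)
      then show "r - s \<le> sqrt (t - s)" using assms real_sqrt_le_mono[of "r - s" "t - s"] by linarith
    qed
    finally show ?thesis using int by (simp add: algebra_simps)
  qed
  then show "integrable M ?d" "(\<integral>\<omega>. ?d \<omega> \<partial>M) \<le> (1 + C) * sqrt (t - s)" by auto
qed

lemma smooth_integrable:
  assumes g: "smooth_compact_support m g" and Y: "\<And>j. (\<lambda>\<omega>. Y \<omega> j) \<in> borel_measurable M"
  shows "integrable M (\<lambda>\<omega>. g (Y \<omega>))"
proof -
  obtain B where "\<And>x. \<bar>g x\<bar> \<le> B" using smooth_bounded[OF g] by blast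
  then show ?thesis
    using cylinder_measurable[OF smooth_continuous[OF g] Y]
    by (intro integrable_const_bound[of _ B]) auto
qed

text \<open>The constant is uniform in the times and in \<open>Y\<close>. The condition on
  \<open>Y\<close> admits every point reached from the solution at time \<open>s\<close> by adding
  the increment in some of the coordinates, hence both \<open>noisy\<close> and
  \<open>noise_mixed\<close> below.\<close>

definition deviation_bound :: "((nat \<Rightarrow> real) \<Rightarrow> real) \<Rightarrow> real \<Rightarrow> bool" where
  "deviation_bound g A \<longleftrightarrow> 0 \<le> A \<and> (\<forall>s t r Y. 0 \<le> s \<longrightarrow> s < t \<longrightarrow> t \<le> s + 1 \<longrightarrow> s \<le> r \<longrightarrow> r \<le> t \<longrightarrow>
      (\<forall>j. (\<lambda>\<omega>. Y \<omega> j) \<in> borel_measurable M) \<longrightarrow>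
      (\<forall>j \<omega>. \<bar>Y \<omega> j - coords e (X s \<omega>) j\<bar> \<le> \<bar>incr W e s t j \<omega>\<bar>) \<longrightarrow>
      (\<integral>\<omega>. \<bar>g (Y \<omega>) - g (coords e (X r \<omega>))\<bar> \<partial>M) \<le> A * sqrt (t - s))"

lemma deviation_boundD:
  assumes "deviation_bound g A" "0 \<le> s" "s < t" "t \<le> s + 1" "s \<le> r" "r \<le> t"
    and "\<And>j. (\<lambda>\<omega>. Y \<omega> j) \<in> borel_measurable M"
    and "\<And>j \<omega>. \<bar>Y \<omega> j - coords e (X s \<omega>) j\<bar> \<le> \<bar>incr W e s t j \<omega>\<bar>"
  shows "(\<integral>\<omega>. \<bar>g (Y \<omega>) - g (coords e (X r \<omega>))\<bar> \<partial>M) \<le> A * sqrt (t - s)"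
  using assms unfolding deviation_bound_def by blast

lemma smooth_deviation:
  assumes g: "smooth_compact_support m g"
  shows "\<exists>A. deviation_bound g A"
proof -
  obtain L where L: "0 \<le> L" "\<And>x y. \<bar>g x - g y\<bar> \<le> L * (\<Sum>i<m. \<bar>x i - y i\<bar>)"
    using smooth_lipschitz[OF g] by blast
  \<comment> \<open>For each coordinate, 1 comes from the increment and \<open>1 + C\<close> from
    the motion of the solution between \<open>s\<close> and \<open>r\<close>.\<close>
  define A where "A = L * (\<Sum>i<m. 2 + C)"
  have "(\<integral>\<omega>. \<bar>g (Y \<omega>) - g (coords e (X r \<omega>))\<bar> \<partial>M) \<le> A * sqrt (t - s)"
    if st: "0 \<le> s" "s < t" "t \<le> s + 1" "s \<le> r" "r \<le> t"
      and Y: "\<And>j. (\<lambda>\<omega>. Y \<omega> j) \<in> borel_measurable M"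
      and Ydev: "\<And>j \<omega>. \<bar>Y \<omega> j - coords e (X s \<omega>) j\<bar> \<le> \<bar>incr W e s t j \<omega>\<bar>" for s t r Y
  proof -
    let ?d = "\<lambda>j \<omega>. \<bar>coords e (X r \<omega>) j - coords e (X s \<omega>) j\<bar>"
    let ?b = "\<lambda>\<omega>. L * (\<Sum>j<m. \<bar>incr W e s t j \<omega>\<bar> + ?d j \<omega>)"
    have ints: "integrable M (\<lambda>\<omega>. \<bar>incr W e s t j \<omega>\<bar>)" "integrable M (?d j)" for j
      using incr_moment1(1)[OF st(1,2)] coord_dev_integrable[OF st] by auto
    have "integrable M (\<lambda>\<omega>. g (Y \<omega>) - g (coords e (X r \<omega>)))"
      using smooth_integrable[OF g, of Y] smooth_integrable[OF g, of "\<lambda>\<omega>. coords e (X r \<omega>)"]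
        Y coords_rv[of r] st by auto
    then have "(\<integral>\<omega>. \<bar>g (Y \<omega>) - g (coords e (X r \<omega>))\<bar> \<partial>M) \<le> (\<integral>\<omega>. ?b \<omega> \<partial>M)"
    proof (intro integral_mono)
      show "integrable M ?b" using ints by (intro integrable_mult_right Bochner_Integration.integrable_sum Bochner_Integration.integrable_add) auto
      fix \<omega>
      have "\<bar>g (Y \<omega>) - g (coords e (X r \<omega>))\<bar> \<le> L * (\<Sum>i<m. \<bar>Y \<omega> i - coords e (X r \<omega>) i\<bar>)" by (rule L(2))
      also have "\<dots> \<le> ?b \<omega>"
      proof (intro mult_left_mono sum_mono L(1))
        fix j
        show "\<bar>Y \<omega> j - coords e (X r \<omega>) j\<bar> \<le> \<bar>incr W e s t j \<omega>\<bar> + ?d j \<omega>"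
          using Ydev[of \<omega> j] by linarith
      qed
      finally show "\<bar>g (Y \<omega>) - g (coords e (X r \<omega>))\<bar> \<le> ?b \<omega>" .
    qed auto
    also have "\<dots> = L * (\<Sum>j<m. (\<integral>\<omega>. \<bar>incr W e s t j \<omega>\<bar> \<partial>M) + (\<integral>\<omega>. ?d j \<omega> \<partial>M))"
      using ints by (simp add: Bochner_Integration.integral_sum Bochner_Integration.integral_add Bochner_Integration.integrable_add)
    also have "\<dots> \<le> L * (\<Sum>j<m. sqrt (t - s) + (1 + C) * sqrt (t - s))"
      using incr_abs_moment1[OF st(1,2)] coord_dev_le[OF st] by (intro mult_left_mono sum_mono add_mono L(1)) auto
    also have "\<dots> = A * sqrt (t - s)" by (simp add: A_def algebra_simps)
    finally show ?thesis .
  qed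
  moreover have "0 \<le> A" unfolding A_def using L(1) C_nonneg by simp
  ultimately show ?thesis unfolding deviation_bound_def by blast
qed

text \<open>The intermediate point of a time step: the Gaussian increment has been added, the drift
  not yet.\<close>

definition noisy :: "real \<Rightarrow> real \<Rightarrow> 'w \<Rightarrow> nat \<Rightarrow> real" where
  "noisy s t \<omega> = (\<lambda>j. coords e (X s \<omega>) j + incr W e s t j \<omega>)"

abbreviation noise_mixed :: "real \<Rightarrow> real \<Rightarrow> nat \<Rightarrow> 'w \<Rightarrow> nat \<Rightarrow> real" where
  "noise_mixed s t k \<omega> \<equiv> mixed k (coords e (X s \<omega>)) (\<lambda>j. incr W e s t j \<omega>)"

text \<open>When coordinate \<open>k\<close> is moved, the linear term has mean 0, the quadratic one
  produces \<open>1/2 * q k * (t - s)\<close> times a mean second derivative, and the third absolute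
  moment bounds the remainder. The second derivatives stay at the points \<open>noise_mixed\<close>,
  where independence is available; \<open>density_deviation\<close> moves them to the
  solution.\<close>

lemma noise_step:
  assumes f: "smooth_compact_support m f"
  obtains A where "0 \<le> A" "\<And>s t. 0 \<le> s \<Longrightarrow> s < t \<Longrightarrow>
      \<bar>(\<integral>\<omega>. f (noisy s t \<omega>) \<partial>M) - (\<integral>\<omega>. f (coords e (X s \<omega>)) \<partial>M) -
        (t - s) * (\<Sum>k<m. 1/2 * q k * (\<integral>\<omega>. coord_deriv k (coord_deriv k f) (noise_mixed s t k \<omega>) \<partial>M))\<bar>
      \<le> A * sqrt (t - s) ^ 3"
proof -
  have "\<forall>k\<in>{..<m}. \<exists>K\<ge>0. \<forall>x d. \<bar>f (x(k := x k + d)) - f x - coord_deriv k f x * d -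
      1/2 * coord_deriv k (coord_deriv k f) x * d\<^sup>2\<bar> \<le> K * \<bar>d\<bar> ^ 3"
    using smooth_second_order[OF f] by (metis lessThan_iff)
  then obtain K where K: "\<And>k. k < m \<Longrightarrow> 0 \<le> K k" "\<And>k x d. k < m \<Longrightarrow>
      \<bar>f (x(k := x k + d)) - f x - coord_deriv k f x * d -
      1/2 * coord_deriv k (coord_deriv k f) x * d\<^sup>2\<bar> \<le> K k * \<bar>d\<bar> ^ 3"
    by (metis lessThan_iff)
  define A where "A = (\<Sum>k<m. K k * 2)"
  have "\<bar>(\<integral>\<omega>. f (noisy s t \<omega>) \<partial>M) - (\<integral>\<omega>. f (coords e (X s \<omega>)) \<partial>M) -
        (t - s) * (\<Sum>k<m. 1/2 * q k * (\<integral>\<omega>. coord_deriv k (coord_deriv k f) (noise_mixed s t k \<omega>) \<partial>M))\<bar>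
      \<le> A * sqrt (t - s) ^ 3" if st: "0 \<le> s" "s < t" for s t
  proof -
    have mixed_rv: "(\<lambda>\<omega>. noise_mixed s t k \<omega> j) \<in> borel_measurable M" for k j
      unfolding mixed_def using coords_rv[of s j] incr_rv[of s t j] st by auto
    have int: "integrable M (\<lambda>\<omega>. f (noise_mixed s t k \<omega>))" for k
      by (rule smooth_integrable[OF f], rule mixed_rv)
    have step: "\<bar>(\<integral>\<omega>. f (noise_mixed s t (Suc k) \<omega>) \<partial>M) - (\<integral>\<omega>. f (noise_mixed s t k \<omega>) \<partial>M) -
        (t - s) * (1/2 * q k * (\<integral>\<omega>. coord_deriv k (coord_deriv k f) (noise_mixed s t k \<omega>) \<partial>M))\<bar>
        \<le> K k * 2 * sqrt (t - s) ^ 3" if k: "k < m" for k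
    proof -
      let ?f1 = "\<lambda>\<omega>. coord_deriv k f (noise_mixed s t k \<omega>)"
      let ?f2 = "\<lambda>\<omega>. coord_deriv k (coord_deriv k f) (noise_mixed s t k \<omega>)"
      let ?D = "incr W e s t k"
      note f1 = smooth_coord_deriv[OF f k] and f2 = smooth_coord_deriv[OF smooth_coord_deriv[OF f k] k]
      \<comment> \<open>In \<open>noise_mixed s t k\<close> only coordinates below \<open>k\<close>
        have received their increments, so the increment of coordinate \<open>k\<close> does not
        occur.\<close>
      have past: "(\<lambda>\<omega>. noise_mixed s t k \<omega> j) \<in> borel_measurable (past_and_others M \<eta> W e s t k)" for j
        unfolding mixed_def using coords_past[of s t j k] measurable_others[of j k s t] st
        by (cases "j < k") auto
      obtain B1 B2 where B: "\<And>x. \<bar>coord_deriv k f x\<bar> \<le> B1" "\<And>x. \<bar>coord_deriv k (coord_deriv k f) x\<bar> \<le> B2"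
        using smooth_bounded[OF f1] smooth_bounded[OF f2] by metis
      have "?f1 \<in> borel_measurable (past_and_others M \<eta> W e s t k)"
        "?f2 \<in> borel_measurable (past_and_others M \<eta> W e s t k)"
        by (rule cylinder_measurable[OF smooth_continuous], rule f1, rule past)
          (rule cylinder_measurable[OF smooth_continuous], rule f2, rule past)
      note p1 = incr_times_past[OF st this(1) B(1)] and p2 = incr_sq_times_past[OF st this(2) B(2)]
      let ?R = "\<lambda>\<omega>. f (noise_mixed s t (Suc k) \<omega>) - f (noise_mixed s t k \<omega>) - ?f1 \<omega> * ?D \<omega> -
          1/2 * (?f2 \<omega> * (?D \<omega>)\<^sup>2)"
      have intR: "integrable M ?R" using int p1(1) p2(1) by (intro Bochner_Integration.integrable_diff integrable_mult_right) auto
      have "(\<integral>\<omega>. ?R \<omega> \<partial>M) = (\<integral>\<omega>. f (noise_mixed s t (Suc k) \<omega>) \<partial>M) - (\<integral>\<omega>. f (noise_mixed s t k \<omega>) \<partial>M) -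
          (\<integral>\<omega>. ?f1 \<omega> * ?D \<omega> \<partial>M) - 1/2 * (\<integral>\<omega>. ?f2 \<omega> * (?D \<omega>)\<^sup>2 \<partial>M)"
        using int p1(1) p2(1) by (simp add: Bochner_Integration.integral_diff)
      then have "(\<integral>\<omega>. f (noise_mixed s t (Suc k) \<omega>) \<partial>M) - (\<integral>\<omega>. f (noise_mixed s t k \<omega>) \<partial>M) -
          (t - s) * (1/2 * q k * (\<integral>\<omega>. ?f2 \<omega> \<partial>M)) = (\<integral>\<omega>. ?R \<omega> \<partial>M)"
        unfolding p1(2) p2(2) by simp
      note arg_cong[OF this, where f = abs]
      also have "\<bar>\<dots>\<bar> \<le> (\<integral>\<omega>. \<bar>?R \<omega>\<bar> \<partial>M)" by (rule integral_abs_bound)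
      also have "\<dots> \<le> (\<integral>\<omega>. K k * \<bar>?D \<omega>\<bar> ^ 3 \<partial>M)"
      proof (rule integral_mono)
        show "integrable M (\<lambda>\<omega>. \<bar>?R \<omega>\<bar>)" using intR by (rule integrable_abs)
        show "integrable M (\<lambda>\<omega>. K k * \<bar>?D \<omega>\<bar> ^ 3)" using incr_abs_moment3(1)[OF st] by simp
        show "\<bar>?R \<omega>\<bar> \<le> K k * \<bar>?D \<omega>\<bar> ^ 3" for \<omega>
          using K(2)[OF k, of "noise_mixed s t k \<omega>" "?D \<omega>"] unfolding mixed_Suc by (simp add: mult.assoc)
      qed
      also have "\<dots> = K k * (\<integral>\<omega>. \<bar>?D \<omega>\<bar> ^ 3 \<partial>M)" by simp
      also have "\<dots> \<le> K k * (2 * sqrt (t - s) ^ 3)"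
        using incr_abs_moment3(2)[OF st] K(1)[OF k] by (intro mult_left_mono) auto
      finally show ?thesis by simp
    qed
    have "(\<integral>\<omega>. f (noisy s t \<omega>) \<partial>M) - (\<integral>\<omega>. f (coords e (X s \<omega>)) \<partial>M) =
        (\<integral>\<omega>. f (noisy s t \<omega>) - f (coords e (X s \<omega>)) \<partial>M)"
      using smooth_integrable[OF f, of "noisy s t"] smooth_integrable[OF f, of "\<lambda>\<omega>. coords e (X s \<omega>)"]
        coords_rv[of s] incr_rv[of s t] st by (simp add: noisy_def)
    also have "\<dots> = (\<integral>\<omega>. (\<Sum>k<m. f (noise_mixed s t (Suc k) \<omega>) - f (noise_mixed s t k \<omega>)) \<partial>M)"
      unfolding noisy_def mixed_telescope[OF f] ..
    also have "\<dots> = (\<Sum>k<m. (\<integral>\<omega>. f (noise_mixed s t (Suc k) \<omega>) \<partial>M) - (\<integral>\<omega>. f (noise_mixed s t k \<omega>) \<partial>M))"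
      using int by (simp add: Bochner_Integration.integral_sum Bochner_Integration.integral_diff)
    finally have "\<bar>(\<integral>\<omega>. f (noisy s t \<omega>) \<partial>M) - (\<integral>\<omega>. f (coords e (X s \<omega>)) \<partial>M) -
        (t - s) * (\<Sum>k<m. 1/2 * q k * (\<integral>\<omega>. coord_deriv k (coord_deriv k f) (noise_mixed s t k \<omega>) \<partial>M))\<bar> =
      \<bar>\<Sum>k<m. (\<integral>\<omega>. f (noise_mixed s t (Suc k) \<omega>) \<partial>M) - (\<integral>\<omega>. f (noise_mixed s t k \<omega>) \<partial>M) -
        (t - s) * (1/2 * q k * (\<integral>\<omega>. coord_deriv k (coord_deriv k f) (noise_mixed s t k \<omega>) \<partial>M))\<bar>"
      by (simp add: sum_subtractf sum_distrib_left)
    also have "\<dots> \<le> (\<Sum>k<m. K k * 2 * sqrt (t - s) ^ 3)"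
      using step by (intro order.trans[OF sum_abs] sum_mono) simp
    also have "\<dots> = A * sqrt (t - s) ^ 3" by (simp add: A_def sum_distrib_right)
    finally show ?thesis .
  qed
  moreover have "0 \<le> A" unfolding A_def using K(1) by (intro sum_nonneg) auto
  ultimately show ?thesis using that by blast
qed

text \<open>The point \<open>Y\<close> of the derivatives and the time \<open>r\<close> of the drift
  are separate parameters: during a step the derivatives stay at the intermediate point while
  \<open>F\<close> follows the solution. With the solution at time \<open>r\<close> for
  \<open>Y\<close> this is the first-order part of the generator.\<close>

definition drift_density :: "((nat \<Rightarrow> real) \<Rightarrow> real) \<Rightarrow> nat \<Rightarrow> ('w \<Rightarrow> nat \<Rightarrow> real) \<Rightarrow> real \<Rightarrow> 'w \<Rightarrow> real" where
  "drift_density f m Y r \<omega> = (\<Sum>k<m. coord_deriv k f (Y \<omega>) * inner (F (X r \<omega>)) (e k))"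

lemma F_joint: "(\<lambda>(r, \<omega>). inner (F (X r \<omega>)) (e k)) \<in> borel_measurable (borel \<Otimes>\<^sub>M M)"
  using measurable_compose[OF X_joint F_borel] by (simp add: case_prod_beta)

lemma
  assumes f: "smooth_compact_support m f"
    and Y: "\<And>j. (\<lambda>(r, \<omega>). Y r \<omega> j) \<in> borel_measurable (borel \<Otimes>\<^sub>M M)"
  shows drift_density_joint:
      "(\<lambda>(r, \<omega>). drift_density f m (Y r) r \<omega>) \<in> borel_measurable (borel \<Otimes>\<^sub>M M)"
    and drift_density_bounded: "\<exists>B. \<forall>r \<omega>. \<bar>drift_density f m (Y r) r \<omega>\<bar> \<le> B"
proof -
  have "(\<lambda>p. coord_deriv k f (case p of (r, \<omega>) \<Rightarrow> Y r \<omega>)) \<in> borel_measurable (borel \<Otimes>\<^sub>M M)" if "k < m" for k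
    using Y by (intro cylinder_measurable[OF smooth_continuous[OF smooth_coord_deriv[OF f that]]])
      (simp add: case_prod_beta)
  then show "(\<lambda>(r, \<omega>). drift_density f m (Y r) r \<omega>) \<in> borel_measurable (borel \<Otimes>\<^sub>M M)"
    using F_joint unfolding drift_density_def case_prod_beta
    by (intro borel_measurable_sum borel_measurable_times) auto
  have "\<forall>i\<in>{..<m}. \<exists>K. \<forall>x. \<bar>coord_deriv i f x\<bar> \<le> K"
    using smooth_bounded[OF smooth_coord_deriv[OF f]] by (metis lessThan_iff)
  then obtain K where K: "\<And>i x. i < m \<Longrightarrow> \<bar>coord_deriv i f x\<bar> \<le> K i" by (metis lessThan_iff)
  have "\<bar>drift_density f m (Y r) r \<omega>\<bar> \<le> (\<Sum>k<m. K k * C)" for r \<omega>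
    unfolding drift_density_def
  proof (intro order.trans[OF sum_abs] sum_mono)
    fix k assume "k \<in> {..<m}"
    then have "\<bar>coord_deriv k f (Y r \<omega>)\<bar> \<le> K k" using K by auto
    moreover from this have "0 \<le> K k" using abs_ge_zero order.trans by blast
    ultimately show "\<bar>coord_deriv k f (Y r \<omega>) * inner (F (X r \<omega>)) (e k)\<bar> \<le> K k * C"
      unfolding abs_mult using F_coord_bound by (intro mult_mono) auto
  qed
  then show "\<exists>B. \<forall>r \<omega>. \<bar>drift_density f m (Y r) r \<omega>\<bar> \<le> B" by blast
qed

lemma noisy_rv: "0 \<le> s \<Longrightarrow> s \<le> t \<Longrightarrow> (\<lambda>\<omega>. noisy s t \<omega> j) \<in> borel_measurable M"
  unfolding noisy_def using coords_rv[of s j] incr_rv[of s t j] by simp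

text \<open>From \<open>noisy s t\<close> to the solution at time \<open>t\<close> the displacement
  is the drift, almost surely at most \<open>C * (t - s)\<close> in each coordinate, and the
  first-order expansion leaves its square. The estimate is pathwise, so the dependence of the drift
  on the noise does no harm.\<close>

lemma drift_step:
  assumes f: "smooth_compact_support m f"
  obtains A where "0 \<le> A" "\<And>s t. 0 \<le> s \<Longrightarrow> s < t \<Longrightarrow>
      \<bar>(\<integral>\<omega>. f (coords e (X t \<omega>)) \<partial>M) - (\<integral>\<omega>. f (noisy s t \<omega>) \<partial>M) -
        (LINT r:{s<..t}|lborel. (\<integral>\<omega>. drift_density f m (noisy s t) r \<omega> \<partial>M))\<bar> \<le> A * (t - s)\<^sup>2"
proof -
  obtain L where L: "0 \<le> L"
    "\<And>x d. \<bar>f (\<lambda>j. x j + d j) - f x - (\<Sum>k<m. coord_deriv k f x * d k)\<bar> \<le> L * (\<Sum>i<m. \<bar>d i\<bar>)\<^sup>2"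
    using smooth_first_order[OF f] by blast
  define A where "A = L * (real m * C)\<^sup>2"
  have "\<bar>(\<integral>\<omega>. f (coords e (X t \<omega>)) \<partial>M) - (\<integral>\<omega>. f (noisy s t \<omega>) \<partial>M) -
        (LINT r:{s<..t}|lborel. (\<integral>\<omega>. drift_density f m (noisy s t) r \<omega> \<partial>M))\<bar> \<le> A * (t - s)\<^sup>2"
    if st: "0 \<le> s" "s < t" for s t
  proof -
    let ?P = "\<lambda>\<omega>. LINT r:{s<..t}|lborel. drift_density f m (noisy s t) r \<omega>"
    have joint: "(\<lambda>(r :: real, \<omega>). noisy s t \<omega> j) \<in> borel_measurable (borel \<Otimes>\<^sub>M M)" for j
      unfolding case_prod_beta by (rule measurable_compose[OF measurable_snd noisy_rv]) (use st in auto)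
    obtain B where B: "\<And>r \<omega>. \<bar>drift_density f m (noisy s t) r \<omega>\<bar> \<le> B"
      using drift_density_bounded[OF f, of "\<lambda>_. noisy s t", OF joint] by blast
    have st': "s \<le> t" using st by simp
    note P = bounded_process_integrable(1)[OF drift_density_joint[OF f, of "\<lambda>_. noisy s t", OF joint] B st']
    note Fub = bounded_process_Fubini[OF drift_density_joint[OF f, of "\<lambda>_. noisy s t", OF joint] B st']
    have int: "integrable M (\<lambda>\<omega>. f (coords e (X t \<omega>)))" "integrable M (\<lambda>\<omega>. f (noisy s t \<omega>))"
      using smooth_integrable[OF f, of "\<lambda>\<omega>. coords e (X t \<omega>)"] smooth_integrable[OF f, of "noisy s t"]
        coords_rv[of t] noisy_rv[of s t] st by auto
    have "(\<integral>\<omega>. f (coords e (X t \<omega>)) \<partial>M) - (\<integral>\<omega>. f (noisy s t \<omega>) \<partial>M) -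
        (LINT r:{s<..t}|lborel. (\<integral>\<omega>. drift_density f m (noisy s t) r \<omega> \<partial>M)) =
        (\<integral>\<omega>. f (coords e (X t \<omega>)) - f (noisy s t \<omega>) - ?P \<omega> \<partial>M)"
      unfolding Fub[symmetric] using int P by (simp add: Bochner_Integration.integral_diff)
    note arg_cong[OF this, where f = abs]
    also have "\<bar>\<dots>\<bar> \<le> A * (t - s)\<^sup>2"
    proof (rule expectation_abs_le)
      show "integrable M (\<lambda>\<omega>. f (coords e (X t \<omega>)) - f (noisy s t \<omega>) - ?P \<omega>)"
        using int P by (intro Bochner_Integration.integrable_diff)
      show "AE \<omega> in M. \<bar>f (coords e (X t \<omega>)) - f (noisy s t \<omega>) - ?P \<omega>\<bar> \<le> A * (t - s)\<^sup>2"
        using coords_increment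
      proof eventually_elim
        case (elim \<omega>)
        have *: "set_integrable lborel {s<..t} (\<lambda>r. inner (F (X r \<omega>)) (e k))"
          "coords e (X t \<omega>) k = noisy s t \<omega> k + drift s t k \<omega>"
          "\<bar>drift s t k \<omega>\<bar> \<le> C * (t - s)" for k
          using elim st unfolding noisy_def by auto
        \<comment> \<open>The derivatives at the intermediate point are constant in
          \<open>r\<close>, so integrating the density over the step yields derivative times total
          drift.\<close>
        have "?P \<omega> = (\<Sum>k<m. coord_deriv k f (noisy s t \<omega>) * drift s t k \<omega>)"
          using *(1) unfolding drift_density_def drift_def set_lebesgue_integral_def set_integrable_def
          by (simp add: sum_distrib_left Bochner_Integration.integral_sum mult.left_commute[of "indicator _ _"])
        moreover have "coords e (X t \<omega>) = (\<lambda>j. noisy s t \<omega> j + drift s t j \<omega>)"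
          using *(2) by (simp add: fun_eq_iff)
        ultimately have "\<bar>f (coords e (X t \<omega>)) - f (noisy s t \<omega>) - ?P \<omega>\<bar> \<le> L * (\<Sum>i<m. \<bar>drift s t i \<omega>\<bar>)\<^sup>2"
          using L(2)[of "noisy s t \<omega>" "\<lambda>k. drift s t k \<omega>"] by simp
        also have "\<dots> \<le> L * (\<Sum>i<m. C * (t - s))\<^sup>2"
          using *(3) by (intro mult_left_mono power_mono sum_mono sum_nonneg L(1)) auto
        also have "\<dots> = A * (t - s)\<^sup>2" by (simp add: A_def power_mult_distrib)
        finally show "\<bar>f (coords e (X t \<omega>)) - f (noisy s t \<omega>) - ?P \<omega>\<bar> \<le> A * (t - s)\<^sup>2" .
      qed
    qed
    finally show ?thesis .
  qed
  moreover have "0 \<le> A" unfolding A_def using L(1) by simp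
  ultimately show ?thesis using that by blast
qed

text \<open>The generator of the cylindrical function given by \<open>f\<close>, evaluated along the
  solution and written with finite sums.\<close>

definition gen :: "((nat \<Rightarrow> real) \<Rightarrow> real) \<Rightarrow> nat \<Rightarrow> real \<Rightarrow> 'w \<Rightarrow> real" where
  "gen f m r \<omega> = (\<Sum>k<m. 1/2 * q k * coord_deriv k (coord_deriv k f) (coords e (X r \<omega>))) +
    drift_density f m (\<lambda>\<omega>. coords e (X r \<omega>)) r \<omega>"

lemma coords_joint: "(\<lambda>(r, \<omega>). coords e (X r \<omega>) j) \<in> borel_measurable (borel \<Otimes>\<^sub>M M)"
  using measurable_compose[OF X_joint, of "\<lambda>x. coords e x j" borel]
  by (simp add: case_prod_beta coords_def)

lemma
  assumes f: "smooth_compact_support m f"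
  shows gen_joint: "(\<lambda>(r, \<omega>). gen f m r \<omega>) \<in> borel_measurable (borel \<Otimes>\<^sub>M M)"
    and gen_bounded: "\<exists>B. \<forall>r \<omega>. \<bar>gen f m r \<omega>\<bar> \<le> B"
proof -
  have "(\<lambda>p. coord_deriv k (coord_deriv k f) (case p of (r, \<omega>) \<Rightarrow> coords e (X r \<omega>))) \<in> borel_measurable (borel \<Otimes>\<^sub>M M)"
    if "k < m" for k
    using coords_joint
    by (intro cylinder_measurable[OF smooth_continuous[OF smooth_coord_deriv[OF smooth_coord_deriv[OF f that] that]]])
      (simp add: case_prod_beta)
  then show "(\<lambda>(r, \<omega>). gen f m r \<omega>) \<in> borel_measurable (borel \<Otimes>\<^sub>M M)"
    using drift_density_joint[OF f, of "\<lambda>r \<omega>. coords e (X r \<omega>)", OF coords_joint] unfolding gen_def case_prod_beta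
    by (intro borel_measurable_add borel_measurable_sum borel_measurable_times) auto
  obtain B where B: "\<And>r \<omega>. \<bar>drift_density f m (\<lambda>\<omega>. coords e (X r \<omega>)) r \<omega>\<bar> \<le> B"
    using drift_density_bounded[OF f, of "\<lambda>r \<omega>. coords e (X r \<omega>)", OF coords_joint] by blast
  have "\<forall>i\<in>{..<m}. \<exists>K. \<forall>x. \<bar>coord_deriv i (coord_deriv i f) x\<bar> \<le> K"
    using smooth_bounded[OF smooth_coord_deriv[OF smooth_coord_deriv[OF f]]] by (metis lessThan_iff)
  then obtain K where K: "\<And>i x. i < m \<Longrightarrow> \<bar>coord_deriv i (coord_deriv i f) x\<bar> \<le> K i" by (metis lessThan_iff)
  have "\<bar>gen f m r \<omega>\<bar> \<le> (\<Sum>k<m. 1/2 * q k * K k) + B" for r \<omega>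
    unfolding gen_def
  proof (intro order.trans[OF abs_triangle_ineq] add_mono B order.trans[OF sum_abs] sum_mono)
    fix k assume "k \<in> {..<m}"
    then show "\<bar>1/2 * q k * coord_deriv k (coord_deriv k f) (coords e (X r \<omega>))\<bar> \<le> 1/2 * q k * K k"
      unfolding abs_mult using K q_pos[of k] by (intro mult_mono) auto
  qed
  then show "\<exists>B. \<forall>r \<omega>. \<bar>gen f m r \<omega>\<bar> \<le> B" by blast
qed

text \<open>Both densities contain the drift at the same time \<open>r\<close>, so \<open>F\<close>
  is never compared at two points. Only derivatives of \<open>f\<close> are, at points whose mean
  distance is of order \<open>sqrt (t - s)\<close>.\<close>

lemma density_deviation:
  assumes f: "smooth_compact_support m f"
  obtains A where "0 \<le> A" "\<And>s t r. 0 \<le> s \<Longrightarrow> s < t \<Longrightarrow> t \<le> s + 1 \<Longrightarrow> s \<le> r \<Longrightarrow> r \<le> t \<Longrightarrow>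
      \<bar>(\<Sum>k<m. 1/2 * q k * (\<integral>\<omega>. coord_deriv k (coord_deriv k f) (noise_mixed s t k \<omega>) \<partial>M)) +
        (\<integral>\<omega>. drift_density f m (noisy s t) r \<omega> \<partial>M) - (\<integral>\<omega>. gen f m r \<omega> \<partial>M)\<bar> \<le> A * sqrt (t - s)"
proof -
  have "\<exists>A. deviation_bound (coord_deriv k f) A" if "k < m" for k
    using smooth_deviation[OF smooth_coord_deriv[OF f that]] .
  then obtain A1 where A1: "\<And>k. k < m \<Longrightarrow> deviation_bound (coord_deriv k f) (A1 k)" by metis
  have "\<exists>A. deviation_bound (coord_deriv k (coord_deriv k f)) A" if "k < m" for k
    using smooth_deviation[OF smooth_coord_deriv[OF smooth_coord_deriv[OF f that] that]] .
  then obtain A2 where A2: "\<And>k. k < m \<Longrightarrow> deviation_bound (coord_deriv k (coord_deriv k f)) (A2 k)" by metis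
  define A where "A = (\<Sum>k<m. 1/2 * q k * A2 k) + (\<Sum>k<m. C * A1 k)"
  have "\<bar>(\<Sum>k<m. 1/2 * q k * (\<integral>\<omega>. coord_deriv k (coord_deriv k f) (noise_mixed s t k \<omega>) \<partial>M)) +
        (\<integral>\<omega>. drift_density f m (noisy s t) r \<omega> \<partial>M) - (\<integral>\<omega>. gen f m r \<omega> \<partial>M)\<bar> \<le> A * sqrt (t - s)"
    if st: "0 \<le> s" "s < t" "t \<le> s + 1" "s \<le> r" "r \<le> t" for s t r
  proof -
    let ?x = "\<lambda>\<omega>. coords e (X r \<omega>)"
    let ?d2 = "\<lambda>k. coord_deriv k (coord_deriv k f)"
    let ?F = "\<lambda>k \<omega>. inner (F (X r \<omega>)) (e k)"
    have mixed_rv: "(\<lambda>\<omega>. noise_mixed s t k \<omega> j) \<in> borel_measurable M" for k j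
      unfolding mixed_def using coords_rv[of s j] incr_rv[of s t j] st by auto
    have x_rv: "(\<lambda>\<omega>. ?x \<omega> j) \<in> borel_measurable M" for j using coords_rv st by simp
    have n_rv: "(\<lambda>\<omega>. noisy s t \<omega> j) \<in> borel_measurable M" for j using noisy_rv st by simp
    have F_rv: "?F k \<in> borel_measurable M" for k
      using measurable_compose[OF solution_rv[OF solution] F_borel, of r] st by simp
    have int2: "integrable M (\<lambda>\<omega>. ?d2 k (Y \<omega>))"
      if "k < m" "\<And>j. (\<lambda>\<omega>. Y \<omega> j) \<in> borel_measurable M" for k Y
      using smooth_integrable[OF smooth_coord_deriv[OF smooth_coord_deriv[OF f that(1)] that(1)] that(2)] .
    have intF: "integrable M (\<lambda>\<omega>. coord_deriv k f (Y \<omega>) * ?F k \<omega>)"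
      if "k < m" "\<And>j. (\<lambda>\<omega>. Y \<omega> j) \<in> borel_measurable M" for k Y
    proof (rule Bochner_Integration.integrable_bound)
      have i: "integrable M (\<lambda>\<omega>. coord_deriv k f (Y \<omega>))"
        using smooth_integrable[OF smooth_coord_deriv[OF f that(1)] that(2)] .
      then show "integrable M (\<lambda>\<omega>. coord_deriv k f (Y \<omega>) * C)" by simp
      show "(\<lambda>\<omega>. coord_deriv k f (Y \<omega>) * ?F k \<omega>) \<in> borel_measurable M"
        using i F_rv by (intro borel_measurable_times) auto
      show "AE \<omega> in M. norm (coord_deriv k f (Y \<omega>) * ?F k \<omega>) \<le> norm (coord_deriv k f (Y \<omega>) * C)"
        using F_coord_bound C_nonneg by (intro AE_I2) (auto simp: abs_mult intro!: mult_left_mono)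
    qed
    have int2m: "integrable M (\<lambda>\<omega>. ?d2 k (noise_mixed s t k \<omega>))"
      and int2x: "integrable M (\<lambda>\<omega>. ?d2 k (?x \<omega>))"
      and intFn: "integrable M (\<lambda>\<omega>. coord_deriv k f (noisy s t \<omega>) * ?F k \<omega>)"
      and intFx: "integrable M (\<lambda>\<omega>. coord_deriv k f (?x \<omega>) * ?F k \<omega>)"
      and int1n: "integrable M (\<lambda>\<omega>. coord_deriv k f (noisy s t \<omega>))"
      and int1x: "integrable M (\<lambda>\<omega>. coord_deriv k f (?x \<omega>))" if k: "k < m" for k
      by (rule int2[OF k], rule mixed_rv) (rule int2[OF k], rule x_rv, rule intF[OF k], rule n_rv,
        rule intF[OF k], rule x_rv, rule smooth_integrable[OF smooth_coord_deriv[OF f k]], rule n_rv,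
        rule smooth_integrable[OF smooth_coord_deriv[OF f k]], rule x_rv)
    have gen: "(\<integral>\<omega>. gen f m r \<omega> \<partial>M) = (\<Sum>k<m. 1/2 * q k * (\<integral>\<omega>. ?d2 k (?x \<omega>) \<partial>M)) +
        (\<Sum>k<m. \<integral>\<omega>. coord_deriv k f (?x \<omega>) * ?F k \<omega> \<partial>M)"
      unfolding gen_def drift_density_def
      using int2x intFx by (subst Bochner_Integration.integral_add)
        (auto intro!: Bochner_Integration.integrable_sum simp: Bochner_Integration.integral_sum)
    have dr: "(\<integral>\<omega>. drift_density f m (noisy s t) r \<omega> \<partial>M) =
        (\<Sum>k<m. \<integral>\<omega>. coord_deriv k f (noisy s t \<omega>) * ?F k \<omega> \<partial>M)"
      unfolding drift_density_def using intFn by (simp add: Bochner_Integration.integral_sum)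
    have b2: "\<bar>1/2 * q k * (\<integral>\<omega>. ?d2 k (noise_mixed s t k \<omega>) \<partial>M) - 1/2 * q k * (\<integral>\<omega>. ?d2 k (?x \<omega>) \<partial>M)\<bar>
        \<le> 1/2 * q k * (A2 k * sqrt (t - s))" if k: "k < m" for k
    proof -
      have "1/2 * q k * (\<integral>\<omega>. ?d2 k (noise_mixed s t k \<omega>) \<partial>M) - 1/2 * q k * (\<integral>\<omega>. ?d2 k (?x \<omega>) \<partial>M) =
          1/2 * q k * (\<integral>\<omega>. ?d2 k (noise_mixed s t k \<omega>) - ?d2 k (?x \<omega>) \<partial>M)"
        using int2m[OF k] int2x[OF k] by (simp add: Bochner_Integration.integral_diff right_diff_distrib)
      note arg_cong[OF this, where f = abs]
      also have "\<bar>\<dots>\<bar> = 1/2 * q k * \<bar>\<integral>\<omega>. ?d2 k (noise_mixed s t k \<omega>) - ?d2 k (?x \<omega>) \<partial>M\<bar>"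
        using q_pos[of k] by (simp add: abs_mult)
      also have "\<dots> \<le> 1/2 * q k * (A2 k * sqrt (t - s))"
        using q_pos[of k]
        by (intro mult_left_mono order.trans[OF integral_abs_bound] deviation_boundD[OF A2[OF k] st] mixed_rv) (auto simp: mixed_def)
      finally show ?thesis .
    qed
    have b1: "\<bar>(\<integral>\<omega>. coord_deriv k f (noisy s t \<omega>) * ?F k \<omega> \<partial>M) - (\<integral>\<omega>. coord_deriv k f (?x \<omega>) * ?F k \<omega> \<partial>M)\<bar>
        \<le> C * (A1 k * sqrt (t - s))" if k: "k < m" for k
    proof -
      let ?diff = "\<lambda>\<omega>. coord_deriv k f (noisy s t \<omega>) - coord_deriv k f (?x \<omega>)"
      have "integrable M ?diff"
        using int1n[OF k] int1x[OF k] by (rule Bochner_Integration.integrable_diff)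
      have "(\<integral>\<omega>. coord_deriv k f (noisy s t \<omega>) * ?F k \<omega> \<partial>M) - (\<integral>\<omega>. coord_deriv k f (?x \<omega>) * ?F k \<omega> \<partial>M) =
          (\<integral>\<omega>. ?diff \<omega> * ?F k \<omega> \<partial>M)"
        using intFn[OF k] intFx[OF k] by (simp add: Bochner_Integration.integral_diff left_diff_distrib)
      note arg_cong[OF this, where f = abs]
      also have "\<bar>\<dots>\<bar> \<le> (\<integral>\<omega>. \<bar>?diff \<omega> * ?F k \<omega>\<bar> \<partial>M)" by (rule integral_abs_bound)
      also have "\<dots> \<le> (\<integral>\<omega>. C * \<bar>?diff \<omega>\<bar> \<partial>M)"
      proof (rule integral_mono)
        show "integrable M (\<lambda>\<omega>. \<bar>?diff \<omega> * ?F k \<omega>\<bar>)"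
          using intFn[OF k] intFx[OF k] by (simp add: left_diff_distrib)
        show "integrable M (\<lambda>\<omega>. C * \<bar>?diff \<omega>\<bar>)" using \<open>integrable M ?diff\<close> by simp
        show "\<bar>?diff \<omega> * ?F k \<omega>\<bar> \<le> C * \<bar>?diff \<omega>\<bar>" for \<omega>
          unfolding abs_mult using F_coord_bound[of "X r \<omega>" k]
          by (simp add: mult.commute[of C] mult_left_mono)
      qed
      also have "\<dots> = C * (\<integral>\<omega>. \<bar>?diff \<omega>\<bar> \<partial>M)" by simp
      also have "\<dots> \<le> C * (A1 k * sqrt (t - s))"
        by (intro mult_left_mono C_nonneg deviation_boundD[OF A1[OF k] st] n_rv) (simp add: noisy_def)
      finally show ?thesis .
    qed
    have "\<bar>(\<Sum>k<m. 1/2 * q k * (\<integral>\<omega>. ?d2 k (noise_mixed s t k \<omega>) \<partial>M)) +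
        (\<integral>\<omega>. drift_density f m (noisy s t) r \<omega> \<partial>M) - (\<integral>\<omega>. gen f m r \<omega> \<partial>M)\<bar> =
      \<bar>(\<Sum>k<m. 1/2 * q k * (\<integral>\<omega>. ?d2 k (noise_mixed s t k \<omega>) \<partial>M) - 1/2 * q k * (\<integral>\<omega>. ?d2 k (?x \<omega>) \<partial>M)) +
       (\<Sum>k<m. (\<integral>\<omega>. coord_deriv k f (noisy s t \<omega>) * ?F k \<omega> \<partial>M) - (\<integral>\<omega>. coord_deriv k f (?x \<omega>) * ?F k \<omega> \<partial>M))\<bar>"
      unfolding gen dr by (simp add: sum_subtractf)
    also have "\<dots> \<le> (\<Sum>k<m. 1/2 * q k * (A2 k * sqrt (t - s))) + (\<Sum>k<m. C * (A1 k * sqrt (t - s)))"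
      using b1 b2 by (intro order.trans[OF abs_triangle_ineq] add_mono order.trans[OF sum_abs] sum_mono) auto
    also have "\<dots> = A * sqrt (t - s)" by (simp add: A_def sum_distrib_right distrib_right mult.assoc)
    finally show ?thesis .
  qed
  moreover have "0 \<le> A" unfolding A_def using A1 A2 C_nonneg q_pos unfolding deviation_bound_def
    by (intro add_nonneg_nonneg sum_nonneg mult_nonneg_nonneg) (auto intro: less_imp_le)
  ultimately show ?thesis using that by blast
qed

text \<open>The noise step has an error of order 3/2, the drift step one of order 2, and the
  deviation of the densities, of order 1/2, is integrated over the step. The restriction to steps of
  length at most 1 lets order 3/2 dominate.\<close>

lemma ito_step:
  assumes f: "smooth_compact_support m f"
  obtains A where "0 \<le> A" "\<And>s t. 0 \<le> s \<Longrightarrow> s < t \<Longrightarrow> t \<le> s + 1 \<Longrightarrow>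
      \<bar>(\<integral>\<omega>. f (coords e (X t \<omega>)) \<partial>M) - (\<integral>\<omega>. f (coords e (X s \<omega>)) \<partial>M) -
        (LINT r:{s<..t}|lborel. (\<integral>\<omega>. gen f m r \<omega> \<partial>M))\<bar> \<le> A * sqrt (t - s) ^ 3"
proof -
  obtain A1 where A1: "0 \<le> A1" "\<And>s t. 0 \<le> s \<Longrightarrow> s < t \<Longrightarrow>
      \<bar>(\<integral>\<omega>. f (coords e (X t \<omega>)) \<partial>M) - (\<integral>\<omega>. f (noisy s t \<omega>) \<partial>M) -
        (LINT r:{s<..t}|lborel. (\<integral>\<omega>. drift_density f m (noisy s t) r \<omega> \<partial>M))\<bar> \<le> A1 * (t - s)\<^sup>2"
    using drift_step[OF f] by blast
  obtain A2 where A2: "0 \<le> A2" "\<And>s t. 0 \<le> s \<Longrightarrow> s < t \<Longrightarrow>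
      \<bar>(\<integral>\<omega>. f (noisy s t \<omega>) \<partial>M) - (\<integral>\<omega>. f (coords e (X s \<omega>)) \<partial>M) -
        (t - s) * (\<Sum>k<m. 1/2 * q k * (\<integral>\<omega>. coord_deriv k (coord_deriv k f) (noise_mixed s t k \<omega>) \<partial>M))\<bar>
      \<le> A2 * sqrt (t - s) ^ 3"
    using noise_step[OF f] by blast
  obtain A3 where A3: "0 \<le> A3" "\<And>s t r. 0 \<le> s \<Longrightarrow> s < t \<Longrightarrow> t \<le> s + 1 \<Longrightarrow> s \<le> r \<Longrightarrow> r \<le> t \<Longrightarrow>
      \<bar>(\<Sum>k<m. 1/2 * q k * (\<integral>\<omega>. coord_deriv k (coord_deriv k f) (noise_mixed s t k \<omega>) \<partial>M)) +
        (\<integral>\<omega>. drift_density f m (noisy s t) r \<omega> \<partial>M) - (\<integral>\<omega>. gen f m r \<omega> \<partial>M)\<bar> \<le> A3 * sqrt (t - s)"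
    using density_deviation[OF f] by blast
  have "\<bar>(\<integral>\<omega>. f (coords e (X t \<omega>)) \<partial>M) - (\<integral>\<omega>. f (coords e (X s \<omega>)) \<partial>M) -
        (LINT r:{s<..t}|lborel. (\<integral>\<omega>. gen f m r \<omega> \<partial>M))\<bar> \<le> (A1 + A2 + A3) * sqrt (t - s) ^ 3"
    if st: "0 \<le> s" "s < t" "t \<le> s + 1" for s t
  proof -
    define a where "a = (\<Sum>k<m. 1/2 * q k * (\<integral>\<omega>. coord_deriv k (coord_deriv k f) (noise_mixed s t k \<omega>) \<partial>M))"
    define b where "b r = (\<integral>\<omega>. drift_density f m (noisy s t) r \<omega> \<partial>M)" for r
    define g where "g r = (\<integral>\<omega>. gen f m r \<omega> \<partial>M)" for r
    have joint: "(\<lambda>(r :: real, \<omega>). noisy s t \<omega> j) \<in> borel_measurable (borel \<Otimes>\<^sub>M M)" for j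
      unfolding case_prod_beta by (rule measurable_compose[OF measurable_snd noisy_rv]) (use st in auto)
    have st': "s \<le> t" using st by simp
    obtain B where B: "\<And>r \<omega>. \<bar>drift_density f m (noisy s t) r \<omega>\<bar> \<le> B"
      using drift_density_bounded[OF f, of "\<lambda>_. noisy s t", OF joint] by blast
    have b: "set_integrable lborel {s<..t} b"
      unfolding b_def
      by (rule bounded_process_integrable(2)[OF drift_density_joint[OF f, of "\<lambda>_. noisy s t", OF joint] B st'])
    obtain B' where B': "\<And>r \<omega>. \<bar>gen f m r \<omega>\<bar> \<le> B'" using gen_bounded[OF f] by blast
    have g: "set_integrable lborel {s<..t} g"
      unfolding g_def by (rule bounded_process_integrable(2)[OF gen_joint[OF f] B' st'])
    have c: "set_integrable lborel {s<..t} (\<lambda>_. c)" for c :: real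
    proof -
      have "integrable lborel (indicat_real {s<..t})" using st by (intro integrable_real_indicator) auto
      then show ?thesis by (simp add: set_integrable_def)
    qed
    \<comment> \<open>The diffusion part \<open>a\<close> does not depend on \<open>r\<close>; as a
      constant density it joins \<open>b\<close> under the time integral, where it can be compared
      with \<open>g\<close> for each \<open>r\<close>.\<close>
    have "\<bar>(t - s) * a + (LINT r:{s<..t}|lborel. b r) - (LINT r:{s<..t}|lborel. g r)\<bar> =
        \<bar>LINT r:{s<..t}|lborel. a + b r - g r\<bar>"
      using b g c st by (simp add: set_integral_add set_integral_diff set_integral_const)
    also have "\<dots> \<le> (LINT r:{s<..t}|lborel. \<bar>a + b r - g r\<bar>)"
      using set_integral_norm_bound[of lborel "{s<..t}" "\<lambda>r. a + b r - g r"] b g c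
      by (simp add: set_integral_add set_integral_diff)
    also have "\<dots> \<le> (LINT r:{s<..t}|lborel. A3 * sqrt (t - s))"
    proof (rule set_integral_mono)
      show "set_integrable lborel {s<..t} (\<lambda>r. \<bar>a + b r - g r\<bar>)"
        using b g c by (intro set_integrable_abs set_integral_add set_integral_diff) auto
    qed (use A3(2)[OF st] c in \<open>auto simp: a_def b_def g_def\<close>)
    also have "\<dots> = A3 * sqrt (t - s) ^ 3"
      using st by (simp add: set_integral_const eval_nat_numeral)
    finally have 3: "\<bar>(t - s) * a + (LINT r:{s<..t}|lborel. b r) - (LINT r:{s<..t}|lborel. g r)\<bar> \<le> A3 * sqrt (t - s) ^ 3" .
    have "(t - s)\<^sup>2 = sqrt (t - s) ^ 3 * sqrt (t - s)"
      using st by (simp add: eval_nat_numeral)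
    also have "\<dots> \<le> sqrt (t - s) ^ 3 * 1" using st by (intro mult_left_mono) auto
    finally have "A1 * (t - s)\<^sup>2 \<le> A1 * sqrt (t - s) ^ 3" using A1(1) by (intro mult_left_mono) auto
    with A1(2)[OF st(1,2)] A2(2)[OF st(1,2)] 3 show ?thesis
      unfolding a_def[symmetric] b_def[symmetric] g_def[symmetric] distrib_right by linarith
  qed
  moreover have "0 \<le> A1 + A2 + A3" using A1(1) A2(1) A3(1) by simp
  ultimately show ?thesis using that by blast
qed

text \<open>The time integral belongs to \<open>\<psi>\<close> itself, so \<open>ito_step\<close>
  bounds the difference quotients of \<open>\<psi>\<close> directly. This matters because
  \<open>g\<close> comes without any continuity in time.\<close>

lemma ito_formula:
  assumes f: "smooth_compact_support m f" and t: "0 \<le> t"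
  shows "(\<integral>\<omega>. f (coords e (X t \<omega>)) \<partial>M) - (\<integral>\<omega>. f (coords e (X 0 \<omega>)) \<partial>M) =
    (LINT r:{0<..t}|lborel. (\<integral>\<omega>. gen f m r \<omega> \<partial>M))"
proof -
  define g where "g r = (\<integral>\<omega>. gen f m r \<omega> \<partial>M)" for r
  define \<psi> where "\<psi> t = (\<integral>\<omega>. f (coords e (X t \<omega>)) \<partial>M) - (LINT r:{0<..t}|lborel. g r)" for t
  obtain A where A: "0 \<le> A" "\<And>s t. 0 \<le> s \<Longrightarrow> s < t \<Longrightarrow> t \<le> s + 1 \<Longrightarrow>
      \<bar>(\<integral>\<omega>. f (coords e (X t \<omega>)) \<partial>M) - (\<integral>\<omega>. f (coords e (X s \<omega>)) \<partial>M) -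
        (LINT r:{s<..t}|lborel. g r)\<bar> \<le> A * sqrt (t - s) ^ 3"
    using ito_step[OF f] unfolding g_def by blast
  obtain B where B: "\<And>r \<omega>. \<bar>gen f m r \<omega>\<bar> \<le> B" using gen_bounded[OF f] by blast
  have g: "set_integrable lborel {s<..t} g" if "s \<le> t" for s t
    unfolding g_def using bounded_process_integrable(2)[OF gen_joint[OF f] B that] .
  have step: "\<bar>\<psi> t - \<psi> s\<bar> \<le> A * sqrt (t - s) ^ 3" if st: "0 \<le> s" "s < t" "t \<le> s + 1" for s t
  proof -
    have "(LINT r:{0<..s} \<union> {s<..t}|lborel. g r) = (LINT r:{0<..s}|lborel. g r) + (LINT r:{s<..t}|lborel. g r)"
      by (rule set_integral_Un) (use g st in auto)
    moreover have "{0<..s} \<union> {s<..t} = {0<..t}" using st by auto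
    ultimately show ?thesis using A(2)[OF st] by (simp add: \<psi>_def algebra_simps)
  qed
  have "(\<psi> has_derivative (\<lambda>h. 0)) (at x within {0..})" if "x \<in> {0..}" for x
  proof -
    \<comment> \<open>An error of order 3/2 divided by the step leaves a square root, whether
      \<open>y\<close> lies before or after \<open>x\<close>; at 0 the derivative is
      one-sided.\<close>
    have "((\<lambda>y. (\<psi> y - \<psi> x) / (y - x)) \<longlongrightarrow> 0) (at x within {0..})"
    proof (rule Lim_null_comparison)
      show "((\<lambda>y. A * sqrt \<bar>y - x\<bar>) \<longlongrightarrow> 0) (at x within {0..})"
        by (auto intro!: tendsto_eq_intros)
      have "norm ((\<psi> y - \<psi> x) / (y - x)) \<le> A * sqrt \<bar>y - x\<bar>" if "y \<in> {0..}" "y \<noteq> x" "dist y x < 1" for y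
      proof -
        have "\<bar>\<psi> y - \<psi> x\<bar> \<le> A * sqrt \<bar>y - x\<bar> ^ 3"
          using step[of x y] step[of y x] that \<open>x \<in> {0..}\<close>
          by (cases "x < y") (auto simp: dist_real_def abs_minus_commute)
        also have "\<dots> = A * sqrt \<bar>y - x\<bar> * \<bar>y - x\<bar>" by (simp add: eval_nat_numeral)
        finally show ?thesis using that by (simp add: field_simps)
      qed
      then show "\<forall>\<^sub>F y in at x within {0..}. norm ((\<psi> y - \<psi> x) / (y - x)) \<le> A * sqrt \<bar>y - x\<bar>"
        unfolding eventually_at by (intro exI[of _ 1]) auto
    qed
    then have "(\<psi> has_real_derivative 0) (at x within {0..})"
      by (simp add: has_field_derivative_iff)
    then show ?thesis by (simp add: has_field_derivative_def lambda_zero)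
  qed
  then obtain c where "\<forall>x\<in>{0..}. \<psi> x = c"
    using has_derivative_zero_constant[of "{0..}" \<psi>] by auto
  then have "\<psi> t = \<psi> 0" using t by simp
  moreover have "(LINT r:{0<..0}|lborel. g r) = 0" by (simp add: set_lebesgue_integral_def)
  ultimately show ?thesis unfolding \<psi>_def g_def[symmetric] by linarith
qed

section \<open>From the expansion to the Cauchy problem\<close>

lemma W_0: "AE \<omega> in M. W 0 \<omega> = 0"
proof -
  have "AE \<omega> in M. \<forall>j. \<beta> j 0 \<omega> = 0" using \<beta>_0 by (simp add: AE_all_countable)
  with W_sums[OF order_refl] show ?thesis
  proof eventually_elim
    case (elim \<omega>)
    then have "(\<lambda>j. 0) sums W 0 \<omega>" by simp
    then show ?case using sums_0 sums_unique2 by blast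
  qed
qed

lemma X_0: "AE \<omega> in M. X 0 \<omega> = \<eta> \<omega>"
proof -
  have "AE \<omega> in M. \<forall>t\<ge>0. set_integrable lborel {0..t} (\<lambda>s. F (X s \<omega>)) \<and>
      X t \<omega> = \<eta> \<omega> + W t \<omega> + (LINT s:{0..t}|lborel. F (X s \<omega>))"
    using solution unfolding strong_solution_def by blast
  with W_0 show ?thesis
  proof eventually_elim
    case (elim \<omega>)
    have "(LINT s:{0..0}|lborel. F (X s \<omega>)) = 0"
      unfolding set_lebesgue_integral_def
      by (rule integral_eq_zero_AE) (use AE_lborel_singleton[of 0] in \<open>auto elim!: eventually_mono\<close>)
    with elim show ?case by auto
  qed
qed

text \<open>Joint measurability of the solution makes its laws measurable in time, and
  \<open>ito_formula\<close> becomes the integrated equation once expectations are written as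
  integrals against the laws.\<close>

lemma laws_probability_solution:
  "probability_solution e q F (distr M borel \<eta>) (\<lambda>t. distr M borel (X t))"
  unfolding probability_solution_def
proof (intro conjI allI impI ballI)
  have "case_prod X \<in> measurable (restrict_space borel {0..} \<Otimes>\<^sub>M M) borel"
  proof -
    have "(\<lambda>p. (fst p, snd p)) \<in> measurable (restrict_space borel {0..} \<Otimes>\<^sub>M M) (borel \<Otimes>\<^sub>M M)"
      by (intro measurable_Pair measurable_compose[OF measurable_fst] measurable_restrict_space1
          measurable_snd) auto
    from measurable_compose[OF this X_joint] show ?thesis by (simp add: case_prod_beta')
  qed
  moreover have "(\<lambda>_. M) \<in> measurable (restrict_space borel {0..}) (subprob_algebra M)"
    using prob_space_axioms prob_space_imp_subprob_space by (auto simp: space_subprob_algebra)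
  ultimately have "(\<lambda>t. distr M borel (X t)) \<in> measurable (restrict_space borel {0..}) (subprob_algebra borel)"
    by (rule measurable_distr2)
  then show "(\<lambda>t. distr M borel (X t)) \<in> measurable (restrict_space borel {0..}) (prob_algebra borel)"
    using solution_rv[OF solution]
    by (intro measurable_prob_algebraI prob_space_distr) (auto simp: space_restrict_space)
next
  fix t :: real and \<phi> assume t: "0 \<le> t" and "\<phi> \<in> FC0_infinity e"
  then obtain m f where f: "smooth_compact_support m f" and \<phi>: "\<phi> = (\<lambda>x. f (coords e x))"
    unfolding FC0_infinity_def coords_def by blast
  have coord_meas: "(\<lambda>x. coords e x j) \<in> borel_measurable borel" for j
    unfolding coords_def by simp
  have \<phi>_meas: "(\<lambda>x. g (coords e x)) \<in> borel_measurable borel" if "smooth_compact_support m g" for g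
    by (rule cylinder_measurable[OF smooth_continuous[OF that]], rule coord_meas)
  have gen_meas: "generator e q F \<phi> \<in> borel_measurable borel"
  proof -
    have "(\<lambda>x. (\<Sum>i<m. 1/2 * q i * coord_deriv i (coord_deriv i f) (coords e x)) +
        (\<Sum>i<m. inner (F x) (e i) * coord_deriv i f (coords e x))) \<in> borel_measurable borel"
      using \<phi>_meas smooth_coord_deriv[OF f] smooth_coord_deriv[OF smooth_coord_deriv[OF f]]
      by (intro borel_measurable_add borel_measurable_sum borel_measurable_times borel_measurable_const
          borel_measurable_inner F_borel) auto
    then show ?thesis
      unfolding \<phi> by (subst measurable_cong[OF generator_cylinder[OF basis f]])
  qed
  have X_rv: "X r \<in> borel_measurable M" if "0 \<le> r" for r using solution_rv[OF solution that] .
  have gen_eq: "generator e q F \<phi> (X r \<omega>) = gen f m r \<omega>" for r \<omega>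
    unfolding \<phi> generator_cylinder[OF basis f] gen_def drift_density_def by (simp add: mult.commute)
  have g_meas: "(\<lambda>r. \<integral>\<omega>. gen f m r \<omega> \<partial>M) \<in> borel_measurable borel"
    by (rule borel_measurable_lebesgue_integral[OF gen_joint[OF f]])
  have "(LINT s:{0..t}|lborel. (\<integral>x. generator e q F \<phi> x \<partial>distr M borel (X s))) =
      (LINT s:{0..t}|lborel. (\<integral>\<omega>. gen f m s \<omega> \<partial>M))"
    using X_rv gen_meas by (intro set_lebesgue_integral_cong) (auto simp: integral_distr gen_eq)
  \<comment> \<open>The Cauchy problem integrates over a closed interval, the expansion over
    half-open ones; they differ by a null set.\<close>
  also have "\<dots> = (LINT s:{0<..t}|lborel. (\<integral>\<omega>. gen f m s \<omega> \<partial>M))"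
  proof (rule set_integral_cong_set)
    show "set_borel_measurable lborel {0..t} (\<lambda>s. \<integral>\<omega>. gen f m s \<omega> \<partial>M)"
      "set_borel_measurable lborel {0<..t} (\<lambda>s. \<integral>\<omega>. gen f m s \<omega> \<partial>M)"
      unfolding set_borel_measurable_def using g_meas by auto
    show "AE x in lborel. (x \<in> {0<..t}) = (x \<in> {0..t})"
      using AE_lborel_singleton[of 0] by (auto elim!: eventually_mono)
  qed
  also have "\<dots> = (\<integral>\<omega>. \<phi> (X t \<omega>) \<partial>M) - (\<integral>\<omega>. \<phi> (X 0 \<omega>) \<partial>M)"
    unfolding \<phi> using ito_formula[OF f t] by simp
  also have "(\<integral>\<omega>. \<phi> (X 0 \<omega>) \<partial>M) = (\<integral>\<omega>. \<phi> (\<eta> \<omega>) \<partial>M)"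
    using X_0 measurable_compose[OF X_rv[of 0] \<phi>_meas[OF f]] measurable_compose[OF \<eta>_rv \<phi>_meas[OF f]]
    unfolding \<phi> by (intro integral_cong_AE) (auto elim!: eventually_mono)
  finally show "(\<integral>x. \<phi> x \<partial>distr M borel (X t)) - (\<integral>x. \<phi> x \<partial>distr M borel \<eta>) =
      (LINT s:{0..t}|lborel. (\<integral>x. generator e q F \<phi> x \<partial>distr M borel (X s)))"
    using X_rv[OF t] \<eta>_rv \<phi>_meas[OF f] by (simp add: integral_distr \<phi>)
qed

end

section \<open>Positive mass of ellipsoids\<close>

theorem theorem2p1:
  fixes M :: "'w measure"
    and Q :: "'a \<Rightarrow> 'a::{real_inner, banach, second_countable_topology}"
    and e :: "nat \<Rightarrow> 'a"
    and q :: "nat \<Rightarrow> real"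
    and W :: "real \<Rightarrow> 'w \<Rightarrow> 'a"
    and F :: "'a \<Rightarrow> 'a"
    and \<eta> :: "'w \<Rightarrow> 'a"
    and T R :: real
    and a :: 'a
  assumes "prob_space M"
    and "positive_trace_class_diag Q e q"
    and "wiener_process M e q W"
    and "F \<in> borel_measurable borel"
    and ii: "bounded (range F)"
    and iii: "\<And>\<eta>. \<eta> \<in> V_infinity M \<Longrightarrow> independent_of_process M \<eta> W \<Longrightarrow>
               (\<exists>X. strong_solution M W F \<eta> X \<and> (\<forall>t\<ge>0. X t \<in> V_infinity M)) \<and>
               has_unique_probability_solution e q F (distr M borel \<eta>)"
    and "\<eta> \<in> V_infinity M"
    and "independent_of_process M \<eta> W"
    and "0 < T" and "0 < R"
  shows "(\<forall>\<mu>. probability_solution e q F (distr M borel \<eta>) \<mu> \<longrightarrow>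
              0 < measure (\<mu> T) (ellipsoid Q R a)) \<and>
         (\<forall>X. strong_solution M W F \<eta> X \<longrightarrow>
              0 < measure M {\<omega> \<in> space M. X T \<omega> \<in> ellipsoid Q R a})"
proof -
  interpret prob_space M by fact
  obtain \<beta> where \<beta>: "\<And>j. standard_real_wiener M (\<beta> j)"
    "indep_vars (\<lambda>_. path_space) (\<lambda>j. path_of (\<beta> j)) UNIV"
    "\<And>t. 0 \<le> t \<Longrightarrow> AE \<omega> in M. (\<lambda>j. (sqrt (q j) * \<beta> j t \<omega>) *\<^sub>R e j) sums W t \<omega>"
    using assms(3) unfolding wiener_process_def by blast
  have Q: "bounded_linear Q" "orthonormal_basis e" "\<And>j. 0 < q j" "\<And>j. q j \<le> 1"
    using assms(2) unfolding positive_trace_class_diag_def decseq_def by (auto, metis zero_le)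
  interpret hilbert_wiener M e q W \<beta> \<eta>
    by unfold_locales (use Q \<beta> assms(3,7,8) in \<open>auto simp: wiener_process_def V_infinity_def\<close>)
  obtain C where C: "\<And>x. norm (F x) \<le> C" using ii by (auto simp: bounded_iff)
  \<comment> \<open>Closedness makes the ellipsoid Borel, hence the set in question an
    event.\<close>
  have Q_closed: "closed (ellipsoid Q R a)" by (rule closed_ellipsoid[OF Q(1)])
  have pos: "0 < prob {\<omega> \<in> space M. X T \<omega> \<in> ellipsoid Q R a}" if X: "strong_solution M W F \<eta> X" for X
  proof -
    have [measurable]: "X T \<in> borel_measurable M" using solution_rv[OF X] assms(9) by simp
    have [measurable]: "ellipsoid Q R a \<in> sets borel" using Q_closed by simp
    have "0 < prob {\<omega> \<in> space M. norm (X T \<omega> - a) < R}"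
      by (rule solution_ball_pos[OF X C assms(9,10)])
    also have "\<dots> \<le> prob {\<omega> \<in> space M. X T \<omega> \<in> ellipsoid Q R a}"
    proof (rule finite_measure_mono)
      show "{\<omega> \<in> space M. norm (X T \<omega> - a) < R} \<subseteq> {\<omega> \<in> space M. X T \<omega> \<in> ellipsoid Q R a}"
        using order.trans[OF Q_norm_le_norm[OF assms(2)] less_imp_le] by (auto simp: ellipsoid_def)
    qed measurable
    finally show ?thesis .
  qed
  moreover have "0 < measure (\<mu> T) (ellipsoid Q R a)"
    if \<mu>: "probability_solution e q F (distr M borel \<eta>) \<mu>" for \<mu>
  proof -
    obtain X where X: "strong_solution M W F \<eta> X" using iii[OF assms(7,8)] by blast
    obtain Z where Z: "strong_solution M W F \<eta> Z" "(\<lambda>(t, \<omega>). Z t \<omega>) \<in> borel_measurable (borel \<Otimes>\<^sub>M M)"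
      using solution_modification[OF X C] .
    interpret bounded_solution M e q W \<beta> \<eta> F C Z
      by unfold_locales (rule assms(4) C Z)+
    \<comment> \<open>Uniqueness identifies \<open>\<mu>\<close> with the laws of the jointly
      measurable modification \<open>Z\<close>, which is itself a strong solution and therefore also
      covered by \<open>pos\<close>.\<close>
    have "\<mu> T = distr M borel (Z T)"
      using iii[OF assms(7,8)] \<mu> laws_probability_solution assms(9)
      unfolding has_unique_probability_solution_def by (metis less_imp_le)
    moreover have "measure (distr M borel (Z T)) (ellipsoid Q R a) = prob {\<omega> \<in> space M. Z T \<omega> \<in> ellipsoid Q R a}"
      using solution_rv[OF Z(1), of T] assms(9) Q_closed
      by (subst measure_distr) (auto intro!: arg_cong[where f = prob])
    ultimately show ?thesis using pos[OF Z(1)] by simp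
  qed
  ultimately show ?thesis by blast
qed

end
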